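(* Let $1\le p\le 2$ and let $n\ge 2$ be an integer. Then there exists a constant $C=C(p,n)>0$ (independent of $f$ and of $t$) such that the following hold for all $t>0$. (1) If $1<p<2$, $\frac1p+\frac1q=1$, and $f\in L^p(\mathbb{R}^n)$, then $$\left(\int_{\mathbb{R}^n}\min\{1,(t|\xi|)^{2q}\}\,|\widehat f(\xi)|^q\,d\xi\right)^{1/q}\le C\,\|M^tf-f\|_p .$$ (2) If $p=1$ and $f\in L^1(\mathbb{R}^n)$, then $$\sup_{\xi\in\mathbb{R}^n}\Big[\min\{1,(t|\xi|)^2\}\,|\widehat f(\xi)|\Big]\le C\,\|M^tf-f\|_1 .$$ (3) If $p=2$ and $f\in L^2(\mathbb{R}^n)$, then $$\left(\int_{\mathbb{R}^n}\min\{1,(t|\xi|)^{4}\}\,|\widehat f(\xi)|^2\,d\xi\right)^{1/2}\asymp\|M^tf-f\|_2 ,$$ meaning that the left-hand side is bounded above and below by positive constants (depending only on $n$) times the right-hand side.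
   Context: For $t>0$ the spherical mean of $f$ is $$M^tf(x)=\frac1{\omega_{n-1}}\int_{S^{n-1}}f(x+t\omega)\,d\omega,$$ where $S^{n-1}$ is the unit sphere in $\mathbb{R}^n$, $d\omega$ is the usual induced surface measure, and $\omega_{n-1}$ is its total mass. $\|\cdot\|_p$ is the norm of $L^p(\mathbb{R}^n)$. The Fourier transform is $\widehat f(\xi)=\int_{\mathbb{R}^n}f(x)e^{-ix\cdot\xi}\,dx$ (up to a fixed normalizing constant), extended to $L^p(\mathbb{R}^n)$, $1<p\le 2$, in the standard way (Hausdorff-Young/Plancherel). *)

theory Defs
  imports "HOL-Analysis.Analysis"
begin

text \<open>Powers in \<open>[0,\<infinity>]\<close>; only used with exponent \<open>a > 0\<close>, where \<open>\<infinity>\<close> to the power \<open>a\<close> is \<open>\<infinity>\<close>.\<close>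

definition enn_powr :: "ennreal \<Rightarrow> real \<Rightarrow> ennreal" where
  "enn_powr x a = (if x = \<infinity> then \<infinity> else ennreal (enn2real x powr a))"

text \<open>Norms take values in \<open>[0,\<infinity>]\<close>, so that no divergent integral is silently read as \<open>0\<close>.
  Elements of \<open>L\<^sup>p\<close> are Lebesgue measurable functions, not identified almost everywhere.\<close>

definition Lp_norm :: "real \<Rightarrow> ('a::euclidean_space \<Rightarrow> complex) \<Rightarrow> ennreal" where
  "Lp_norm p f = enn_powr (\<integral>\<^sup>+ x. ennreal (norm (f x) powr p) \<partial>lebesgue) (1 / p)"

definition Lp :: "real \<Rightarrow> ('a::euclidean_space \<Rightarrow> complex) set" where
  "Lp p = {f \<in> borel_measurable lebesgue. Lp_norm p f < \<infinity>}"

text \<open>Surface measure on the unit sphere as the measure of polar coordinates: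
  \<open>\<sigma>(A) = n \<cdot> vol {r \<omega> | 0 < r \<le> 1, \<omega> \<in> A}\<close> for Borel sets \<open>A\<close> (see \<open>emeasure_surface_measure\<close>
  below); note \<open>sgn x = x / |x|\<close>.  It is completed, because for Lebesgue measurable \<open>f\<close> the
  function \<open>\<omega> \<mapsto> f (x + t \<omega>)\<close> is, for almost every \<open>x\<close>, measurable only up to a null set.\<close>

definition surface_measure :: "'a::euclidean_space measure" where
  "surface_measure = completion (scale_measure (of_nat DIM('a))
     (distr (restrict_space lborel (cball 0 1 - {0})) (restrict_space borel (sphere 0 1)) sgn))"

definition spherical_mean :: "real \<Rightarrow> ('a::euclidean_space \<Rightarrow> complex) \<Rightarrow> 'a \<Rightarrow> complex" where
  "spherical_mean t f x =
     (LINT \<omega>|surface_measure. f (x + t *\<^sub>R \<omega>)) /\<^sub>R measure (surface_measure :: 'a measure) (sphere 0 1)"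

definition fourier :: "('a::euclidean_space \<Rightarrow> complex) \<Rightarrow> 'a \<Rightarrow> complex" where
  "fourier f \<xi> = (LINT x|lebesgue. f x * exp (- \<i> * complex_of_real (x \<bullet> \<xi>)))"

text \<open>Continuous extension of \<open>fourier\<close> from the dense subspace \<open>L\<^sup>1 \<inter> L\<^sup>p\<close> to
  \<open>L\<^sup>p \<rightarrow> L\<^sup>q\<close>, \<open>q = p / (p - 1)\<close>, for \<open>1 < p \<le> 2\<close>.  By the Hausdorff-Young inequality such an
  \<open>F\<close> exists and is unique almost everywhere; \<open>fourier_Lp\<close> picks one representative.\<close>

definition is_fourier_Lp ::
    "real \<Rightarrow> ('a::euclidean_space \<Rightarrow> complex) \<Rightarrow> ('a \<Rightarrow> complex) \<Rightarrow> bool" where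
  "is_fourier_Lp p f F \<longleftrightarrow> F \<in> Lp (p / (p - 1)) \<and>
     (\<exists>g :: nat \<Rightarrow> 'a \<Rightarrow> complex. (\<forall>k. g k \<in> Lp 1 \<inter> Lp p) \<and>
        (\<lambda>k. Lp_norm p (\<lambda>x. g k x - f x)) \<longlonglongrightarrow> 0 \<and>
        (\<lambda>k. Lp_norm (p / (p - 1)) (\<lambda>\<xi>. fourier (g k) \<xi> - F \<xi>)) \<longlonglongrightarrow> 0)"

definition fourier_Lp :: "real \<Rightarrow> ('a::euclidean_space \<Rightarrow> complex) \<Rightarrow> 'a \<Rightarrow> complex" where
  "fourier_Lp p f = (SOME F. is_fourier_Lp p f F)"

lemma sgn_measurable_sphere:
  "sgn \<in> measurable (restrict_space lborel (cball 0 1 - {0 :: 'a::euclidean_space}))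
     (restrict_space borel (sphere 0 1))"
proof (rule measurable_restrict_space2)
  show "sgn \<in> space (restrict_space lborel (cball 0 1 - {0::'a})) \<rightarrow> sphere 0 1"
    by (auto simp: space_restrict_space norm_sgn)
  have "(\<lambda>x::'a. x /\<^sub>R norm x) \<in> borel_measurable borel"
    by measurable
  then have "(sgn :: 'a \<Rightarrow> 'a) \<in> borel_measurable lborel"
    by (simp add: sgn_div_norm[abs_def])
  then show "(sgn :: 'a \<Rightarrow> 'a) \<in> borel_measurable (restrict_space lborel (cball 0 1 - {0}))"
    by (rule measurable_restrict_space1)
qed

lemma emeasure_surface_measure:
  fixes A :: "'a::euclidean_space set"
  assumes "A \<in> sets borel" "A \<subseteq> sphere 0 1"
  shows "emeasure surface_measure A =
    of_nat DIM('a) * emeasure lborel {r *\<^sub>R \<omega> | r \<omega>. 0 < r \<and> r \<le> 1 \<and> \<omega> \<in> A}"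
proof -
  let ?B = "cball 0 1 - {0::'a}"
  let ?D = "distr (restrict_space lborel ?B) (restrict_space borel (sphere 0 1)) sgn"
  have A: "A \<in> sets (restrict_space borel (sphere 0 1))"
    using assms by (auto simp: sets_restrict_space_iff)
  have eq: "sgn -` A \<inter> ?B = {r *\<^sub>R \<omega> | r \<omega>. 0 < r \<and> r \<le> 1 \<and> \<omega> \<in> A}"
  proof (intro set_eqI iffI)
    fix x assume x: "x \<in> sgn -` A \<inter> ?B"
    have "x = norm x *\<^sub>R sgn x" using x by (simp add: sgn_div_norm)
    moreover have "0 < norm x" "norm x \<le> 1" "sgn x \<in> A" using x by auto
    ultimately show "x \<in> {r *\<^sub>R \<omega> | r \<omega>. 0 < r \<and> r \<le> 1 \<and> \<omega> \<in> A}" by blast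
  next
    fix x assume "x \<in> {r *\<^sub>R \<omega> | r \<omega>. 0 < r \<and> r \<le> 1 \<and> \<omega> \<in> A}"
    then obtain r w where x: "x = r *\<^sub>R w" "0 < r" "r \<le> 1" "w \<in> A" by blast
    then have "norm w = 1" using assms by auto
    then have "w \<noteq> 0" "sgn x = w" "norm x \<le> 1"
      using x by (auto simp: sgn_div_norm)
    then show "x \<in> sgn -` A \<inter> ?B" using x by auto
  qed
  have "emeasure surface_measure A = of_nat DIM('a) * emeasure ?D A"
    using A by (simp add: surface_measure_def emeasure_completion main_part_sets)
  also have "emeasure ?D A = emeasure (restrict_space lborel ?B) (sgn -` A \<inter> ?B)"
    using emeasure_distr[OF sgn_measurable_sphere A] by (simp add: space_restrict_space)
  also have "\<dots> = emeasure lborel (sgn -` A \<inter> ?B)"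
    by (rule emeasure_restrict_space) auto
  finally show ?thesis by (simp only: eq)
qed

end

theory Submission
  imports Defs "HOL-Probability.Probability"
begin

text \<open>On the Fourier side \<open>M\<^sup>t f - f\<close> is multiplication by \<open>m(t \<xi>) - 1\<close>, where \<open>m\<close> is the
  transform of the normalized surface measure, and \<open>1 - m(\<xi>)\<close>, the average of \<open>1 - cos (\<omega> \<bullet> \<xi>)\<close>,
  is comparable to \<open>min 1 (|\<xi>|\<^sup>2)\<close>.  The three statements therefore follow from the trivial
  \<open>L\<^sup>1\<close> bound, the Hausdorff-Young inequality and the Plancherel theorem.  As constants are free,
  Hausdorff-Young is obtained by real interpolation, and all triangle inequalities are used in a
  form that loses a constant.\<close>

subsection \<open>Normalized surface measure\<close>

text \<open>Elements of \<open>Lp p\<close> are Lebesgue measurable functions, and a sphere has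
  Lebesgue measure zero, so changing \<open>f\<close> on a null set can spoil
  \<open>spherical_mean t f x\<close> for individual \<open>x\<close>. The work is therefore done
  for Borel functions and \<open>lborel\<close>, where Fubini applies, and carried over because a
  null set meets almost every sphere of radius t in a surface null set. Existence of such a limit,
  that is completeness of L^q, must be proved before anything is known about the chosen one, and
  each inequality is shown on the intersection of L^1 and L^p and then passed to the limit along the
  approximating sequence. Lossy triangle inequalities suffice for this, since every passage splits
  into a fixed number of terms. The dimension matters only for the lower bound on 1 - m: on the line
  the multiplier is m(xi) = cos xi, and 1 - cos xi vanishes at all multiples of 2 pi.\<close>

definition sphere_prob :: "'a::euclidean_space measure" where
  "sphere_prob = distr (uniform_measure lborel (cball 0 1)) borel sgn"

lemma sets_sphere_prob [simp, measurable_cong]: "sets sphere_prob = sets borel"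
  by (simp add: sphere_prob_def)

lemma space_sphere_prob [simp]: "space sphere_prob = UNIV"
  by (simp add: sphere_prob_def)

lemma borel_measurable_sgn_euclidean [measurable]:
  "(sgn :: 'a::euclidean_space \<Rightarrow> 'a) \<in> borel_measurable borel"
proof -
  have "(\<lambda>x::'a. x /\<^sub>R norm x) \<in> borel_measurable borel"
    by measurable
  then show ?thesis
    by (simp add: sgn_div_norm[abs_def])
qed

lemma emeasure_unit_cball:
  "emeasure lborel (cball 0 1 :: 'a::euclidean_space set) = ennreal (measure lborel (cball 0 1 :: 'a set))"
  "measure lborel (cball 0 1 :: 'a set) > 0"
proof -
  have fin: "emeasure lborel (cball 0 1 :: 'a set) < \<infinity>"
    by (rule emeasure_lborel_cball_finite)
  then show 1: "emeasure lborel (cball 0 1 :: 'a set) = ennreal (measure lborel (cball 0 1 :: 'a set))"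
    by (intro emeasure_eq_ennreal_measure) auto
  show "measure lborel (cball 0 1 :: 'a set) > 0"
    by (rule content_cball_pos) simp
qed

lemma prob_space_sphere_prob: "prob_space sphere_prob"
  unfolding sphere_prob_def
proof (rule prob_space.prob_space_distr)
  show "prob_space (uniform_measure lborel (cball 0 1 :: 'a set))"
    using emeasure_unit_cball[where 'a='a] by (intro prob_space_uniform_measure) auto
qed simp

lemma integral_sphere_prob:
  fixes f :: "'a::euclidean_space \<Rightarrow> 'b::{banach, second_countable_topology}"
  assumes [measurable]: "f \<in> borel_measurable borel"
  shows "(LINT w|sphere_prob. f w) =
    (LINT x|lborel. indicator (cball 0 1) x *\<^sub>R f (sgn x)) /\<^sub>R measure lborel (cball 0 1 :: 'a set)"
proof -
  let ?V = "measure lborel (cball 0 1 :: 'a set)"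
  have "1 / emeasure lborel (cball 0 1 :: 'a set) = ennreal (1 / ?V)"
    using divide_ennreal[of 1 ?V] emeasure_unit_cball[where 'a='a] by (metis ennreal_1 zero_le_one)
  then have "(\<lambda>x. indicator (cball 0 1) x / emeasure lborel (cball 0 1 :: 'a set)) =
        (\<lambda>x. ennreal (indicator (cball 0 1 :: 'a set) x / ?V))"
    by (intro ext) (auto simp: indicator_def)
  then have "(LINT w|sphere_prob. f w) = (LINT x|lborel. (indicator (cball 0 1) x / ?V) *\<^sub>R f (sgn x))"
    unfolding sphere_prob_def uniform_measure_def
    by - (simp add: integral_distr, subst integral_density, auto intro!: borel_measurable_divide borel_measurable_indicator)
  also have "\<dots> = (LINT x|lborel. (indicator (cball 0 1) x *\<^sub>R f (sgn x)) /\<^sub>R ?V)"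
    by (intro Bochner_Integration.integral_cong) (auto simp: divide_inverse mult.commute)
  finally show ?thesis by (simp only: integral_scaleR_right)
qed

lemma scale_measure_eq_density: "scale_measure c M = density M (\<lambda>_. c)"
  by (rule measure_eqI) (auto simp: emeasure_density_const)

text \<open>The bridge to \<open>sphere_prob\<close>, which lives on the Borel sets of the whole
  space, is not completed and has mass one, so that product measures are convenient. Both measures
  are images under \<open>sgn\<close> of Lebesgue measure on the ball; they differ by the origin, a
  null set, and by a constant, which is the total surface mass. Its positivity lets it cancel in
  \<open>spherical_mean\<close>.\<close>

lemma integral_surface_measure:
  fixes f :: "'a::euclidean_space \<Rightarrow> 'b::{banach, second_countable_topology}"
  assumes [measurable]: "f \<in> borel_measurable borel"
  shows "(LINT w|surface_measure. f w) = measure surface_measure (sphere 0 1 :: 'a set) *\<^sub>R (LINT w|sphere_prob. f w)"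
    and "measure surface_measure (sphere 0 1 :: 'a set) > 0"
proof -
  let ?V = "measure lborel (cball 0 1 :: 'a set)"
  let ?D = "distr (restrict_space lborel (cball 0 1 - {0})) (restrict_space borel (sphere 0 1)) (sgn :: 'a \<Rightarrow> 'a)"
  \<comment> \<open>The value type is fresh because the formula is used both for \<open>f\<close>
    and for the real constant 1, which yields the total mass.\<close>
  have 1: "(LINT w|surface_measure. f w) = real DIM('a) *\<^sub>R (LINT x|lborel. indicator (cball 0 1) x *\<^sub>R f (sgn x))"
    if "f \<in> borel_measurable borel" for f :: "'a \<Rightarrow> 'c::{banach, second_countable_topology}"
  proof -
    note [measurable] = that
    have fm: "f \<in> borel_measurable (restrict_space borel (sphere 0 1))"
      by (rule measurable_restrict_space1) simp
    have "(LINT w|surface_measure. f w) = (LINT w|density ?D (\<lambda>_. ennreal (real DIM('a))). f w)"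
      unfolding surface_measure_def scale_measure_eq_density
      using fm by (subst integral_completion) (auto simp: ennreal_of_nat_eq_real_of_nat)
    also have "\<dots> = (LINT w|?D. real DIM('a) *\<^sub>R f w)"
      using fm by (subst integral_density) auto
    also have "\<dots> = real DIM('a) *\<^sub>R (LINT w|?D. f w)"
      by simp
    also have "(LINT w|?D. f w) = (LINT x|restrict_space lborel (cball 0 1 - {0}). f (sgn x))"
      using fm sgn_measurable_sphere by (intro integral_distr) auto
    also have "\<dots> = (LINT x|lborel. indicator (cball 0 1 - {0}) x *\<^sub>R f (sgn x))"
      by (subst integral_restrict_space) auto
    also have "\<dots> = (LINT x|lborel. indicator (cball 0 1) x *\<^sub>R f (sgn x))"
      using AE_lborel_singleton[of "0::'a"]
      by (intro integral_cong_AE) (auto simp: indicator_def)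
    finally show ?thesis .
  qed
  have s: "space (surface_measure :: 'a measure) = sphere 0 1"
    by (simp add: surface_measure_def space_scale_measure space_restrict_space)
  have "measure surface_measure (sphere 0 1 :: 'a set) = (LINT w|(surface_measure :: 'a measure). (1::real))"
    unfolding lebesgue_integral_const by (simp only: s scaleR_one real_scaleR_def mult_1_right)
  also have "\<dots> = real DIM('a) * ?V"
    by (subst 1) auto
  finally have m: "measure surface_measure (sphere 0 1 :: 'a set) = real DIM('a) * ?V" .
  show "measure surface_measure (sphere 0 1 :: 'a set) > 0"
    unfolding m using emeasure_unit_cball(2)[where 'a='a] by auto
  show "(LINT w|surface_measure. f w) = measure surface_measure (sphere 0 1 :: 'a set) *\<^sub>R (LINT w|sphere_prob. f w)"
    unfolding m integral_sphere_prob[OF assms] 1[OF assms]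
    using emeasure_unit_cball(2)[where 'a='a] by simp
qed

lemma AE_sphere_prob_norm: "AE w in sphere_prob. norm (w::'a::euclidean_space) = 1"
proof -
  have "AE x in uniform_measure lborel (cball 0 (1::real)). norm (sgn (x::'a)) = 1"
    using AE_lborel_singleton[of "0::'a"]
    by (intro AE_uniform_measureI) (auto simp: norm_sgn)
  then show ?thesis
    unfolding sphere_prob_def by (subst AE_distr_iff) auto
qed

text \<open>The part in the unit ball of the cone over a Borel null set \<open>N\<close> lies in the
  preimage of \<open>N\<close> under \<open>sgn\<close>, so \<open>N\<close> is also null for
  surface measure.\<close>

lemma AE_surface_measure:
  assumes "AE w in sphere_prob. P w"
  shows "AE w in surface_measure. P (w::'a::euclidean_space)"
proof -
  from assms obtain N where N: "{w. \<not> P w} \<subseteq> N" "N \<in> sets borel" "emeasure sphere_prob N = 0"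
    by (auto elim!: AE_E)
  have [measurable]: "sgn -` N \<in> sets (borel :: 'a measure)"
    using measurable_sets_borel[OF borel_measurable_sgn_euclidean N(2)] by simp
  have "emeasure sphere_prob N = emeasure (uniform_measure lborel (cball 0 1)) (sgn -` N)"
    using N(2) unfolding sphere_prob_def by (subst emeasure_distr) auto
  also have "\<dots> = emeasure lborel (cball 0 1 \<inter> (sgn -` N)) / emeasure lborel (cball 0 1 :: 'a set)"
    using N(2) by (intro emeasure_uniform_measure) (auto intro!: measurable_sets_borel)
  finally have *: "emeasure lborel (cball 0 1 \<inter> (sgn -` N)) / emeasure lborel (cball 0 1 :: 'a set) = 0"
    using N(3) by simp
  then have 0: "emeasure lborel (cball 0 1 \<inter> (sgn -` N)) = 0"
    using emeasure_lborel_cball_finite[of "0::'a" 1] by (auto simp: ennreal_divide_eq_0_iff)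
  let ?A = "N \<inter> sphere 0 1"
  have "emeasure surface_measure ?A = of_nat DIM('a) * emeasure lborel {r *\<^sub>R \<omega> | r \<omega>. 0 < r \<and> r \<le> 1 \<and> \<omega> \<in> ?A}"
    using N(2) by (intro emeasure_surface_measure) auto
  moreover have "emeasure lborel {r *\<^sub>R \<omega> | r \<omega>. 0 < r \<and> r \<le> 1 \<and> \<omega> \<in> ?A} \<le> emeasure lborel (cball 0 1 \<inter> (sgn -` N))"
    using N(2) by (intro emeasure_mono) (auto simp: sgn_scaleR sgn_div_norm)
  ultimately have "emeasure surface_measure ?A = 0"
    using 0 by simp
  moreover have "?A \<in> sets surface_measure"
    using N(2) by (auto simp: surface_measure_def sets_restrict_space intro!: sets_completionI_sets)
  ultimately have "AE w in surface_measure. w \<notin> ?A"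
    by (intro AE_not_in) (auto simp: null_sets_def)
  moreover have "AE w in surface_measure. w \<in> sphere 0 1"
    by (rule AE_I2) (auto simp: surface_measure_def space_scale_measure space_restrict_space)
  ultimately show ?thesis
    by eventually_elim (use N(1) in auto)
qed

section \<open>Invariance under translations and rotations\<close>

lemma nn_integral_lborel_translate:
  fixes g :: "'a::euclidean_space \<Rightarrow> ennreal"
  assumes [measurable]: "g \<in> borel_measurable borel"
  shows "(\<integral>\<^sup>+ x. g (x + c) \<partial>lborel) = (\<integral>\<^sup>+ x. g x \<partial>lborel)"
proof -
  have "(\<integral>\<^sup>+ x. g x \<partial>lborel) = (\<integral>\<^sup>+ x. g x \<partial>distr lborel borel ((+) c))"
    by (simp add: lborel_distr_plus)
  also have "\<dots> = (\<integral>\<^sup>+ x. g (x + c) \<partial>lborel)"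
    by (subst nn_integral_distr) (auto simp: add.commute)
  finally show ?thesis by simp
qed

text \<open>The uniqueness argument for translation invariant measures: computing
  \<open>\<integral>\<integral> 1\<^sub>A(f x) 1\<^sub>B(y - f x) dx dy\<close>, where \<open>B\<close> is the unit ball, in the two possible orders shows
  that the image measure and Lebesgue measure agree on \<open>A\<close>.\<close>

lemma distr_lborel_orthogonal:
  fixes f :: "'a::euclidean_space \<Rightarrow> 'a"
  assumes f: "orthogonal_transformation f"
  shows "distr lborel borel f = lborel"
proof (rule measure_eqI)
  have lin: "linear f" and norm: "norm (f x) = norm x" and surj: "surj f" for x
    using f by (auto simp: orthogonal_transformation orthogonal_transformation_surj)
  have [measurable]: "f \<in> borel_measurable borel"
    using lin by (simp add: borel_measurable_continuous_onI linear_continuous_on linear_linear)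
  define B where "B = (cball 0 1 :: 'a set)"
  have [measurable]: "B \<in> sets borel"
    by (simp add: B_def)
  fix A :: "'a set" assume "A \<in> sets (distr lborel borel f)"
  then have [measurable]: "A \<in> sets borel"
    by simp
  let ?M = "emeasure (distr lborel borel f) A"
  have M: "?M = (\<integral>\<^sup>+ x. indicator A (f x) \<partial>lborel)"
    by (simp add: nn_integral_indicator[symmetric] nn_integral_distr del: nn_integral_indicator)
  have "emeasure lborel B * ?M = (\<integral>\<^sup>+ x. indicator A (f x) * emeasure lborel B \<partial>lborel)"
    unfolding M by (subst nn_integral_multc) (auto simp: mult.commute)
  also have "\<dots> = (\<integral>\<^sup>+ x. indicator A (f x) * (\<integral>\<^sup>+ y. indicator B (y + - f x) \<partial>lborel) \<partial>lborel)"
    by (subst nn_integral_lborel_translate) auto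
  also have "\<dots> = (\<integral>\<^sup>+ x. \<integral>\<^sup>+ y. indicator A (f x) * indicator B (y + - f x) \<partial>lborel \<partial>lborel)"
    by (simp add: nn_integral_cmult)
  also have "\<dots> = (\<integral>\<^sup>+ y. \<integral>\<^sup>+ x. indicator A (f x) * indicator B (y + - f x) \<partial>lborel \<partial>lborel)"
    by (rule lborel_pair.Fubini'[symmetric]) simp
  also have "\<dots> = (\<integral>\<^sup>+ y. \<integral>\<^sup>+ x. indicator A (f x + y) * indicator B (f x) \<partial>lborel \<partial>lborel)"
  proof (rule nn_integral_cong)
    fix y :: 'a
    \<comment> \<open>Translating the variable by a preimage of \<open>y\<close> translates its
      image by \<open>y\<close>; the symmetry of the ball then removes the sign of
      \<open>f x\<close>.\<close>
    obtain c where c: "f c = y"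
      using surj by (metis surjD)
    have "(\<integral>\<^sup>+ x. indicator A (f x) * indicator B (y + - f x) \<partial>lborel) =
       (\<integral>\<^sup>+ x. indicator A (f (x + c)) * indicator B (y + - f (x + c)) \<partial>lborel)"
      by (rule nn_integral_lborel_translate[symmetric]) simp
    also have "\<dots> = (\<integral>\<^sup>+ x. indicator A (f x + y) * indicator B (f x) \<partial>lborel)"
      using lin c by (intro nn_integral_cong) (simp add: linear_add B_def indicator_def)
    finally show "(\<integral>\<^sup>+ x. indicator A (f x) * indicator B (y + - f x) \<partial>lborel) =
      (\<integral>\<^sup>+ x. indicator A (f x + y) * indicator B (f x) \<partial>lborel)" .
  qed
  also have "\<dots> = (\<integral>\<^sup>+ x. \<integral>\<^sup>+ y. indicator A (y + f x) * indicator B (f x) \<partial>lborel \<partial>lborel)"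
    by (subst lborel_pair.Fubini') (auto simp: add.commute)
  also have "\<dots> = (\<integral>\<^sup>+ x. emeasure lborel A * indicator B (f x) \<partial>lborel)"
    by (simp add: nn_integral_multc nn_integral_lborel_translate)
  \<comment> \<open>\<open>f\<close> preserves norms, so the ball is its own preimage. This is what
    makes the proportionality factor equal to one.\<close>
  also have "\<dots> = (\<integral>\<^sup>+ x. emeasure lborel A * indicator B x \<partial>lborel)"
    by (intro nn_integral_cong) (simp add: B_def indicator_def norm)
  also have "\<dots> = emeasure lborel B * emeasure lborel A"
    by (subst nn_integral_cmult) (auto simp: mult.commute)
  finally show "?M = emeasure lborel A"
    using emeasure_unit_cball[where 'a='a] by (simp add: B_def ennreal_mult_cancel_left)
qed simp

lemma integral_sphere_prob_orthogonal:
  fixes f :: "real ^ 'n \<Rightarrow> real ^ 'n" and g :: "real ^ 'n \<Rightarrow> 'b::{banach, second_countable_topology}"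
  assumes f: "orthogonal_transformation f" and [measurable]: "g \<in> borel_measurable borel"
  shows "(LINT w|sphere_prob. g (f w)) = (LINT w|sphere_prob. g w)"
proof -
  have lin: "linear f"
    using f by (simp add: orthogonal_transformation_linear)
  have [measurable]: "f \<in> borel_measurable borel"
    using lin by (simp add: borel_measurable_continuous_onI linear_continuous_on linear_linear)
  have norm: "norm (f x) = norm x" for x
    using f by (simp add: orthogonal_transformation)
  have sgn: "f (sgn x) = sgn (f x)" for x
    using lin by (simp add: sgn_div_norm norm linear_cmul)
  have [measurable]: "(\<lambda>x. indicat_real (cball 0 1) x *\<^sub>R g (sgn x)) \<in> borel_measurable borel"
    by (intro borel_measurable_scaleR borel_measurable_indicator) auto
  have "(LINT x|lborel. indicator (cball 0 1) x *\<^sub>R g (sgn x)) =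
        (LINT x|distr lborel borel f. indicator (cball 0 1) x *\<^sub>R g (sgn x))"
    by (simp add: distr_lborel_orthogonal[OF f])
  also have "\<dots> = (LINT x|lborel. indicator (cball 0 1) (f x) *\<^sub>R g (sgn (f x)))"
    by (rule integral_distr) auto
  also have "\<dots> = (LINT x|lborel. indicator (cball 0 1) x *\<^sub>R g (f (sgn x)))"
    by (intro Bochner_Integration.integral_cong) (auto simp: indicator_def norm sgn)
  finally show ?thesis
    by (simp add: integral_sphere_prob)
qed

section \<open>Elementary inequalities for 1 - cos\<close>

lemma one_minus_cos_le: "1 - cos u \<le> u\<^sup>2 / 2" for u :: real
proof -
  have "1 - cos u = 2 * (sin (u / 2))\<^sup>2"
    using cos_double_sin[of "u / 2"] by simp
  also have "(sin (u / 2))\<^sup>2 \<le> (u / 2)\<^sup>2"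
    using abs_sin_x_le_abs_x[of "u / 2"] by (simp only: abs_le_square_iff)
  finally show ?thesis
    by (simp add: power2_eq_square)
qed

lemma one_minus_cos_ge: "u\<^sup>2 / 4 \<le> 1 - cos u" if "\<bar>u\<bar> \<le> 1" for u :: real
proof -
  have *: "u\<^sup>2 / 4 \<le> 1 - cos u" if u: "0 < u" "u \<le> 1" for u :: real
  proof -
    obtain z where z: "0 < z" "z < u / 2" "sin (u / 2) - sin 0 = (u / 2 - 0) * cos z"
      using MVT2[of 0 "u / 2" sin cos] u by (auto intro!: derivative_eq_intros)
    have "z\<^sup>2 \<le> (1 / 2)\<^sup>2"
      using z u by (intro power_mono) auto
    \<comment> \<open>The bound gives even 7/8; the value 3/4 is enough because 2 (3/8)^2 = 9/32 >=
      1/4.\<close>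
    then have "3 / 4 \<le> cos z"
      using one_minus_cos_le[of z] by (simp add: power2_eq_square)
    then have "u * 3 \<le> u * (4 * cos z)"
      using u by (intro mult_left_mono) auto
    then have "u / 2 * (3 / 4) \<le> sin (u / 2)"
      using z(3) by simp
    then have "(u / 2 * (3 / 4))\<^sup>2 \<le> (sin (u / 2))\<^sup>2"
      using u by (intro power_mono) auto
    moreover have "1 - cos u = 2 * (sin (u / 2))\<^sup>2"
      using cos_double_sin[of "u / 2"] by simp
    moreover have "u\<^sup>2 / 4 \<le> 2 * (u / 2 * (3 / 4))\<^sup>2"
      by (simp add: power2_eq_square)
    ultimately show ?thesis by linarith
  qed
  show ?thesis
    using *[of "\<bar>u\<bar>"] that by (cases "u = 0") auto
qed

text \<open>Since |exp(iu) - 1|^2 = 2 (1 - cos u), this is |a - b|^2 <= 2 |a|^2 + 2 |b|^2 for a =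
  exp(ix) - 1 and b = exp(iy) - 1. The sum of squares in the proof is |a + b|^2, from the
  parallelogram law.\<close>

lemma one_minus_cos_diff_le: "1 - cos (x - y) \<le> 2 * (1 - cos x) + 2 * (1 - cos y)" for x y :: real
proof -
  have "(sin x)\<^sup>2 + (cos x)\<^sup>2 = 1" "(sin y)\<^sup>2 + (cos y)\<^sup>2 = 1"
    by simp_all
  then have "(cos x + cos y - 2)\<^sup>2 + (sin x + sin y)\<^sup>2 = 6 + 2 * cos (x - y) - 4 * cos x - 4 * cos y"
    unfolding cos_diff by algebra
  moreover have "0 \<le> (cos x + cos y - 2)\<^sup>2 + (sin x + sin y)\<^sup>2"
    by simp
  ultimately have "0 \<le> 6 + 2 * cos (x - y) - 4 * cos x - 4 * cos y"
    by metis
  then show ?thesis by (simp add: algebra_simps)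
qed

section \<open>The Fourier multiplier of the spherical mean\<close>

definition sphere_cf :: "'a::euclidean_space \<Rightarrow> complex" where
  "sphere_cf \<xi> = (LINT w|sphere_prob. exp (- \<i> * complex_of_real (w \<bullet> \<xi>)))"

text \<open>Kept apart from \<open>1 - sphere_cf\<close>: pointwise bounds on this nonnegative
  integrand can be integrated directly, whereas \<open>sphere_cf\<close> is known to be real only
  after rotation invariance has been used.\<close>

definition sphere_defect :: "'a::euclidean_space \<Rightarrow> real" where
  "sphere_defect \<xi> = (LINT w|sphere_prob. 1 - cos (w \<bullet> \<xi>))"

interpretation sphere_prob: prob_space "sphere_prob :: 'a::euclidean_space measure"
  by (rule prob_space_sphere_prob)

lemma measure_sphere_prob_UNIV [simp]: "measure (sphere_prob :: 'a::euclidean_space measure) UNIV = 1"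
  using sphere_prob.prob_space[where 'a='a] by simp

lemma integrable_sphere_prob_bounded:
  fixes f :: "'a::euclidean_space \<Rightarrow> 'b::{banach, second_countable_topology}"
  assumes "f \<in> borel_measurable borel" "\<And>x. norm (f x) \<le> B"
  shows "integrable sphere_prob f"
  using assms by (intro sphere_prob.integrable_const_bound[of _ B]) auto

lemma integrable_sphere_defect: "integrable sphere_prob (\<lambda>w. 1 - cos (w \<bullet> (\<xi>::'a::euclidean_space)))"
proof (rule integrable_sphere_prob_bounded[where B=2])
  show "norm (1 - cos (x \<bullet> \<xi>)) \<le> 2" for x :: 'a
    using cos_ge_minus_one[of "x \<bullet> \<xi>"] cos_le_one[of "x \<bullet> \<xi>"] by auto
qed simp

lemma sphere_defect_radial:
  fixes \<xi> \<eta> :: "real ^ 'n"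
  assumes "norm \<xi> = norm \<eta>"
  shows "sphere_cf \<xi> = sphere_cf \<eta>" "sphere_defect \<xi> = sphere_defect \<eta>"
proof -
  obtain f where f: "orthogonal_transformation f" "f \<xi> = \<eta>"
    using orthogonal_transformation_exists[OF assms] by blast
  have "w \<bullet> \<xi> = f w \<bullet> \<eta>" for w
    using f by (auto simp: orthogonal_transformation_def)
  then show "sphere_cf \<xi> = sphere_cf \<eta>" "sphere_defect \<xi> = sphere_defect \<eta>"
    unfolding sphere_cf_def sphere_defect_def
    by (simp_all add: integral_sphere_prob_orthogonal[OF f(1), where g="\<lambda>w. exp (- \<i> * complex_of_real (w \<bullet> \<eta>))", simplified]
        integral_sphere_prob_orthogonal[OF f(1), where g="\<lambda>w. 1 - cos (w \<bullet> \<eta>)"])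
qed

text \<open>Conjugation turns the frequency into its negative, which has the same length, so by
  radial symmetry \<open>sphere_cf\<close> is real.\<close>

lemma one_minus_sphere_cf:
  fixes \<xi> :: "real ^ 'n"
  shows "1 - sphere_cf \<xi> = complex_of_real (sphere_defect \<xi>)"
proof -
  have int: "integrable sphere_prob (\<lambda>w. exp (- \<i> * complex_of_real (w \<bullet> \<xi>)))" for \<xi> :: "real ^ 'n"
    by (rule integrable_sphere_prob_bounded[where B=1]) auto
  have "cnj (sphere_cf \<xi>) = (LINT w|sphere_prob. cnj (exp (- \<i> * complex_of_real (w \<bullet> \<xi>))))"
    unfolding sphere_cf_def by (simp only: Bochner_Integration.integral_cnj)
  also have "\<dots> = sphere_cf (- \<xi>)"
    unfolding sphere_cf_def by (intro Bochner_Integration.integral_cong) (simp_all add: exp_cnj)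
  finally have "cnj (sphere_cf \<xi>) = sphere_cf (- \<xi>)" .
  then have "cnj (sphere_cf \<xi>) = sphere_cf \<xi>"
    using sphere_defect_radial(1)[of "- \<xi>" \<xi>] by simp
  then have "Im (sphere_cf \<xi>) = 0"
    by (simp add: complex_eq_iff)
  moreover have "Re (sphere_cf \<xi>) = (LINT w|sphere_prob. cos (w \<bullet> \<xi>))"
    unfolding sphere_cf_def
    by (subst integral_Re[OF int, symmetric]) (auto simp: Re_exp)
  moreover have "sphere_defect \<xi> = 1 - (LINT w|sphere_prob. cos (w \<bullet> \<xi>))"
    unfolding sphere_defect_def
    by (subst Bochner_Integration.integral_diff)
      (auto intro!: integrable_sphere_prob_bounded[where B=1])
  ultimately show ?thesis
    by (simp add: complex_eq_iff)
qed

lemma sphere_defect_le: "sphere_defect \<xi> \<le> 2 * min 1 ((norm \<xi>)\<^sup>2)" for \<xi> :: "'a::euclidean_space"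
proof -
  have "sphere_defect \<xi> \<le> (LINT w|(sphere_prob::'a measure). 2)"
    unfolding sphere_defect_def
    by (intro integral_mono integrable_sphere_defect)
      (auto intro: order_trans[OF diff_left_mono[OF cos_ge_minus_one]])
  moreover have "sphere_defect \<xi> \<le> (LINT w|(sphere_prob::'a measure). (norm \<xi>)\<^sup>2 / 2)"
    unfolding sphere_defect_def
  proof (intro integral_mono_AE integrable_sphere_defect)
    show "AE w in sphere_prob. 1 - cos (w \<bullet> \<xi>) \<le> (norm \<xi>)\<^sup>2 / 2"
      using AE_sphere_prob_norm
    proof eventually_elim
      fix w :: 'a assume "norm w = 1"
      then have "\<bar>w \<bullet> \<xi>\<bar> \<le> norm \<xi>"
        using Cauchy_Schwarz_ineq2[of w \<xi>] by simp
      then have "(w \<bullet> \<xi>)\<^sup>2 \<le> (norm \<xi>)\<^sup>2"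
        by (metis abs_le_square_iff abs_norm_cancel)
      then show "1 - cos (w \<bullet> \<xi>) \<le> (norm \<xi>)\<^sup>2 / 2"
        using one_minus_cos_le[of "w \<bullet> \<xi>"] by linarith
    qed
  qed simp
  ultimately have "sphere_defect \<xi> \<le> 2" "sphere_defect \<xi> \<le> (norm \<xi>)\<^sup>2 / 2"
    by auto
  moreover have "0 \<le> (norm \<xi>)\<^sup>2"
    by simp
  ultimately show ?thesis
    by (cases "1 \<le> (norm \<xi>)\<^sup>2") (simp_all only: min_def if_True if_False; linarith)+
qed

text \<open>For small frequencies, sum the pointwise bound over the axes.  For large ones, write a unit
  vector as a difference of two vectors of length \<open>|\<xi>|\<close>: this is possible exactly because the
  dimension is at least two, and it avoids any decay estimate for the transform of the sphere.\<close>

lemma sphere_defect_ge: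
  fixes \<xi> :: "real ^ 'n"
  assumes n: "CARD('n) \<ge> 2"
  shows "min 1 ((norm \<xi>)\<^sup>2) / (16 * real CARD('n)) \<le> sphere_defect \<xi>"
proof -
  let ?n = "real CARD('n)"
  have small: "(norm \<xi>)\<^sup>2 / (4 * ?n) \<le> sphere_defect \<xi>" if le: "norm \<xi> \<le> 1" for \<xi> :: "real ^ 'n"
  proof -
    \<comment> \<open>By radial symmetry the frequency may be turned onto each axis. After summation
      the quadratic lower bound of the integrand depends only on |w|^2 = 1, at the price of the
      factor n.\<close>
    have "?n * sphere_defect \<xi> = (\<Sum>b\<in>(Basis::(real ^ 'n) set). sphere_defect \<xi>)"
      by simp
    also have "\<dots> = (\<Sum>b\<in>Basis. sphere_defect (norm \<xi> *\<^sub>R (b :: real ^ 'n)))"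
      by (rule sum.cong[OF refl], rule sphere_defect_radial(2)) simp
    also have "\<dots> = (LINT w|sphere_prob. (\<Sum>b\<in>(Basis :: (real ^ 'n) set). 1 - cos (w \<bullet> (norm \<xi> *\<^sub>R b))))"
      unfolding sphere_defect_def by (intro Bochner_Integration.integral_sum[symmetric] integrable_sphere_defect)
    also have "\<dots> \<ge> (LINT w|(sphere_prob::(real ^ 'n) measure). (norm \<xi>)\<^sup>2 / 4)"
    proof (intro integral_mono_AE Bochner_Integration.integrable_sum integrable_sphere_defect)
      show "AE w::real ^ 'n in sphere_prob. (norm \<xi>)\<^sup>2 / 4 \<le> (\<Sum>b\<in>Basis. 1 - cos (w \<bullet> (norm \<xi> *\<^sub>R b)))"
        using AE_sphere_prob_norm
      proof eventually_elim
        fix w :: "real ^ 'n" assume w: "norm w = 1"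
        have "(norm \<xi>)\<^sup>2 / 4 = (norm \<xi>)\<^sup>2 / 4 * (norm w)\<^sup>2"
          using w by simp
        also have "(norm w)\<^sup>2 = (\<Sum>b\<in>Basis. (w \<bullet> b)\<^sup>2)"
          unfolding power2_norm_eq_inner by (subst euclidean_inner) (simp add: power2_eq_square)
        also have "(norm \<xi>)\<^sup>2 / 4 * \<dots> = (\<Sum>b\<in>Basis. (w \<bullet> (norm \<xi> *\<^sub>R b))\<^sup>2 / 4)"
          by (simp add: sum_distrib_left power_mult_distrib)
        also have "\<dots> \<le> (\<Sum>b\<in>Basis. 1 - cos (w \<bullet> (norm \<xi> *\<^sub>R b)))"
        proof (intro sum_mono one_minus_cos_ge)
          fix b :: "real ^ 'n" assume "b \<in> Basis"
          then have "\<bar>w \<bullet> (norm \<xi> *\<^sub>R b)\<bar> \<le> norm w * norm (norm \<xi> *\<^sub>R b)"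
            by (intro Cauchy_Schwarz_ineq2)
          also have "\<dots> \<le> 1"
            using w le \<open>b \<in> Basis\<close> by simp
          finally show "\<bar>w \<bullet> (norm \<xi> *\<^sub>R b)\<bar> \<le> 1" .
        qed
        finally show "(norm \<xi>)\<^sup>2 / 4 \<le> (\<Sum>b\<in>Basis. 1 - cos (w \<bullet> (norm \<xi> *\<^sub>R b)))" .
      qed
    qed simp
    finally show ?thesis
      by (simp add: field_simps)
  qed
  \<comment> \<open>This is the bound 1 / (4 n) for a unit vector, divided by the 4 that
    \<open>one_minus_cos_diff_le\<close> costs when both vectors have the same defect.\<close>
  have large: "1 / (16 * ?n) \<le> sphere_defect \<xi>" if ge: "norm \<xi> \<ge> 1 / 2" for \<xi> :: "real ^ 'n"
  proof -
    obtain i j :: 'n where ij: "i \<noteq> j"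
      using n by (metis card_2_iff' ex_card UNIV_I)
    \<comment> \<open>The height for which \<open>u\<close> and \<open>v\<close> both have length
      |xi| while \<open>u - v\<close> is the unit vector along axis j; it exists because |xi| >=
      1/2.\<close>
    define h where "h = sqrt ((norm \<xi>)\<^sup>2 - 1 / 4)"
    have "(1 / 2)\<^sup>2 \<le> (norm \<xi>)\<^sup>2"
      using ge by (intro power_mono) auto
    then have h: "h\<^sup>2 = (norm \<xi>)\<^sup>2 - 1 / 4"
      unfolding h_def by (subst real_sqrt_pow2) (auto simp: power2_eq_square)
    define u v where "u = h *\<^sub>R axis i 1 + (1 / 2) *\<^sub>R axis j (1::real)"
      and "v = h *\<^sub>R axis i 1 - (1 / 2) *\<^sub>R axis j (1::real)"
    have ax: "axis i (1::real) \<bullet> axis i 1 = 1" "axis j (1::real) \<bullet> axis j 1 = 1" "axis i (1::real) \<bullet> axis j 1 = 0"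
       "axis j (1::real) \<bullet> axis i 1 = 0"
      using ij by (auto simp: inner_axis_axis)
    have "u \<bullet> u = \<xi> \<bullet> \<xi>" "v \<bullet> v = \<xi> \<bullet> \<xi>"
      using h unfolding u_def v_def
      by (simp_all add: inner_add_left inner_add_right inner_diff_left inner_diff_right ax
          power2_norm_eq_inner power2_eq_square[of h])
    then have uv: "sphere_defect u = sphere_defect \<xi>" "sphere_defect v = sphere_defect \<xi>"
      by (auto intro!: sphere_defect_radial(2) simp: norm_eq_sqrt_inner)
    have "1 / (4 * ?n) \<le> sphere_defect (axis j 1 :: real ^ 'n)"
      using small[of "axis j 1 :: real ^ 'n"] by simp
    also have "\<dots> \<le> (LINT w|sphere_prob. 2 * (1 - cos (w \<bullet> u)) + 2 * (1 - cos (w \<bullet> v)))"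
      unfolding sphere_defect_def
    proof (intro integral_mono integrable_sphere_defect Bochner_Integration.integrable_add integrable_mult_right)
      fix w :: "real ^ 'n"
      have "axis j 1 = u - v"
        unfolding u_def v_def by (simp add: scaleR_add_left[symmetric])
      then show "1 - cos (w \<bullet> axis j 1) \<le> 2 * (1 - cos (w \<bullet> u)) + 2 * (1 - cos (w \<bullet> v))"
        using one_minus_cos_diff_le[of "w \<bullet> u" "w \<bullet> v"] by (simp only: inner_diff_right)
    qed
    also have "\<dots> = 4 * sphere_defect \<xi>"
      using uv unfolding sphere_defect_def
      by (simp only: Bochner_Integration.integral_add integrable_mult_right integrable_sphere_defect integral_mult_right_zero)
    finally show ?thesis
      by simp
  qed
  show ?thesis
  proof (cases "norm \<xi> \<le> 1")
    case True
    have "min 1 ((norm \<xi>)\<^sup>2) / (16 * ?n) \<le> (norm \<xi>)\<^sup>2 / (4 * ?n)"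
      by (intro frac_le) auto
    then show ?thesis
      using small[OF True] by linarith
  next
    case False
    have "min 1 ((norm \<xi>)\<^sup>2) / (16 * ?n) \<le> 1 / (16 * ?n)"
      by (intro frac_le) auto
    then show ?thesis
      using large[of \<xi>] False by linarith
  qed
qed

subsection \<open>Gaussians\<close>

definition gauss :: "'a::euclidean_space \<Rightarrow> real" where
  "gauss x = exp (- (norm x)\<^sup>2 / 2)"

text \<open>The number (2 pi)^(n/2) has two roles: it is the integral of \<open>gauss\<close>, and
  it is the factor by which the transform without normalizing constant scales the L^2 norm.\<close>

definition gauss_total :: "'a::euclidean_space itself \<Rightarrow> real" where
  "gauss_total _ = sqrt (2 * pi) ^ DIM('a)"

lemma gauss_total_pos: "gauss_total a > 0"
  by (simp add: gauss_total_def)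

lemma gauss_bounds: "0 < gauss x" "gauss x \<le> 1"
  by (auto simp: gauss_def)

lemma gauss_0 [simp]: "gauss 0 = 1"
  by (simp add: gauss_def)

lemma borel_measurable_gauss [measurable]: "gauss \<in> borel_measurable borel"
  unfolding gauss_def[abs_def] by measurable

text \<open>This is the characteristic function of the standard normal distribution, cleared of the
  factor 1 / sqrt (2 pi) in its density.\<close>

lemma gauss_fourier_real:
  fixes t :: real
  shows "has_bochner_integral lborel (\<lambda>x. iexp (t * x) * complex_of_real (exp (- x\<^sup>2 / 2)))
    (complex_of_real (sqrt (2 * pi) * exp (- t\<^sup>2 / 2)))"
proof -
  have d: "std_normal_density x * sqrt (2 * pi) = exp (- x\<^sup>2 / 2)" for x
    by (simp add: std_normal_density_def)
  have int: "integrable lborel (\<lambda>x. std_normal_density x *\<^sub>R iexp (t * x))"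
    by (rule Bochner_Integration.integrable_bound[OF integrable_normal_density[of 1 0]]) (auto simp: normal_density_nonneg)
  have "(LINT x|lborel. std_normal_density x *\<^sub>R iexp (t * x)) = char std_normal_distribution t"
    unfolding char_def by (subst integral_density) (auto simp: normal_density_nonneg)
  also have "\<dots> = complex_of_real (exp (- t\<^sup>2 / 2))"
    by (simp add: char_std_normal_distribution)
  finally have "has_bochner_integral lborel (\<lambda>x. std_normal_density x *\<^sub>R iexp (t * x)) (complex_of_real (exp (- t\<^sup>2 / 2)))"
    using int by (simp add: has_bochner_integral_iff)
  from has_bochner_integral_mult_right[OF this, of "complex_of_real (sqrt (2 * pi))"]
  moreover have "complex_of_real (sqrt (2 * pi)) * (std_normal_density x *\<^sub>R iexp (t * x)) =
      iexp (t * x) * complex_of_real (exp (- x\<^sup>2 / 2))" for x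
    unfolding d[symmetric] by (simp add: scaleR_conv_of_real mult_ac)
  ultimately show ?thesis
    by (simp only: of_real_mult)
qed

text \<open>Lebesgue measure is the image of a product measure over \<open>Basis\<close>, and both
  the Gaussian and the character split into factors of one coordinate each.\<close>

lemma gauss_fourier:
  fixes z :: "'a::euclidean_space"
  shows "has_bochner_integral lborel (\<lambda>x. exp (- \<i> * complex_of_real (x \<bullet> z)) * complex_of_real (gauss x))
    (complex_of_real (gauss_total TYPE('a) * gauss z))"
proof -
  let ?P = "\<Pi>\<^sub>M b\<in>(Basis :: 'a set). (lborel :: real measure)"
  let ?e = "\<lambda>x::'a. exp (- \<i> * complex_of_real (x \<bullet> z)) * complex_of_real (gauss x)"
  let ?g = "\<lambda>b x. iexp (- (z \<bullet> b) * x) * complex_of_real (exp (- x\<^sup>2 / 2))"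
  interpret product_sigma_finite "\<lambda>_::'a. lborel :: real measure"
    by standard
  have g: "has_bochner_integral lborel (?g b) (complex_of_real (sqrt (2 * pi) * exp (- (z \<bullet> b)\<^sup>2 / 2)))" for b
    using gauss_fourier_real[of "- (z \<bullet> b)"] by simp
  have e: "?e (\<Sum>b\<in>Basis. f b *\<^sub>R b) = (\<Prod>b\<in>Basis. ?g b (f b))" for f
  proof -
    have "(norm (\<Sum>b\<in>Basis. f b *\<^sub>R b :: 'a))\<^sup>2 = (\<Sum>b\<in>Basis. (f b)\<^sup>2)"
      unfolding power2_norm_eq_inner by (subst euclidean_inner) (simp add: power2_eq_square)
    moreover have "(\<Sum>b\<in>Basis. f b *\<^sub>R b) \<bullet> z = (\<Sum>b\<in>Basis. f b * (z \<bullet> b))"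
      by (simp add: inner_sum_left inner_commute[of z])
    ultimately show ?thesis
      by (simp add: gauss_def exp_of_real[symmetric] prod.distrib exp_sum[symmetric] sum_distrib_left
          sum_negf sum_divide_distrib mult_ac)
  qed
  have int: "integrable ?P (\<lambda>f. \<Prod>b\<in>Basis. ?g b (f b))"
    using g by (intro product_integrable_prod) (auto simp: has_bochner_integral_iff)
  have [measurable]: "?e \<in> borel_measurable borel" by measurable
  have m: "(\<lambda>f. \<Sum>b\<in>Basis. f b *\<^sub>R b) \<in> ?P \<rightarrow>\<^sub>M (borel :: 'a measure)"
    by measurable
  have L: "(lborel :: 'a measure) = distr ?P borel (\<lambda>f. \<Sum>b\<in>Basis. f b *\<^sub>R b)"
    by (rule lborel_eq)
  have "integrable lborel ?e"
    unfolding L using m int by (subst integrable_distr_eq, simp, simp, simp only: e)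
  moreover have "integral\<^sup>L lborel ?e = (LINT f|?P. (\<Prod>b\<in>Basis. ?g b (f b)))"
    unfolding L using m by (subst integral_distr, simp, simp, simp only: e)
  moreover have "(LINT f|?P. (\<Prod>b\<in>Basis. ?g b (f b))) = (\<Prod>b\<in>Basis. integral\<^sup>L lborel (?g b))"
    using g by (intro product_integral_prod) (auto simp: has_bochner_integral_iff)
  moreover have "(\<Prod>b\<in>Basis. integral\<^sup>L lborel (?g b)) = (\<Prod>b\<in>Basis. complex_of_real (sqrt (2 * pi) * exp (- (z \<bullet> b)\<^sup>2 / 2)))"
    using g by (intro prod.cong) (auto simp: has_bochner_integral_iff)
  moreover have "(\<Prod>b\<in>Basis. complex_of_real (sqrt (2 * pi) * exp (- (z \<bullet> b)\<^sup>2 / 2))) = complex_of_real (gauss_total TYPE('a) * gauss z)"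
  proof -
    have "(norm z)\<^sup>2 = (\<Sum>b\<in>Basis. (z \<bullet> b)\<^sup>2)"
      unfolding power2_norm_eq_inner by (subst euclidean_inner) (simp add: power2_eq_square)
    then have "gauss z = (\<Prod>b\<in>Basis. exp (- (z \<bullet> b)\<^sup>2 / 2))"
      by (simp add: gauss_def exp_sum[symmetric] sum_divide_distrib sum_negf)
    then show ?thesis
      by (simp add: gauss_total_def prod.distrib)
  qed
  ultimately show ?thesis
    by (simp add: has_bochner_integral_iff)
qed

lemma integrable_gauss: "integrable lborel (gauss :: 'a::euclidean_space \<Rightarrow> real)"
  and integral_gauss: "integral\<^sup>L lborel (gauss :: 'a \<Rightarrow> real) = gauss_total TYPE('a)"
  using gauss_fourier[of "0::'a"] has_bochner_integral_Re[of lborel]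
  by (auto simp: has_bochner_integral_iff complex_of_real_integrable_eq simp flip: of_real_mult)

section \<open>Affine changes of variable\<close>

lemma integral_lborel_affine:
  fixes f :: "'a::euclidean_space \<Rightarrow> 'b::{banach, second_countable_topology}"
  assumes [measurable]: "f \<in> borel_measurable borel" and c: "c \<noteq> 0"
  shows "(LINT x|lborel. f x) = \<bar>c\<bar> ^ DIM('a) *\<^sub>R (LINT x|lborel. f (t + c *\<^sub>R x))"
proof -
  have "(LINT x|lborel. f x) = (LINT x|density (distr lborel borel (\<lambda>x. t + c *\<^sub>R x)) (\<lambda>_. ennreal (\<bar>c\<bar> ^ DIM('a))). f x)"
    using lborel_affine[OF c, of t] by (simp add: ennreal_power)
  also have "\<dots> = (LINT x|distr lborel borel (\<lambda>x. t + c *\<^sub>R x). \<bar>c\<bar> ^ DIM('a) *\<^sub>R f x)"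
    by (rule integral_density) auto
  also have "\<dots> = (LINT x|lborel. \<bar>c\<bar> ^ DIM('a) *\<^sub>R f (t + c *\<^sub>R x))"
    by (rule integral_distr) auto
  finally show ?thesis by simp
qed

lemma integral_lborel_translate:
  fixes f :: "'a::euclidean_space \<Rightarrow> 'b::{banach, second_countable_topology}"
  assumes "f \<in> borel_measurable borel"
  shows "(LINT x|lborel. f (x + c)) = (LINT x|lborel. f x)"
  using integral_lborel_affine[OF assms, of 1 c] by (simp add: add.commute)

lemma integrable_lborel_translate:
  fixes f :: "'a::euclidean_space \<Rightarrow> 'b::{banach, second_countable_topology}"
  assumes f: "integrable lborel f"
  shows "integrable lborel (\<lambda>x. f (x + c))"
proof -
  have [measurable]: "f \<in> borel_measurable borel"
    using f by auto
  have "(\<integral>\<^sup>+ x. ennreal (norm (f (x + c))) \<partial>lborel) = (\<integral>\<^sup>+ x. ennreal (norm (f x)) \<partial>lborel)"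
    by (rule nn_integral_lborel_translate) simp
  then show ?thesis
    using f by (simp add: integrable_iff_bounded)
qed

lemma gauss_fourier_scaled:
  fixes z :: "'a::euclidean_space"
  assumes s: "s > 0"
  shows "(LINT x|lborel. exp (- \<i> * complex_of_real (x \<bullet> z)) * complex_of_real (gauss (s *\<^sub>R x)))
    = complex_of_real (gauss_total TYPE('a) * gauss (z /\<^sub>R s) / s ^ DIM('a))"
proof -
  have "complex_of_real (gauss_total TYPE('a) * gauss (z /\<^sub>R s)) =
     (LINT x|lborel. exp (- \<i> * complex_of_real (x \<bullet> (z /\<^sub>R s))) * complex_of_real (gauss x))"
    using gauss_fourier[of "z /\<^sub>R s"] by (simp add: has_bochner_integral_iff)
  also have "\<dots> = s ^ DIM('a) *\<^sub>R (LINT x|lborel. exp (- \<i> * complex_of_real (x \<bullet> z)) * complex_of_real (gauss (s *\<^sub>R x)))"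
  proof (subst integral_lborel_affine[where c=s and t=0])
    have *: "(0 + s *\<^sub>R x) \<bullet> (z /\<^sub>R s) = x \<bullet> z" for x
      using s by simp
    show "\<bar>s\<bar> ^ DIM('a) *\<^sub>R (LINT x|lborel. exp (- \<i> * complex_of_real ((0 + s *\<^sub>R x) \<bullet> (z /\<^sub>R s))) * complex_of_real (gauss (0 + s *\<^sub>R x))) =
      s ^ DIM('a) *\<^sub>R (LINT x|lborel. exp (- \<i> * complex_of_real (x \<bullet> z)) * complex_of_real (gauss (s *\<^sub>R x)))"
      unfolding * using s by simp
  qed (use s in auto)
  finally show ?thesis
    using s by (simp add: scaleR_conv_of_real field_simps)
qed

lemma integrable_lborel_scaled:
  fixes f :: "'a::euclidean_space \<Rightarrow> 'b::{banach, second_countable_topology}"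
  assumes f: "integrable lborel f" and c: "c \<noteq> 0"
  shows "integrable lborel (\<lambda>x. f (c *\<^sub>R x))"
proof -
  have [measurable]: "f \<in> borel_measurable borel"
    using f by auto
  have "integrable (density (distr lborel borel (\<lambda>x. 0 + c *\<^sub>R x)) (\<lambda>_. ennreal (\<bar>c\<bar> ^ DIM('a)))) f"
    using f lborel_affine[OF c, of "0::'a"] by (simp add: ennreal_power)
  then have "integrable (distr lborel borel (\<lambda>x::'a. 0 + c *\<^sub>R x)) (\<lambda>x. (\<bar>c\<bar> ^ DIM('a)) *\<^sub>R f x)"
    by (subst (asm) integrable_density) auto
  then have "integrable lborel (\<lambda>x. (\<bar>c\<bar> ^ DIM('a)) *\<^sub>R f (c *\<^sub>R x))"
    by (subst (asm) integrable_distr_eq) auto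
  from integrable_scaleR_right[OF this, of "inverse (\<bar>c\<bar> ^ DIM('a))"] show ?thesis
    using c by simp
qed

lemma integrable_gauss_scaled:
  "s > 0 \<Longrightarrow> integrable lborel (\<lambda>x::'a::euclidean_space. gauss (s *\<^sub>R x))"
  by (rule integrable_lborel_scaled[OF integrable_gauss]) simp

subsection \<open>Plancherel\<close>

abbreviation (input) chi :: "'a::euclidean_space \<Rightarrow> 'a \<Rightarrow> complex" where
  "chi x \<xi> \<equiv> exp (- \<i> * complex_of_real (x \<bullet> \<xi>))"

lemma borel_measurable_cnj [measurable (raw)]:
  "f \<in> borel_measurable M \<Longrightarrow> (\<lambda>x. cnj (f x)) \<in> borel_measurable M"
  by (rule borel_measurable_continuous_on) (intro continuous_intros)

lemma fourier_lborel:
  fixes f :: "'a::euclidean_space \<Rightarrow> complex"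
  assumes [measurable]: "f \<in> borel_measurable borel"
  shows "fourier f \<xi> = (LINT x|lborel. f x * chi x \<xi>)"
proof -
  have "(\<lambda>x. f x * chi x \<xi>) \<in> borel_measurable lborel"
    by measurable
  then show ?thesis
    unfolding fourier_def by (rule integral_completion)
qed

lemma borel_measurable_fourier [measurable]:
  fixes f :: "'a::euclidean_space \<Rightarrow> complex"
  assumes [measurable]: "f \<in> borel_measurable borel"
  shows "fourier f \<in> borel_measurable borel"
  unfolding fourier_lborel[OF assms, abs_def] by measurable

lemma integrable_mult_chi:
  fixes f :: "'a::euclidean_space \<Rightarrow> complex"
  assumes "integrable lborel f"
  shows "integrable lborel (\<lambda>x. f x * chi x \<xi>)"
proof -
  have [measurable]: "f \<in> borel_measurable borel"
    using assms by auto
  show ?thesis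
    using assms by (rule Bochner_Integration.integrable_bound) (auto simp: norm_mult)
qed

lemma norm_fourier_le:
  fixes f :: "'a::euclidean_space \<Rightarrow> complex"
  assumes f: "integrable lborel f"
  shows "norm (fourier f \<xi>) \<le> (LINT x|lborel. norm (f x))"
proof -
  have [measurable]: "f \<in> borel_measurable borel"
    using f by auto
  have "norm (fourier f \<xi>) \<le> (LINT x|lborel. norm (f x * chi x \<xi>))"
    unfolding fourier_lborel[OF \<open>f \<in> borel_measurable borel\<close>] by (rule integral_norm_bound)
  then show ?thesis
    by (simp add: norm_mult)
qed

lemma integrable_pair_mult:
  fixes f :: "'a::euclidean_space \<Rightarrow> complex" and g :: "'b::euclidean_space \<Rightarrow> complex"
  assumes f: "integrable lborel f" and g: "integrable lborel g"
    and [measurable]: "case_prod u \<in> borel_measurable (lborel \<Otimes>\<^sub>M lborel)"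
    and u: "\<And>x y. norm (u x y) \<le> 1"
  shows "integrable (lborel \<Otimes>\<^sub>M lborel) (\<lambda>(x, y). f x * g y * u x y)"
proof -
  have [measurable]: "f \<in> borel_measurable borel" "g \<in> borel_measurable borel"
    using f g by auto
  have "integrable (lborel \<Otimes>\<^sub>M lborel) (\<lambda>(x, y). f x * g y)"
    using f g by (intro lborel_pair.Fubini_integrable) (auto simp: norm_mult)
  then show ?thesis
    by (rule Bochner_Integration.integrable_bound) (auto simp: norm_mult mult_left_le u)
qed

section \<open>Multiplication formula, autocorrelation and the upper Plancherel inequality\<close>

lemma fourier_multiplication:
  fixes f g :: "'a::euclidean_space \<Rightarrow> complex"
  assumes f: "integrable lborel f" and g: "integrable lborel g"
  shows "(LINT \<xi>|lborel. fourier f \<xi> * g \<xi>) = (LINT x|lborel. f x * fourier g x)"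
proof -
  have [measurable]: "f \<in> borel_measurable borel" "g \<in> borel_measurable borel"
    using f g by auto
  have "(LINT \<xi>|lborel. fourier f \<xi> * g \<xi>) = (LINT \<xi>|lborel. (LINT x|lborel. f x * g \<xi> * chi x \<xi>))"
    unfolding fourier_lborel[OF \<open>f \<in> borel_measurable borel\<close>]
    by (intro Bochner_Integration.integral_cong refl, subst integral_mult_left_zero[symmetric]) (simp add: mult_ac)
  also have "\<dots> = (LINT x|lborel. (LINT \<xi>|lborel. f x * g \<xi> * chi x \<xi>))"
    using f g by (intro lborel_pair.Fubini_integral integrable_pair_mult) auto
  also have "\<dots> = (LINT x|lborel. f x * fourier g x)"
    unfolding fourier_lborel[OF \<open>g \<in> borel_measurable borel\<close>]
    by (intro Bochner_Integration.integral_cong refl, subst integral_mult_right_zero[symmetric]) (simp add: mult_ac inner_commute)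
  finally show ?thesis .
qed

text \<open>The convolution of f with the conjugate of its reflection. Its transform is |f^|^2 and
  its value at 0 is the squared L^2 norm, so Plancherel is Fourier inversion for
  \<open>autocorr f\<close> at the single point 0.\<close>

definition autocorr :: "('a::euclidean_space \<Rightarrow> complex) \<Rightarrow> 'a \<Rightarrow> complex" where
  "autocorr f z = (LINT x|lborel. f (x + z) * cnj (f x))"

lemma borel_measurable_autocorr [measurable]:
  fixes f :: "'a::euclidean_space \<Rightarrow> complex"
  assumes [measurable]: "f \<in> borel_measurable borel"
  shows "autocorr f \<in> borel_measurable borel"
  unfolding autocorr_def[abs_def] by measurable

lemma
  fixes f :: "'a::euclidean_space \<Rightarrow> complex"
  assumes f: "integrable lborel f"
  shows integrable_autocorr: "integrable lborel (autocorr f)"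
    and fourier_autocorr: "fourier (autocorr f) \<xi> = complex_of_real ((norm (fourier f \<xi>))\<^sup>2)"
proof -
  have fm [measurable]: "f \<in> borel_measurable borel"
    using f by auto
  have t: "(LINT z|lborel. norm (f (x + z))) = (LINT z|lborel. norm (f z))" for x
    using integral_lborel_translate[of "\<lambda>z. norm (f z)" x] by (simp add: add.commute)
  have pair: "integrable (lborel \<Otimes>\<^sub>M lborel) (\<lambda>(x, z). f (x + z) * cnj (f x))"
  proof (rule lborel_pair.Fubini_integrable)
    show "integrable lborel (\<lambda>x. LINT z|lborel. norm (case (x, z) of (x, z) \<Rightarrow> f (x + z) * cnj (f x)))"
      using f by (simp add: norm_mult t)
    show "AE x in lborel. integrable lborel (\<lambda>z. case (x, z) of (x, z) \<Rightarrow> f (x + z) * cnj (f x))"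
      using integrable_lborel_translate[OF f] by (simp add: add.commute)
  qed simp
  show "integrable lborel (autocorr f)"
    using lborel_pair.integrable_snd[OF pair] by (simp add: autocorr_def[abs_def])
  have pair2: "integrable (lborel \<Otimes>\<^sub>M lborel) (\<lambda>(x, z). f (x + z) * cnj (f x) * chi z \<xi>)"
    by (rule Bochner_Integration.integrable_bound[OF pair]) (auto simp: norm_mult)
  have "fourier (autocorr f) \<xi> = (LINT z|lborel. (LINT x|lborel. f (x + z) * cnj (f x) * chi z \<xi>))"
    by (subst fourier_lborel) (auto simp: autocorr_def)
  also have "\<dots> = (LINT x|lborel. (LINT z|lborel. f (x + z) * cnj (f x) * chi z \<xi>))"
    using pair2 by (rule lborel_pair.Fubini_integral)
  also have "\<dots> = (LINT x|lborel. cnj (f x * chi x \<xi>) * fourier f \<xi>)"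
  proof (intro Bochner_Integration.integral_cong refl)
    fix x
    \<comment> \<open>The character at z is the character at z + x times the conjugate of the one at
      x. This separates the variables, and the z integral becomes a translate of the transform of
      \<open>f\<close>.\<close>
    have "(LINT z|lborel. f (x + z) * cnj (f x) * chi z \<xi>) =
      (LINT z|lborel. cnj (f x * chi x \<xi>) * (f (z + x) * chi (z + x) \<xi>))"
    proof (intro Bochner_Integration.integral_cong refl)
      fix z
      have "chi (z + x) \<xi> = chi z \<xi> * chi x \<xi>"
        by (simp add: inner_add_left exp_add[symmetric] algebra_simps)
      moreover have "cnj (chi x \<xi>) * chi x \<xi> = 1"
        by (simp add: exp_cnj exp_add[symmetric])
      ultimately show "f (x + z) * cnj (f x) * chi z \<xi> = cnj (f x * chi x \<xi>) * (f (z + x) * chi (z + x) \<xi>)"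
        unfolding complex_cnj_mult add.commute[of x z] by algebra
    qed
    also have "\<dots> = cnj (f x * chi x \<xi>) * (LINT z|lborel. f (z + x) * chi (z + x) \<xi>)"
      by (rule integral_mult_right_zero)
    also have "(LINT z|lborel. f (z + x) * chi (z + x) \<xi>) = fourier f \<xi>"
      unfolding fourier_lborel[OF fm] by (rule integral_lborel_translate[where f="\<lambda>z. f z * chi z \<xi>"]) simp
    finally show "(LINT z|lborel. f (x + z) * cnj (f x) * chi z \<xi>) = cnj (f x * chi x \<xi>) * fourier f \<xi>" .
  qed
  also have "\<dots> = cnj (fourier f \<xi>) * fourier f \<xi>"
    unfolding fourier_lborel[OF fm] integral_mult_left_zero Bochner_Integration.integral_cnj ..
  finally show "fourier (autocorr f) \<xi> = complex_of_real ((norm (fourier f \<xi>))\<^sup>2)"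
    by (simp only: complex_norm_square mult.commute)
qed

text \<open>The pointwise bound |ab| <= (|a|^2 + |b|^2) / 2 takes the place of Cauchy-Schwarz and
  loses nothing, as both squares have the same integral.\<close>

lemma norm_autocorr_le:
  fixes f :: "'a::euclidean_space \<Rightarrow> complex"
  assumes [measurable]: "f \<in> borel_measurable borel" and f: "integrable lborel (\<lambda>x. (norm (f x))\<^sup>2)"
  shows "norm (autocorr f z) \<le> (LINT x|lborel. (norm (f x))\<^sup>2)"
proof -
  note f' = integrable_lborel_translate[OF f, of z]
  have "norm (autocorr f z) \<le> (LINT x|lborel. (norm (f (x + z)))\<^sup>2 / 2 + (norm (f x))\<^sup>2 / 2)"
    unfolding autocorr_def
  proof (rule Bochner_Integration.integral_norm_bound_integral)
    show bd: "norm (f (x + z) * cnj (f x)) \<le> (norm (f (x + z)))\<^sup>2 / 2 + (norm (f x))\<^sup>2 / 2" for x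
      using sum_squares_bound[of "norm (f (x + z))" "norm (f x)"] by (simp add: norm_mult field_simps)
    show int: "integrable lborel (\<lambda>x. (norm (f (x + z)))\<^sup>2 / 2 + (norm (f x))\<^sup>2 / 2)"
      using f f' by auto
    show "integrable lborel (\<lambda>x. f (x + z) * cnj (f x))"
      by (rule Bochner_Integration.integrable_bound[OF int], measurable) (use bd in \<open>auto intro: order_trans[OF _ abs_ge_self]\<close>)
  qed
  also have "\<dots> = (LINT x|lborel. (norm (f x))\<^sup>2)"
    using f f' by (simp add: integral_lborel_translate[where f="\<lambda>x. (norm (f x))\<^sup>2"])
  finally show ?thesis .
qed

text \<open>The multiplication formula for \<open>autocorr f\<close> and a Gaussian. As s tends to 0
  the left side approaches the integral of |f^|^2, while the right side averages
  \<open>autocorr f\<close> over ever smaller neighbourhoods of 0.\<close>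

lemma gauss_plancherel:
  fixes f :: "'a::euclidean_space \<Rightarrow> complex"
  assumes f: "integrable lborel f" and s: "s > 0"
  shows "(LINT \<xi>|lborel. complex_of_real ((norm (fourier f \<xi>))\<^sup>2 * gauss (s *\<^sub>R \<xi>))) =
    complex_of_real (gauss_total TYPE('a)) * (LINT w|lborel. autocorr f (s *\<^sub>R w) * complex_of_real (gauss w))"
proof -
  have [measurable]: "f \<in> borel_measurable borel"
    using f by auto
  let ?g = "\<lambda>\<xi>::'a. complex_of_real (gauss (s *\<^sub>R \<xi>))"
  let ?K = "complex_of_real (gauss_total TYPE('a))"
  have g: "integrable lborel ?g"
    using integrable_gauss_scaled[OF s] by (simp add: complex_of_real_integrable_eq)
  have "(LINT \<xi>|lborel. complex_of_real ((norm (fourier f \<xi>))\<^sup>2 * gauss (s *\<^sub>R \<xi>))) =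
    (LINT \<xi>|lborel. fourier (autocorr f) \<xi> * ?g \<xi>)"
    by (simp add: fourier_autocorr[OF f])
  also have "\<dots> = (LINT z|lborel. autocorr f z * fourier ?g z)"
    by (rule fourier_multiplication[OF integrable_autocorr[OF f] g])
  also have "\<dots> = (LINT z|lborel. autocorr f z * (?K * complex_of_real (gauss (z /\<^sub>R s) / s ^ DIM('a))))"
    using gauss_fourier_scaled[OF s, where 'a='a] by (simp add: fourier_lborel mult.commute)
  \<comment> \<open>The Jacobian of z = s w cancels the factor s^(-n) in the transform of the scaled
    Gaussian.\<close>
  also have "\<dots> = s ^ DIM('a) *\<^sub>R (LINT w|lborel. autocorr f (s *\<^sub>R w) * (?K * complex_of_real (gauss w / s ^ DIM('a))))"
    using s by (subst integral_lborel_affine[where c=s and t=0]) auto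
  also have "\<dots> = (LINT w|lborel. ?K * (autocorr f (s *\<^sub>R w) * complex_of_real (gauss w)))"
    using s unfolding integral_scaleR_right[symmetric]
    by (intro Bochner_Integration.integral_cong refl) (simp add: scaleR_conv_of_real)
  finally show ?thesis
    by (simp only: integral_mult_right_zero)
qed

lemma ennreal_nn_integral_norm2:
  fixes f :: "'a::euclidean_space \<Rightarrow> complex"
  assumes "f \<in> borel_measurable borel" "integrable lborel (\<lambda>x. (norm (f x))\<^sup>2)"
  shows "(\<integral>\<^sup>+ x. ennreal ((norm (f x))\<^sup>2) \<partial>lborel) = ennreal (LINT x|lborel. (norm (f x))\<^sup>2)"
  using assms by (intro nn_integral_eq_integral) auto

lemma nn_integral_gauss_plancherel:
  fixes f :: "'a::euclidean_space \<Rightarrow> complex"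
  assumes f: "integrable lborel f" and s: "s > 0"
  shows "(\<integral>\<^sup>+ \<xi>. ennreal ((norm (fourier f \<xi>))\<^sup>2 * gauss (s *\<^sub>R \<xi>)) \<partial>lborel) =
    ennreal (gauss_total TYPE('a) * (LINT w|lborel. Re (autocorr f (s *\<^sub>R w)) * gauss w))"
proof -
  have [measurable]: "f \<in> borel_measurable borel"
    using f by auto
  let ?B = "LINT x|lborel. norm (f x)"
  have int: "integrable lborel (\<lambda>\<xi>. (norm (fourier f \<xi>))\<^sup>2 * gauss (s *\<^sub>R \<xi>))"
  proof (rule Bochner_Integration.integrable_bound)
    show "integrable lborel (\<lambda>\<xi>::'a. ?B\<^sup>2 * gauss (s *\<^sub>R \<xi>))"
      using integrable_gauss_scaled[OF s] by (rule integrable_mult_right)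
    have "(norm (fourier f \<xi>))\<^sup>2 \<le> ?B\<^sup>2" for \<xi>
      using norm_fourier_le[OF f] by (intro power_mono) auto
    then show "AE \<xi> in lborel. norm ((norm (fourier f \<xi>))\<^sup>2 * gauss (s *\<^sub>R \<xi>)) \<le> norm (?B\<^sup>2 * gauss (s *\<^sub>R \<xi>))"
      using gauss_bounds(1) by (auto simp: abs_mult less_imp_le intro!: mult_right_mono)
  qed measurable
  have "(LINT \<xi>|lborel. (norm (fourier f \<xi>))\<^sup>2 * gauss (s *\<^sub>R \<xi>)) =
     Re (LINT \<xi>|lborel. complex_of_real ((norm (fourier f \<xi>))\<^sup>2 * gauss (s *\<^sub>R \<xi>)))"
    by (simp only: integral_complex_of_real Re_complex_of_real)
  also have "\<dots> = gauss_total TYPE('a) * Re (LINT w|lborel. autocorr f (s *\<^sub>R w) * complex_of_real (gauss w))"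
    unfolding gauss_plancherel[OF f s] by simp
  also have "Re (LINT w|lborel. autocorr f (s *\<^sub>R w) * complex_of_real (gauss w)) =
     (LINT w|lborel. Re (autocorr f (s *\<^sub>R w)) * gauss w)"
  proof (subst integral_Re[symmetric])
    show "integrable lborel (\<lambda>w. autocorr f (s *\<^sub>R w) * complex_of_real (gauss w))"
    proof (rule Bochner_Integration.integrable_bound)
      show "integrable lborel (\<lambda>w. autocorr f (s *\<^sub>R w))"
        using integrable_lborel_scaled[OF integrable_autocorr[OF f]] s by auto
      show "AE w in lborel. norm (autocorr f (s *\<^sub>R w) * complex_of_real (gauss w)) \<le> norm (autocorr f (s *\<^sub>R w))"
        using gauss_bounds by (intro AE_I2) (simp add: norm_mult mult_left_le abs_of_pos[OF gauss_bounds(1)] mult_left_le[OF gauss_bounds(2)])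
    qed measurable
  qed simp
  finally show ?thesis
    using int by (subst nn_integral_eq_integral) (auto simp: less_imp_le[OF gauss_bounds(1)])
qed

text \<open>Fatou's lemma as s tends to 0 in the Gaussian identity; the Gaussian averages of
  \<open>autocorr f\<close> stay below its uniform bound, whatever s is.\<close>

lemma plancherel_le:
  fixes f :: "'a::euclidean_space \<Rightarrow> complex"
  assumes f: "integrable lborel f" and f2: "integrable lborel (\<lambda>x. (norm (f x))\<^sup>2)"
  shows "(\<integral>\<^sup>+ \<xi>. ennreal ((norm (fourier f \<xi>))\<^sup>2) \<partial>lborel) \<le>
    ennreal ((gauss_total TYPE('a))\<^sup>2) * (\<integral>\<^sup>+ x. ennreal ((norm (f x))\<^sup>2) \<partial>lborel)"
proof -
  have fm [measurable]: "f \<in> borel_measurable borel"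
    using f by auto
  let ?K = "gauss_total TYPE('a)"
  let ?N = "LINT x|lborel. (norm (f x))\<^sup>2"
  define s where "s k = 1 / real (Suc k)" for k
  have s: "s k > 0" for k
    by (simp add: s_def)
  have s0: "s \<longlonglongrightarrow> 0"
    unfolding s_def by real_asymp
  have lim: "(\<lambda>k. ennreal ((norm (fourier f \<xi>))\<^sup>2 * gauss (s k *\<^sub>R \<xi>))) \<longlonglongrightarrow> ennreal ((norm (fourier f \<xi>))\<^sup>2)" for \<xi>
  proof -
    have "(\<lambda>k. gauss (s k *\<^sub>R \<xi>)) \<longlonglongrightarrow> exp (- (norm (0 *\<^sub>R \<xi>))\<^sup>2 / 2)"
      unfolding gauss_def by (intro tendsto_intros s0) simp
    then have "(\<lambda>k. (norm (fourier f \<xi>))\<^sup>2 * gauss (s k *\<^sub>R \<xi>)) \<longlonglongrightarrow> (norm (fourier f \<xi>))\<^sup>2 * 1"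
      by (intro tendsto_mult tendsto_const) simp
    then show ?thesis
      by (intro tendsto_ennrealI) simp
  qed
  have "(\<integral>\<^sup>+ \<xi>. ennreal ((norm (fourier f \<xi>))\<^sup>2) \<partial>lborel) =
     (\<integral>\<^sup>+ \<xi>. liminf (\<lambda>k. ennreal ((norm (fourier f \<xi>))\<^sup>2 * gauss (s k *\<^sub>R \<xi>))) \<partial>lborel)"
    using lim_imp_Liminf[OF _ lim] by simp
  also have "\<dots> \<le> liminf (\<lambda>k. \<integral>\<^sup>+ \<xi>. ennreal ((norm (fourier f \<xi>))\<^sup>2 * gauss (s k *\<^sub>R \<xi>)) \<partial>lborel)"
    by (intro nn_integral_liminf) simp
  \<comment> \<open>One factor \<open>?K\<close> comes from the transform of the Gaussian, the other
    from its integral.\<close>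
  also have "\<dots> \<le> liminf (\<lambda>k::nat. ennreal (?K\<^sup>2 * ?N))"
  proof (intro Liminf_mono always_eventually allI)
    fix k
    have "(LINT w|lborel. Re (autocorr f (s k *\<^sub>R w)) * gauss w) \<le> (LINT w|(lborel :: 'a measure). ?N * gauss w)"
    proof (rule integral_mono')
      show "integrable lborel (\<lambda>w::'a. ?N * gauss w)"
        using integrable_gauss by (rule integrable_mult_right)
      show "Re (autocorr f (s k *\<^sub>R w)) * gauss w \<le> ?N * gauss w" for w
        using norm_autocorr_le[OF fm f2, of "s k *\<^sub>R w"] complex_Re_le_cmod[of "autocorr f (s k *\<^sub>R w)"] gauss_bounds(1)[of w]
        by (intro mult_right_mono) auto
      show "0 \<le> ?N * gauss w" for w :: 'a
        using gauss_bounds(1)[of w] by simp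
    qed
    also have "\<dots> = ?N * ?K"
      by (simp add: integral_gauss)
    finally show "(\<integral>\<^sup>+ \<xi>. ennreal ((norm (fourier f \<xi>))\<^sup>2 * gauss (s k *\<^sub>R \<xi>)) \<partial>lborel) \<le> ennreal (?K\<^sup>2 * ?N)"
      unfolding nn_integral_gauss_plancherel[OF f s] using gauss_total_pos[of "TYPE('a)"]
      by (intro ennreal_leI) (simp add: power2_eq_square mult.commute mult.left_commute)
  qed
  also have "\<dots> = ennreal (?K\<^sup>2) * ennreal ?N"
    by (simp add: Liminf_const ennreal_mult')
  finally show ?thesis
    using ennreal_nn_integral_norm2[OF fm f2] by simp
qed

section \<open>Continuity of translations in the L^1 norm\<close>

lemma L1_translation_approx:
  fixes f :: "'a::euclidean_space \<Rightarrow> complex"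
  assumes fm [measurable]: "f \<in> borel_measurable borel"
    and approx: "\<And>e. e > 0 \<Longrightarrow> \<exists>g\<in>borel_measurable borel. (\<integral>\<^sup>+ x. ennreal (norm (f x - g x)) \<partial>lborel) \<le> ennreal e \<and>
      (\<lambda>k. \<integral>\<^sup>+ x. ennreal (norm (g (x + z k) - g x)) \<partial>lborel) \<longlonglongrightarrow> 0"
  shows "(\<lambda>k. \<integral>\<^sup>+ x. ennreal (norm (f (x + z k) - f x)) \<partial>lborel) \<longlonglongrightarrow> 0"
proof (rule order_tendstoI)
  fix a :: ennreal assume "0 < a"
  \<comment> \<open>\<open>a\<close> may be infinite; any \<open>b\<close> strictly below it is
    finite and supplies the real number \<open>d\<close>.\<close>
  then obtain b where b: "0 < b" "b < a"
    using dense by blast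
  then obtain d where d: "0 < d" "ennreal d < a"
    by (cases b) auto
  obtain g where [measurable]: "g \<in> borel_measurable borel"
    and fg: "(\<integral>\<^sup>+ x. ennreal (norm (f x - g x)) \<partial>lborel) \<le> ennreal (d / 3)"
    and g: "(\<lambda>k. \<integral>\<^sup>+ x. ennreal (norm (g (x + z k) - g x)) \<partial>lborel) \<longlonglongrightarrow> 0"
    using approx[of "d / 3"] d(1) by auto
  have "\<forall>\<^sub>F k in sequentially. (\<integral>\<^sup>+ x. ennreal (norm (g (x + z k) - g x)) \<partial>lborel) < ennreal (d / 3)"
    using d(1) by (intro order_tendstoD(2)[OF g]) simp
  then show "\<forall>\<^sub>F k in sequentially. (\<integral>\<^sup>+ x. ennreal (norm (f (x + z k) - f x)) \<partial>lborel) < a"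
  proof eventually_elim
    case (elim k)
    have "(\<integral>\<^sup>+ x. ennreal (norm (f (x + z k) - f x)) \<partial>lborel) \<le>
      (\<integral>\<^sup>+ x. ennreal (norm (f (x + z k) - g (x + z k))) + ennreal (norm (g (x + z k) - g x)) + ennreal (norm (f x - g x)) \<partial>lborel)"
    proof (rule nn_integral_mono)
      fix x
      have "norm (f (x + z k) - f x) \<le> norm (f (x + z k) - g (x + z k)) + norm (g (x + z k) - g x) + norm (f x - g x)"
        using norm_triangle_ineq[of "f (x + z k) - g (x + z k) + (g (x + z k) - g x)" "g x - f x"]
          norm_triangle_ineq[of "f (x + z k) - g (x + z k)" "g (x + z k) - g x"] norm_minus_commute[of "g x" "f x"]
        by simp
      then show "ennreal (norm (f (x + z k) - f x)) \<le>
        ennreal (norm (f (x + z k) - g (x + z k))) + ennreal (norm (g (x + z k) - g x)) + ennreal (norm (f x - g x))"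
        by (simp add: ennreal_plus[symmetric] del: ennreal_plus)
    qed
    also have "\<dots> = (\<integral>\<^sup>+ x. ennreal (norm (f (x + z k) - g (x + z k))) \<partial>lborel) +
        (\<integral>\<^sup>+ x. ennreal (norm (g (x + z k) - g x)) \<partial>lborel) + (\<integral>\<^sup>+ x. ennreal (norm (f x - g x)) \<partial>lborel)"
      by (simp add: nn_integral_add)
    also have "(\<integral>\<^sup>+ x. ennreal (norm (f (x + z k) - g (x + z k))) \<partial>lborel) = (\<integral>\<^sup>+ x. ennreal (norm (f x - g x)) \<partial>lborel)"
      by (rule nn_integral_lborel_translate) simp
    also have "(\<integral>\<^sup>+ x. ennreal (norm (f x - g x)) \<partial>lborel) + (\<integral>\<^sup>+ x. ennreal (norm (g (x + z k) - g x)) \<partial>lborel) +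
        (\<integral>\<^sup>+ x. ennreal (norm (f x - g x)) \<partial>lborel) \<le> ennreal (d / 3) + ennreal (d / 3) + ennreal (d / 3)"
      using fg elim by (intro add_mono) auto
    also have "\<dots> = ennreal d"
      using d(1) by (simp add: ennreal_plus[symmetric] del: ennreal_plus)
    finally show ?case using d(2) by simp
  qed
qed simp

text \<open>A point of an open \<open>U\<close> stays in \<open>U\<close> under small translations,
  so the measure of the points that leave \<open>U\<close> tends to 0 by dominated convergence. The
  points that enter \<open>U\<close> are the translates of those that leave it under the opposite
  translation.\<close>

lemma L1_translation_continuous_open:
  fixes z :: "nat \<Rightarrow> 'a::euclidean_space" and c :: complex
  assumes U: "open U" "emeasure lborel U < \<infinity>" and z: "z \<longlonglongrightarrow> 0"
  shows "(\<lambda>k. \<integral>\<^sup>+ x. ennreal (norm (indicator U (x + z k) *\<^sub>R c - indicator U x *\<^sub>R c)) \<partial>lborel) \<longlonglongrightarrow> 0"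
proof -
  have [measurable]: "U \<in> sets borel"
    using U by simp
  have half: "(\<lambda>k. \<integral>\<^sup>+ x. indicator U x * indicator (- U) (x + z k) \<partial>lborel) \<longlonglongrightarrow> 0" if z: "z \<longlonglongrightarrow> 0" for z :: "nat \<Rightarrow> 'a"
  proof -
    have "(\<lambda>k. \<integral>\<^sup>+ x. indicator U x * indicator (- U) (x + z k) \<partial>lborel) \<longlonglongrightarrow> (\<integral>\<^sup>+ (x::'a). 0 \<partial>lborel)"
    proof (rule nn_integral_dominated_convergence[where w="indicator U"])
      show "AE x in lborel. (\<lambda>k. indicator U x * indicator (- U) (x + z k) :: ennreal) \<longlonglongrightarrow> 0"
      proof (rule AE_I2)
        fix x :: 'a
        show "(\<lambda>k. indicator U x * indicator (- U) (x + z k) :: ennreal) \<longlonglongrightarrow> 0"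
        proof (cases "x \<in> U")
          case True
          have "(\<lambda>k. x + z k) \<longlonglongrightarrow> x"
            using tendsto_add[OF tendsto_const[of x] z] by simp
          then have "\<forall>\<^sub>F k in sequentially. x + z k \<in> U"
            using U(1) True by (rule topological_tendstoD)
          then have "\<forall>\<^sub>F k in sequentially. indicator U x * indicator (- U) (x + z k) = (0 :: ennreal)"
            by eventually_elim (simp add: indicator_def)
          then show ?thesis
            by (rule tendsto_eventually)
        qed simp
      qed
      show "(\<integral>\<^sup>+ x. indicator U x \<partial>lborel) < \<infinity>"
        using U(2) by simp
    qed (auto simp: indicator_def)
    then show ?thesis by simp
  qed
  have eq: "(\<integral>\<^sup>+ x. ennreal (norm (indicator U (x + z k) *\<^sub>R c - indicator U x *\<^sub>R c)) \<partial>lborel) =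
     ennreal (norm c) * ((\<integral>\<^sup>+ x. indicator U x * indicator (- U) (x + z k) \<partial>lborel) + (\<integral>\<^sup>+ x. indicator U x * indicator (- U) (x + - z k) \<partial>lborel))" for k
  proof -
    have "(\<integral>\<^sup>+ x. indicator U x * indicator (- U) (x + - z k) \<partial>lborel) =
      (\<integral>\<^sup>+ x. indicator U (x + z k) * indicator (- U) (x + z k + - z k) \<partial>lborel :: ennreal)"
      by (rule nn_integral_lborel_translate[symmetric]) simp
    also have "\<dots> = (\<integral>\<^sup>+ x. indicator U (x + z k) * indicator (- U) x \<partial>lborel)"
      by simp
    finally have "ennreal (norm c) * ((\<integral>\<^sup>+ x. indicator U x * indicator (- U) (x + z k) \<partial>lborel) + (\<integral>\<^sup>+ x. indicator U x * indicator (- U) (x + - z k) \<partial>lborel))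
      = (\<integral>\<^sup>+ x. ennreal (norm c) * (indicator U x * indicator (- U) (x + z k) + indicator U (x + z k) * indicator (- U) x) \<partial>lborel)"
      by (simp add: nn_integral_cmult nn_integral_add)
    also have "\<dots> = (\<integral>\<^sup>+ x. ennreal (norm (indicator U (x + z k) *\<^sub>R c - indicator U x *\<^sub>R c)) \<partial>lborel)"
      by (intro nn_integral_cong) (auto simp: indicator_def)
    finally show ?thesis ..
  qed
  have "(\<lambda>k. - z k) \<longlonglongrightarrow> 0"
    using tendsto_minus[OF z] by simp
  then have "(\<lambda>k. (\<integral>\<^sup>+ x. indicator U x * indicator (- U) (x + z k) \<partial>lborel) + (\<integral>\<^sup>+ x. indicator U x * indicator (- U) (x + - z k) \<partial>lborel)) \<longlonglongrightarrow> (0 + 0 :: ennreal)"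
    using half[OF z] half[of "\<lambda>k. - z k"] by (intro tendsto_add) auto
  from ennreal_tendsto_cmult[OF _ this, of "ennreal (norm c)"] show ?thesis
    unfolding eq by simp
qed

text \<open>A density argument along the construction of integrable functions: outer regularity
  replaces a measurable set by an open superset, and limits of simple functions are handled by
  \<open>L1_translation_approx\<close>.\<close>

lemma L1_translation_continuous:
  fixes f :: "'a::euclidean_space \<Rightarrow> complex"
  assumes "integrable lborel f" and z: "z \<longlonglongrightarrow> 0"
  shows "(\<lambda>k. \<integral>\<^sup>+ x. ennreal (norm (f (x + z k) - f x)) \<partial>lborel) \<longlonglongrightarrow> 0"
  using assms(1)
proof induction
  case (base A c)
  then have [measurable]: "A \<in> sets borel" by simp
  show ?case
  proof (rule L1_translation_approx)
    fix e :: real assume e: "e > 0"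
    \<comment> \<open>The summand 1 keeps the tolerance defined when \<open>c\<close> is 0.\<close>
    then have pos: "e / (norm c + 1) > 0"
      by (intro divide_pos_pos) (auto intro: add_nonneg_pos)
    then obtain U where U: "open U" "A \<subseteq> U" "emeasure lborel (U - A) < ennreal (e / (norm c + 1))"
      using outer_regular_lborel[of A] by (metis \<open>A \<in> sets borel\<close>)
    have [measurable]: "U \<in> sets borel"
      using U by simp
    have "emeasure lborel U = emeasure lborel A + emeasure lborel (U - A)"
      using U(2) by (subst plus_emeasure) (auto simp: Un_absorb1)
    also have "\<dots> < \<infinity>"
      using base(2) U(3) by (auto simp: ennreal_add_less_top intro: less_trans[OF _ ennreal_less_top])
    finally have fin: "emeasure lborel U < \<infinity>" .
    have "(\<integral>\<^sup>+ x. ennreal (norm (indicator A x *\<^sub>R c - indicator U x *\<^sub>R c)) \<partial>lborel) = (\<integral>\<^sup>+ x. ennreal (norm c) * indicator (U - A) x \<partial>lborel)"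
      using U(2) by (intro nn_integral_cong) (auto simp: indicator_def)
    also have "\<dots> = ennreal (norm c) * emeasure lborel (U - A)"
      by (simp add: nn_integral_cmult)
    also have "\<dots> \<le> ennreal (norm c) * ennreal (e / (norm c + 1))"
      using U(3) by (intro mult_left_mono) auto
    also have "\<dots> = ennreal (norm c * (e / (norm c + 1)))"
      using pos by (intro ennreal_mult[symmetric]) auto
    also have "\<dots> \<le> ennreal e"
    proof (rule ennreal_leI)
      have "norm c + 1 > 0"
        by (intro add_nonneg_pos) auto
      then show "norm c * (e / (norm c + 1)) \<le> e"
        using e by (simp add: divide_le_eq distrib_left)
    qed
    finally show "\<exists>g\<in>borel_measurable borel. (\<integral>\<^sup>+ x. ennreal (norm (indicator A x *\<^sub>R c - g x)) \<partial>lborel) \<le> ennreal e \<and>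
      (\<lambda>k. \<integral>\<^sup>+ x. ennreal (norm (g (x + z k) - g x)) \<partial>lborel) \<longlonglongrightarrow> 0"
      using L1_translation_continuous_open[OF U(1) fin z, of c]
      by (intro bexI[of _ "\<lambda>x. indicator U x *\<^sub>R c"]) auto
  qed measurable
next
  case (add f g)
  then have [measurable]: "f \<in> borel_measurable borel" "g \<in> borel_measurable borel"
    by auto
  have sum: "(\<lambda>k. (\<integral>\<^sup>+ x. ennreal (norm (f (x + z k) - f x)) \<partial>lborel) + (\<integral>\<^sup>+ x. ennreal (norm (g (x + z k) - g x)) \<partial>lborel)) \<longlonglongrightarrow> 0"
    using tendsto_add[OF add.IH] by simp
  show ?case
  proof (rule tendsto_sandwich[OF _ _ tendsto_const sum])
    show "\<forall>\<^sub>F k in sequentially. (\<integral>\<^sup>+ x. ennreal (norm (f (x + z k) + g (x + z k) - (f x + g x))) \<partial>lborel) \<le>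
      (\<integral>\<^sup>+ x. ennreal (norm (f (x + z k) - f x)) \<partial>lborel) + (\<integral>\<^sup>+ x. ennreal (norm (g (x + z k) - g x)) \<partial>lborel)"
    proof (rule always_eventually, rule allI)
      fix k
      have "norm (f (x + z k) + g (x + z k) - (f x + g x)) \<le> norm (f (x + z k) - f x) + norm (g (x + z k) - g x)" for x
        by (rule order_trans[OF _ norm_triangle_ineq]) (simp add: algebra_simps)
      then have "(\<integral>\<^sup>+ x. ennreal (norm (f (x + z k) + g (x + z k) - (f x + g x))) \<partial>lborel) \<le>
       (\<integral>\<^sup>+ x. ennreal (norm (f (x + z k) - f x)) + ennreal (norm (g (x + z k) - g x)) \<partial>lborel)"
        by (intro nn_integral_mono) (simp add: ennreal_plus[symmetric] del: ennreal_plus)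
      then show "(\<integral>\<^sup>+ x. ennreal (norm (f (x + z k) + g (x + z k) - (f x + g x))) \<partial>lborel) \<le>
        (\<integral>\<^sup>+ x. ennreal (norm (f (x + z k) - f x)) \<partial>lborel) + (\<integral>\<^sup>+ x. ennreal (norm (g (x + z k) - g x)) \<partial>lborel)"
        by (simp add: nn_integral_add)
    qed
  qed simp
next
  case (lim f s)
  then have [measurable]: "f \<in> borel_measurable borel" "\<And>i. s i \<in> borel_measurable borel"
    by auto
  have "(\<lambda>i. \<integral>\<^sup>+ x. ennreal (norm (f x - s i x)) \<partial>lborel) \<longlonglongrightarrow> (\<integral>\<^sup>+ (x::'a). 0 \<partial>lborel)"
  \<comment> \<open>The approximants satisfy |s i x| <= 2 |f x|, hence the 3.\<close>
  proof (rule nn_integral_dominated_convergence[where w="\<lambda>x. ennreal (3 * norm (f x))"])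
    show "(\<integral>\<^sup>+ x. ennreal (3 * norm (f x)) \<partial>lborel) < \<infinity>"
      using lim.hyps(4) by (simp add: ennreal_mult nn_integral_cmult integrable_iff_bounded ennreal_mult_less_top)
    show "AE x in lborel. ennreal (norm (f x - s i x)) \<le> ennreal (3 * norm (f x))" for i
    proof (intro AE_I2 ennreal_leI)
      fix x
      show "norm (f x - s i x) \<le> 3 * norm (f x)"
        using lim.hyps(3)[of x i] norm_triangle_ineq4[of "f x" "s i x"] by simp
    qed
    show "AE x in lborel. (\<lambda>i. ennreal (norm (f x - s i x))) \<longlonglongrightarrow> 0"
    proof (rule AE_I2)
      fix x
      have "(\<lambda>i. norm (f x - s i x)) \<longlonglongrightarrow> norm (f x - f x)"
        using lim.hyps(2)[of x] by (intro tendsto_intros) simp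
      then have "(\<lambda>i. ennreal (norm (f x - s i x))) \<longlonglongrightarrow> ennreal 0"
        by (intro tendsto_ennrealI) simp
      then show "(\<lambda>i. ennreal (norm (f x - s i x))) \<longlonglongrightarrow> 0"
        by simp
    qed
  qed auto
  then have conv: "(\<lambda>i. \<integral>\<^sup>+ x. ennreal (norm (f x - s i x)) \<partial>lborel) \<longlonglongrightarrow> 0"
    by simp
  show ?case
  proof (rule L1_translation_approx)
    fix e :: real assume "e > 0"
    then have "\<forall>\<^sub>F i in sequentially. (\<integral>\<^sup>+ x. ennreal (norm (f x - s i x)) \<partial>lborel) < ennreal e"
      by (intro order_tendstoD(2)[OF conv]) simp
    then obtain i where "(\<integral>\<^sup>+ x. ennreal (norm (f x - s i x)) \<partial>lborel) < ennreal e"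
      by (auto dest: eventually_happens)
    then show "\<exists>g\<in>borel_measurable borel. (\<integral>\<^sup>+ x. ennreal (norm (f x - g x)) \<partial>lborel) \<le> ennreal e \<and>
      (\<lambda>k. \<integral>\<^sup>+ x. ennreal (norm (g (x + z k) - g x)) \<partial>lborel) \<longlonglongrightarrow> 0"
      using lim.IH[of i] by (intro bexI[of _ "s i"]) auto
  qed simp
qed

text \<open>For |f| <= B, the difference of \<open>autocorr f\<close> at z and at 0 is at most B
  times the L^1 distance of f from its translate by z. Hence \<open>autocorr f\<close> is continuous
  at 0, and its Gaussian averages converge to the squared L^2 norm instead of merely staying below
  it.\<close>

lemma plancherel_ge_bounded:
  fixes f :: "'a::euclidean_space \<Rightarrow> complex"
  assumes f: "integrable lborel f" and B: "\<And>x. norm (f x) \<le> B"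
  shows "ennreal ((gauss_total TYPE('a))\<^sup>2) * (\<integral>\<^sup>+ x. ennreal ((norm (f x))\<^sup>2) \<partial>lborel) \<le>
    (\<integral>\<^sup>+ \<xi>. ennreal ((norm (fourier f \<xi>))\<^sup>2) \<partial>lborel)"
proof -
  have fm [measurable]: "f \<in> borel_measurable borel"
    using f by auto
  have B0: "B \<ge> 0"
    using order_trans[OF norm_ge_zero B] .
  let ?K = "gauss_total TYPE('a)"
  let ?N = "LINT x|lborel. (norm (f x))\<^sup>2"
  have f2: "integrable lborel (\<lambda>x. (norm (f x))\<^sup>2)"
  proof (rule Bochner_Integration.integrable_bound)
    show "integrable lborel (\<lambda>x. B * norm (f x))"
      using f by auto
    show "AE x in lborel. norm ((norm (f x))\<^sup>2) \<le> norm (B * norm (f x))"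
      using B B0 by (auto simp: power2_eq_square abs_mult intro!: mult_right_mono)
  qed simp
  define s where "s k = 1 / real (Suc k)" for k
  have s: "s k > 0" for k
    by (simp add: s_def)
  have s0: "s \<longlonglongrightarrow> 0"
    unfolding s_def by real_asymp
  have ac: "(\<lambda>k. autocorr f (z k)) \<longlonglongrightarrow> complex_of_real ?N" if z: "z \<longlonglongrightarrow> 0" for z
  proof -
    have int: "integrable lborel (\<lambda>x. f (x + z k) * cnj (f x))" for k
    proof (rule Bochner_Integration.integrable_bound)
      show "integrable lborel (\<lambda>x. B * norm (f x))"
        using f by auto
      show "AE x in lborel. norm (f (x + z k) * cnj (f x)) \<le> norm (B * norm (f x))"
        using B B0 by (auto simp: norm_mult abs_mult intro!: mult_right_mono)
    qed measurable
    have bd: "ennreal (norm (autocorr f (z k) - complex_of_real ?N)) \<le>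
      ennreal B * (\<integral>\<^sup>+ x. ennreal (norm (f (x + z k) - f x)) \<partial>lborel)" for k
    proof -
      have N: "complex_of_real ?N = (LINT x|lborel. complex_of_real ((norm (f x))\<^sup>2))"
        by (rule integral_complex_of_real[symmetric])
      have intN: "integrable lborel (\<lambda>x. complex_of_real ((norm (f x))\<^sup>2))"
        using f2 by (simp only: complex_of_real_integrable_eq)
      have e: "(f (x + z k) - f x) * cnj (f x) = f (x + z k) * cnj (f x) - complex_of_real ((norm (f x))\<^sup>2)" for x
        unfolding complex_norm_square by (simp add: algebra_simps)
      have eq: "autocorr f (z k) - complex_of_real ?N = (LINT x|lborel. (f (x + z k) - f x) * cnj (f x))"
        unfolding autocorr_def N e by (rule Bochner_Integration.integral_diff[OF int intN, symmetric])
      have int': "integrable lborel (\<lambda>x. (f (x + z k) - f x) * cnj (f x))"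
        unfolding e by (rule Bochner_Integration.integrable_diff[OF int intN])
      have "ennreal (norm (autocorr f (z k) - complex_of_real ?N)) \<le> (\<integral>\<^sup>+ x. ennreal (norm ((f (x + z k) - f x) * cnj (f x))) \<partial>lborel)"
        unfolding eq by (rule integral_norm_bound_ennreal[OF int'])
      also have "\<dots> \<le> (\<integral>\<^sup>+ x. ennreal B * ennreal (norm (f (x + z k) - f x)) \<partial>lborel)"
      proof (rule nn_integral_mono)
        fix x
        have "norm ((f (x + z k) - f x) * cnj (f x)) \<le> B * norm (f (x + z k) - f x)"
          unfolding norm_mult complex_mod_cnj using B[of x] by (subst mult.commute) (rule mult_right_mono, auto)
        then show "ennreal (norm ((f (x + z k) - f x) * cnj (f x))) \<le> ennreal B * ennreal (norm (f (x + z k) - f x))"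
          using B0 by (simp add: ennreal_mult[symmetric] del: norm_mult)
      qed
      also have "\<dots> = ennreal B * (\<integral>\<^sup>+ x. ennreal (norm (f (x + z k) - f x)) \<partial>lborel)"
        by (rule nn_integral_cmult) simp
      finally show ?thesis .
    qed
    have "(\<lambda>k. ennreal B * (\<integral>\<^sup>+ x. ennreal (norm (f (x + z k) - f x)) \<partial>lborel)) \<longlonglongrightarrow> ennreal B * 0"
      by (intro ennreal_tendsto_cmult L1_translation_continuous[OF f z]) simp
    then have lim: "(\<lambda>k. ennreal B * (\<integral>\<^sup>+ x. ennreal (norm (f (x + z k) - f x)) \<partial>lborel)) \<longlonglongrightarrow> ennreal 0"
      by simp
    have "(\<lambda>k. ennreal (norm (autocorr f (z k) - complex_of_real ?N))) \<longlonglongrightarrow> ennreal 0"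
      by (rule tendsto_sandwich[OF _ always_eventually[OF allI[OF bd]] tendsto_const lim]) simp
    then have "(\<lambda>k. norm (autocorr f (z k) - complex_of_real ?N)) \<longlonglongrightarrow> 0"
      by (rule tendsto_ennrealD) auto
    then show ?thesis
      unfolding tendsto_norm_zero_iff by (rule LIM_zero_cancel)
  qed
  have "(\<lambda>k. LINT w|lborel. Re (autocorr f (s k *\<^sub>R w)) * gauss w) \<longlonglongrightarrow> (LINT w|(lborel :: 'a measure). ?N * gauss w)"
  proof (rule integral_dominated_convergence)
    show "integrable lborel (\<lambda>w::'a. ?N * gauss w)"
      using integrable_gauss by (rule integrable_mult_right)
    show "AE w in lborel. (\<lambda>k. Re (autocorr f (s k *\<^sub>R w)) * gauss w) \<longlonglongrightarrow> ?N * gauss w"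
    proof (intro AE_I2 tendsto_mult tendsto_const)
      fix w :: 'a
      have "(\<lambda>k. s k *\<^sub>R w) \<longlonglongrightarrow> 0 *\<^sub>R w"
        by (intro tendsto_intros s0)
      then show "(\<lambda>k. Re (autocorr f (s k *\<^sub>R w))) \<longlonglongrightarrow> ?N"
        using tendsto_Re[OF ac[of "\<lambda>k. s k *\<^sub>R w"]] by simp
    qed
    show "AE w in lborel. norm (Re (autocorr f (s k *\<^sub>R w)) * gauss w) \<le> ?N * gauss w" for k
    proof (rule AE_I2)
      fix w :: 'a
      show "norm (Re (autocorr f (s k *\<^sub>R w)) * gauss w) \<le> ?N * gauss w"
        using norm_autocorr_le[OF fm f2, of "s k *\<^sub>R w"] abs_Re_le_cmod[of "autocorr f (s k *\<^sub>R w)"] gauss_bounds(1)[of w]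
        by (auto simp: abs_mult intro!: mult_right_mono)
    qed
  qed measurable
  then have "(\<lambda>k. ennreal (?K * (LINT w|lborel. Re (autocorr f (s k *\<^sub>R w)) * gauss w))) \<longlonglongrightarrow> ennreal (?K * (LINT w|(lborel :: 'a measure). ?N * gauss w))"
    by (intro tendsto_ennrealI tendsto_mult tendsto_const)
  \<comment> \<open>Since \<open>gauss\<close> is at most 1, each regularized integral is bounded by
    the full integral of |f^|^2.\<close>
  moreover have "ennreal (?K * (LINT w|lborel. Re (autocorr f (s k *\<^sub>R w)) * gauss w)) \<le> (\<integral>\<^sup>+ \<xi>. ennreal ((norm (fourier f \<xi>))\<^sup>2) \<partial>lborel)" for k
    unfolding nn_integral_gauss_plancherel[OF f s, symmetric]
    using gauss_bounds by (intro nn_integral_mono ennreal_leI) (auto intro!: mult_left_le)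
  ultimately have "ennreal (?K * (LINT w|(lborel :: 'a measure). ?N * gauss w)) \<le> (\<integral>\<^sup>+ \<xi>. ennreal ((norm (fourier f \<xi>))\<^sup>2) \<partial>lborel)"
    by (intro LIMSEQ_le_const2) auto
  moreover have "ennreal (?K * (LINT w|(lborel :: 'a measure). ?N * gauss w)) = ennreal (?K\<^sup>2) * ennreal ?N"
    by (simp add: integral_gauss ennreal_mult'[symmetric] power2_eq_square mult_ac)
  ultimately show ?thesis
    using ennreal_nn_integral_norm2[OF fm f2] by simp
qed

subsection \<open>Lebesgue norms\<close>

lemma enn_powr_ennreal: "0 \<le> x \<Longrightarrow> enn_powr (ennreal x) a = ennreal (x powr a)"
  by (simp add: enn_powr_def)

lemma enn_powr_top [simp]: "enn_powr \<infinity> a = \<infinity>" "enn_powr top a = top"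
  by (simp_all add: enn_powr_def)

lemma enn_powr_mono:
  assumes "x \<le> y" "0 \<le> a"
  shows "enn_powr x a \<le> enn_powr y a"
proof (cases y)
  case (real s)
  then obtain r where r: "x = ennreal r" "0 \<le> r"
    using assms(1) by (cases x) (auto simp: top_unique)
  then show ?thesis
    using assms real by (auto simp: enn_powr_ennreal intro!: ennreal_leI powr_mono2)
qed simp

lemma enn_powr_cmult:
  assumes "0 \<le> c" "0 < a"
  shows "enn_powr (ennreal c * x) a = ennreal (c powr a) * enn_powr x a"
proof (cases x)
  case (real r)
  then show ?thesis
    using assms by (simp add: enn_powr_ennreal ennreal_mult[symmetric] powr_mult)
next
  case top
  then show ?thesis
    using assms by (cases "c = 0") (simp_all add: enn_powr_def ennreal_mult_top)
qed

lemma enn_powr_add_le: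
  assumes "0 < a" "a \<le> 1"
  shows "enn_powr (x + y) a \<le> 2 * (enn_powr x a + enn_powr y a)"
proof -
  have "x + y \<le> ennreal 2 * max x y"
    by (simp add: mult_2 add_mono)
  then have "enn_powr (x + y) a \<le> enn_powr (ennreal 2 * max x y) a"
    using assms by (intro enn_powr_mono) auto
  also have "\<dots> = ennreal (2 powr a) * enn_powr (max x y) a"
    using assms by (intro enn_powr_cmult) auto
  also have "\<dots> \<le> ennreal 2 * (enn_powr x a + enn_powr y a)"
  proof (rule mult_mono)
    show "ennreal (2 powr a) \<le> ennreal 2"
      using assms powr_mono[of a 1 2] by (intro ennreal_leI) simp
    show "enn_powr (max x y) a \<le> enn_powr x a + enn_powr y a"
      by (auto simp: max_def)
  qed auto
  finally show ?thesis by simp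
qed

lemma enn_powr_less_top_iff: "enn_powr x a < top \<longleftrightarrow> x < top"
  by (cases x) (auto simp: enn_powr_ennreal)

lemma Lp_norm_lborel: "Lp_norm p f = enn_powr (\<integral>\<^sup>+ x. ennreal (norm (f x) powr p) \<partial>lborel) (1 / p)"
  by (simp add: Lp_norm_def nn_integral_completion)

lemma Lp_norm_eq_powr:
  assumes "0 < p"
  shows "(\<integral>\<^sup>+ x. ennreal (norm (f x) powr p) \<partial>lborel) = enn_powr (Lp_norm p f) p"
proof -
  have "enn_powr (enn_powr x (1 / p)) p = x" for x
    using assms by (cases x) (auto simp: enn_powr_ennreal powr_powr)
  then show ?thesis
    by (simp add: Lp_norm_lborel)
qed

lemma Lp_norm_mono:
  assumes "AE x in lborel. norm (f x) \<le> norm (g x)" "0 < p"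
  shows "Lp_norm p f \<le> Lp_norm p g"
  unfolding Lp_norm_lborel using assms
  by (intro enn_powr_mono nn_integral_mono_AE) (auto elim!: AE_mp intro!: ennreal_leI powr_mono2)

lemma Lp_norm_cong_AE:
  assumes "AE x in lborel. f x = g x"
  shows "Lp_norm p f = Lp_norm p g"
  unfolding Lp_norm_lborel using assms by (intro arg_cong2[where f=enn_powr] nn_integral_cong_AE) auto

lemma Lp_norm_cmult:
  assumes [measurable]: "f \<in> borel_measurable lebesgue" and p: "0 < p"
  shows "Lp_norm p (\<lambda>x. c * f x) = ennreal (norm c) * Lp_norm p f"
proof -
  have "(\<integral>\<^sup>+ x. ennreal (norm (c * f x) powr p) \<partial>lebesgue) = ennreal (norm c powr p) * (\<integral>\<^sup>+ x. ennreal (norm (f x) powr p) \<partial>lebesgue)"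
    by (simp add: norm_mult powr_mult ennreal_mult nn_integral_cmult)
  then show ?thesis
    using p unfolding Lp_norm_def by (simp only: enn_powr_cmult powr_ge_zero) (simp add: enn_powr_cmult powr_powr)
qed

text \<open>A substitute for Minkowski's inequality from |a + b|^p <= 2^p (|a|^p + |b|^p). One
  factor 2 is the p-th root of 2^p, the other comes from splitting the root of a sum, so the
  constant does not depend on p.\<close>

lemma Lp_norm_add:
  assumes [measurable]: "f \<in> borel_measurable lebesgue" "g \<in> borel_measurable lebesgue" and p: "1 \<le> p"
  shows "Lp_norm p (\<lambda>x. f x + g x) \<le> 4 * (Lp_norm p f + Lp_norm p g)"
proof -
  let ?N = "\<lambda>f :: 'a \<Rightarrow> complex. \<integral>\<^sup>+ x. ennreal (norm (f x) powr p) \<partial>lebesgue"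
  have "?N (\<lambda>x. f x + g x) \<le> (\<integral>\<^sup>+ x. ennreal (2 powr p) * (ennreal (norm (f x) powr p) + ennreal (norm (g x) powr p)) \<partial>lebesgue)"
  proof (rule nn_integral_mono)
    fix x
    have "norm (f x + g x) powr p \<le> (2 * max (norm (f x)) (norm (g x))) powr p"
      using p norm_triangle_ineq[of "f x" "g x"] by (intro powr_mono2) auto
    also have "\<dots> = 2 powr p * max (norm (f x)) (norm (g x)) powr p"
      by (simp add: powr_mult)
    also have "\<dots> \<le> 2 powr p * (norm (f x) powr p + norm (g x) powr p)"
      by (intro mult_left_mono) (auto simp: max_def)
    finally show "ennreal (norm (f x + g x) powr p) \<le> ennreal (2 powr p) * (ennreal (norm (f x) powr p) + ennreal (norm (g x) powr p))"
      by (simp add: ennreal_mult[symmetric] ennreal_plus[symmetric] del: ennreal_plus)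
  qed
  also have "\<dots> = ennreal (2 powr p) * (?N f + ?N g)"
    by (simp add: nn_integral_cmult nn_integral_add)
  finally have "enn_powr (?N (\<lambda>x. f x + g x)) (1 / p) \<le> enn_powr (ennreal (2 powr p) * (?N f + ?N g)) (1 / p)"
    using p by (intro enn_powr_mono) auto
  also have "\<dots> = 2 * enn_powr (?N f + ?N g) (1 / p)"
    using p by (subst enn_powr_cmult) (auto simp: powr_powr)
  also have "\<dots> \<le> 2 * (2 * (enn_powr (?N f) (1 / p) + enn_powr (?N g) (1 / p)))"
    using p by (intro mult_left_mono enn_powr_add_le) auto
  finally show ?thesis
    unfolding Lp_norm_def by (simp add: mult.assoc[symmetric])
qed

lemma Lp_norm_diff:
  assumes "f \<in> borel_measurable lebesgue" "g \<in> borel_measurable lebesgue" "1 \<le> p"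
  shows "Lp_norm p (\<lambda>x. f x - g x) \<le> 4 * (Lp_norm p f + Lp_norm p g)"
  using Lp_norm_add[of f "\<lambda>x. - g x" p] assms by (simp add: Lp_norm_def)

lemma LpI: "f \<in> borel_measurable lebesgue \<Longrightarrow> Lp_norm p f < \<infinity> \<Longrightarrow> f \<in> Lp p"
  by (simp add: Lp_def)

lemma LpD: "f \<in> Lp p \<Longrightarrow> f \<in> borel_measurable lebesgue" "f \<in> Lp p \<Longrightarrow> Lp_norm p f < \<infinity>"
  by (simp_all add: Lp_def)

lemma Lp_diff:
  assumes "f \<in> Lp p" "g \<in> Lp p" "1 \<le> p"
  shows "(\<lambda>x. f x - g x) \<in> Lp p"
proof (rule LpI)
  note [measurable] = LpD(1)[OF assms(1)] LpD(1)[OF assms(2)]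
  show "(\<lambda>x. f x - g x) \<in> borel_measurable lebesgue"
    by measurable
  have "Lp_norm p (\<lambda>x. f x - g x) \<le> 4 * (Lp_norm p f + Lp_norm p g)"
    using assms by (intro Lp_norm_diff LpD(1))
  also have "\<dots> < \<infinity>"
    using LpD(2)[OF assms(1)] LpD(2)[OF assms(2)] by (simp add: ennreal_mult_less_top ennreal_add_less_top)
  finally show "Lp_norm p (\<lambda>x. f x - g x) < \<infinity>" .
qed

lemma Lp1_iff_integrable:
  "f \<in> Lp 1 \<longleftrightarrow> integrable lebesgue f"
  unfolding Lp_def Lp_norm_def integrable_iff_bounded by (auto simp: enn_powr_less_top_iff)

text \<open>The entry point for every transfer of a statement from Borel functions to elements of
  \<open>Lp p\<close>.\<close>

lemma lebesgue_borel_representative: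
  fixes f :: "'a::euclidean_space \<Rightarrow> complex"
  assumes f: "f \<in> borel_measurable lebesgue"
  shows "\<exists>g\<in>borel_measurable borel. AE x in lborel. f x = g x"
proof -
  have "(\<lambda>x. Re (f x)) \<in> borel_measurable lebesgue" "(\<lambda>x. Im (f x)) \<in> borel_measurable lebesgue"
    using f by (auto simp: borel_measurable_complex_iff)
  then obtain u v where "u \<in> borel_measurable lborel" "AE x in lborel. Re (f x) = u x"
    "v \<in> borel_measurable lborel" "AE x in lborel. Im (f x) = v x"
    by (metis completion_ex_borel_measurable_real)
  then show ?thesis
    by (intro bexI[of _ "\<lambda>x. Complex (u x) (v x)"])
      (auto simp: borel_measurable_complex_iff complex_eq_iff)
qed

subsection \<open>The Hausdorff-Young inequality\<close>

lemma nn_integral_powr_Icc: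
  assumes "a > -1" "c \<ge> 0"
  shows "(\<integral>\<^sup>+ l. ennreal (l powr a) * indicator {0..c} l \<partial>lborel) = ennreal (c powr (a + 1) / (a + 1))"
proof -
  have "((\<lambda>l. l powr a) has_integral (c powr (a + 1) / (a + 1))) {0..c}"
    using assms by (rule has_integral_powr_from_0)
  then show ?thesis
    by (intro nn_integral_has_integral_lebesgue') auto
qed

text \<open>Splitting \<open>f\<close> at height \<open>s = (\<lambda>/2)\<^bsup>-1/(p-1)\<^esup>\<close> makes the transform of the large part at most
  \<open>\<lambda>/2\<close>, so that only the bounded part, for which the \<open>L\<^sup>2\<close> theory applies, contributes to the level set.\<close>

lemma fourier_level_set:
  fixes f :: "'a::euclidean_space \<Rightarrow> complex"
  assumes p: "1 < p" and l: "0 < l" and f: "integrable lborel f"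
    and fp: "(\<integral>\<^sup>+ x. ennreal (norm (f x) powr p) \<partial>lborel) \<le> 1"
  shows "emeasure lborel {\<xi>. l \<le> norm (fourier f \<xi>)} \<le>
    ennreal (4 * (gauss_total TYPE('a))\<^sup>2 * l powr (- 2)) *
    (\<integral>\<^sup>+ x. ennreal ((norm (f x))\<^sup>2) * indicator {x. l * norm (f x) powr (p - 1) \<le> 2} x \<partial>lborel)"
proof -
  let ?K = "gauss_total TYPE('a)"
  have fm [measurable]: "f \<in> borel_measurable borel"
    using f by auto
  define S where "S = {x. l * norm (f x) powr (p - 1) \<le> 2}"
  have [measurable]: "S \<in> sets borel"
    unfolding S_def by measurable
  define g where "g x = indicator S x *\<^sub>R f x" for x
  define h where "h x = indicator (- S) x *\<^sub>R f x" for x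
  have gi: "integrable lborel g" and hi: "integrable lborel h"
    unfolding g_def[abs_def] h_def[abs_def] using f by (auto intro: integrable_mult_indicator)
  have [measurable]: "g \<in> borel_measurable borel" "h \<in> borel_measurable borel"
    using gi hi by auto
  have fgh: "fourier f \<xi> = fourier g \<xi> + fourier h \<xi>" for \<xi>
  proof -
    have "fourier g \<xi> + fourier h \<xi> = (LINT x|lborel. g x * chi x \<xi> + h x * chi x \<xi>)"
      by (simp only: fourier_lborel[OF \<open>g \<in> borel_measurable borel\<close>] fourier_lborel[OF \<open>h \<in> borel_measurable borel\<close>]
          Bochner_Integration.integral_add[OF integrable_mult_chi[OF gi] integrable_mult_chi[OF hi]])
    also have "\<dots> = fourier f \<xi>"
      unfolding fourier_lborel[OF fm]
      by (intro Bochner_Integration.integral_cong refl) (auto simp: g_def h_def indicator_def)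
    finally show ?thesis ..
  qed
  \<comment> \<open>Off \<open>S\<close> the factor l |f|^(p-1) exceeds 2, so |f| is dominated by
    (l/2) |f|^p, whose integral is at most l/2 by the normalization of \<open>f\<close>.\<close>
  have h_le: "norm (h x) \<le> l / 2 * norm (f x) powr p" for x
  proof (cases "x \<in> S")
    case False
    then have "2 < l * norm (f x) powr (p - 1)"
      by (simp add: S_def)
    then have "norm (f x) * 2 \<le> norm (f x) * (l * norm (f x) powr (p - 1))"
      by (intro mult_left_mono) auto
    also have "\<dots> = l * norm (f x) powr p"
      using p by (cases "f x = 0") (auto simp: powr_diff)
    finally show ?thesis
      using False by (simp add: h_def)
  qed (use l in \<open>auto simp: h_def\<close>)
  have h_hat: "norm (fourier h \<xi>) \<le> l / 2" for \<xi>
  proof -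
    have "ennreal (LINT x|lborel. norm (h x)) = (\<integral>\<^sup>+ x. ennreal (norm (h x)) \<partial>lborel)"
      using hi by (intro nn_integral_eq_integral[symmetric]) auto
    also have "\<dots> \<le> (\<integral>\<^sup>+ x. ennreal (l / 2) * ennreal (norm (f x) powr p) \<partial>lborel)"
      using h_le l by (intro nn_integral_mono) (simp add: ennreal_mult[symmetric] ennreal_leI)
    also have "\<dots> = ennreal (l / 2) * (\<integral>\<^sup>+ x. ennreal (norm (f x) powr p) \<partial>lborel)"
      by (rule nn_integral_cmult) measurable
    also have "\<dots> \<le> ennreal (l / 2) * 1"
      using fp by (rule mult_left_mono) simp
    finally have "(LINT x|lborel. norm (h x)) \<le> l / 2"
      using l by simp
    then show ?thesis
      using norm_fourier_le[OF hi, of \<xi>] by linarith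
  qed
  have g2: "integrable lborel (\<lambda>x. (norm (g x))\<^sup>2)"
  proof (rule Bochner_Integration.integrable_bound)
    let ?s = "(2 / l) powr (1 / (p - 1))"
    show "integrable lborel (\<lambda>x. ?s * norm (f x))"
      using f by auto
    have "norm ((norm (g x))\<^sup>2) \<le> norm (?s * norm (f x))" for x
    proof (cases "x \<in> S")
      case True
      then have "norm (f x) powr (p - 1) \<le> 2 / l"
        using l by (simp add: S_def field_simps)
      then have "(norm (f x) powr (p - 1)) powr (1 / (p - 1)) \<le> ?s"
        using p by (intro powr_mono2) auto
      then have "norm (f x) \<le> ?s"
        using p by (simp add: powr_powr)
      then have "norm (f x) * norm (f x) \<le> ?s * norm (f x)"
        by (intro mult_right_mono) auto
      then show ?thesis
        using True by (simp add: g_def power2_eq_square)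
    qed (simp add: g_def)
    then show "AE x in lborel. norm ((norm (g x))\<^sup>2) \<le> norm (?s * norm (f x))"
      by simp
  qed simp
  have "emeasure lborel {\<xi>. l \<le> norm (fourier f \<xi>)} = (\<integral>\<^sup>+ \<xi>. indicator {\<xi>. l \<le> norm (fourier f \<xi>)} \<xi> \<partial>lborel)"
    by (rule nn_integral_indicator[symmetric]) measurable
  also have "\<dots> \<le> (\<integral>\<^sup>+ \<xi>. ennreal (4 * l powr (- 2)) * ennreal ((norm (fourier g \<xi>))\<^sup>2) \<partial>lborel)"
  proof (rule nn_integral_mono)
    fix \<xi>
    \<comment> \<open>Chebyshev's inequality with exponent 2: where |f^| >= l, the bounded part must
      contribute at least l/2. Squaring this half gives the 4.\<close>
    have "1 \<le> 4 * l powr (- 2) * (norm (fourier g \<xi>))\<^sup>2" if "l \<le> norm (fourier f \<xi>)"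
    proof -
      have "l / 2 \<le> norm (fourier g \<xi>)"
        using h_hat[of \<xi>] that norm_triangle_ineq[of "fourier g \<xi>" "fourier h \<xi>"] by (simp add: fgh)
      then have "(l / 2)\<^sup>2 \<le> (norm (fourier g \<xi>))\<^sup>2"
        using l by (intro power_mono) auto
      then show ?thesis
        using l by (simp add: powr_minus powr_numeral field_simps power2_eq_square)
    qed
    then show "indicator {\<xi>. l \<le> norm (fourier f \<xi>)} \<xi> \<le> ennreal (4 * l powr (- 2)) * ennreal ((norm (fourier g \<xi>))\<^sup>2)"
      by (auto simp: indicator_def ennreal_mult[symmetric] ennreal_1[symmetric] simp del: ennreal_1 intro!: ennreal_leI)
  qed
  also have "\<dots> = ennreal (4 * l powr (- 2)) * (\<integral>\<^sup>+ \<xi>. ennreal ((norm (fourier g \<xi>))\<^sup>2) \<partial>lborel)"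
    by (rule nn_integral_cmult) measurable
  also have "\<dots> \<le> ennreal (4 * l powr (- 2)) * (ennreal (?K\<^sup>2) * (\<integral>\<^sup>+ x. ennreal ((norm (g x))\<^sup>2) \<partial>lborel))"
    by (intro mult_left_mono plancherel_le gi g2) simp
  also have "\<dots> = ennreal (4 * ?K\<^sup>2 * l powr (- 2)) * (\<integral>\<^sup>+ x. ennreal ((norm (g x))\<^sup>2) \<partial>lborel)"
    by (subst mult.assoc[symmetric], subst ennreal_mult[symmetric]) (simp_all add: mult_ac)
  also have "(\<integral>\<^sup>+ x. ennreal ((norm (g x))\<^sup>2) \<partial>lborel) = (\<integral>\<^sup>+ x. ennreal ((norm (f x))\<^sup>2) * indicator S x \<partial>lborel)"
    by (intro nn_integral_cong) (auto simp: g_def indicator_def)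
  finally show ?thesis
    by (simp add: S_def)
qed

text \<open>The layer-cake formula in the style of Marcinkiewicz. After
  \<open>fourier_level_set\<close> is inserted and the integrals are exchanged, the heights l that
  count for a given x form the interval from 0 to 2 |f x|^(1-p), on which l^(q-3) is integrable
  because q > 2. The factor 1 / (q - 2) blows up as p tends to 2, so p = 2 must come from
  Plancherel.\<close>

lemma hausdorff_young_normalized:
  fixes f :: "'a::euclidean_space \<Rightarrow> complex"
  assumes p: "1 < p" "p < 2" and q: "q = p / (p - 1)" and f: "integrable lborel f"
    and fp: "(\<integral>\<^sup>+ x. ennreal (norm (f x) powr p) \<partial>lborel) \<le> 1"
  shows "(\<integral>\<^sup>+ \<xi>. ennreal (norm (fourier f \<xi>) powr q) \<partial>lborel) \<le>
    ennreal (q * (4 * (gauss_total TYPE('a))\<^sup>2) * (2 powr (q - 2) / (q - 2)))"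
proof -
  let ?K = "4 * (gauss_total TYPE('a))\<^sup>2"
  let ?S = "\<lambda>l. {x. l * norm (f x) powr (p - 1) \<le> 2}"
  have fm [measurable]: "f \<in> borel_measurable borel"
    using f by auto
  have q2: "q > 2" "q > 0"
    using p by (auto simp: q field_simps)
  have "(\<integral>\<^sup>+ \<xi>. ennreal (norm (fourier f \<xi>) powr q) \<partial>lborel) =
     (\<integral>\<^sup>+ \<xi>. \<integral>\<^sup>+ l. ennreal q * (ennreal (l powr (q - 1)) * indicator {0..norm (fourier f \<xi>)} l) \<partial>lborel \<partial>lborel)"
    using q2 by (intro nn_integral_cong) (simp add: nn_integral_cmult nn_integral_powr_Icc ennreal_mult[symmetric])
  also have "\<dots> = (\<integral>\<^sup>+ \<xi>. \<integral>\<^sup>+ l. ennreal q * ennreal (l powr (q - 1)) * indicator {0..} l * indicator {\<xi>. l \<le> norm (fourier f \<xi>)} \<xi> \<partial>lborel \<partial>lborel)"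
    by (intro nn_integral_cong) (auto simp: indicator_def)
  also have "\<dots> = (\<integral>\<^sup>+ l. \<integral>\<^sup>+ \<xi>. ennreal q * ennreal (l powr (q - 1)) * indicator {0..} l * indicator {\<xi>. l \<le> norm (fourier f \<xi>)} \<xi> \<partial>lborel \<partial>lborel)"
    by (rule lborel_pair.Fubini'[symmetric]) (simp add: indicator_def split_beta')
  also have "\<dots> = (\<integral>\<^sup>+ l. ennreal q * ennreal (l powr (q - 1)) * indicator {0..} l * emeasure lborel {\<xi>. l \<le> norm (fourier f \<xi>)} \<partial>lborel)"
    by (intro nn_integral_cong, subst nn_integral_cmult_indicator) (auto intro: pred_Collect_borel)
  also have "\<dots> \<le> (\<integral>\<^sup>+ l. \<integral>\<^sup>+ x. ennreal (q * ?K) * (ennreal ((norm (f x))\<^sup>2) * (ennreal (l powr (q - 3)) * indicator {0..} l * indicator (?S l) x)) \<partial>lborel \<partial>lborel)"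
  proof (rule nn_integral_mono)
    fix l :: real
    show "ennreal q * ennreal (l powr (q - 1)) * indicator {0..} l * emeasure lborel {\<xi>. l \<le> norm (fourier f \<xi>)} \<le>
      (\<integral>\<^sup>+ x. ennreal (q * ?K) * (ennreal ((norm (f x))\<^sup>2) * (ennreal (l powr (q - 3)) * indicator {0..} l * indicator (?S l) x)) \<partial>lborel)"
    proof (cases "0 < l")
      case True
      have "ennreal q * ennreal (l powr (q - 1)) * indicator {0..} l * emeasure lborel {\<xi>. l \<le> norm (fourier f \<xi>)} \<le>
        ennreal q * ennreal (l powr (q - 1)) * indicator {0..} l * (ennreal (?K * l powr (- 2)) *
          (\<integral>\<^sup>+ x. ennreal ((norm (f x))\<^sup>2) * indicator (?S l) x \<partial>lborel))"
        by (intro mult_left_mono fourier_level_set[OF p(1) True f fp]) simp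
      also have "\<dots> = ennreal q * ennreal (l powr (q - 1)) * ennreal (?K * l powr (- 2)) *
          (\<integral>\<^sup>+ x. ennreal ((norm (f x))\<^sup>2) * indicator (?S l) x \<partial>lborel)"
        using True by (simp add: mult.assoc)
      also have "ennreal q * ennreal (l powr (q - 1)) * ennreal (?K * l powr (- 2)) = ennreal (q * ?K) * ennreal (l powr (q - 3))"
        using q2 True by (simp add: ennreal_mult[symmetric] powr_add[symmetric] mult_ac)
      also have "ennreal (q * ?K) * ennreal (l powr (q - 3)) * (\<integral>\<^sup>+ x. ennreal ((norm (f x))\<^sup>2) * indicator (?S l) x \<partial>lborel) =
        (\<integral>\<^sup>+ x. ennreal (q * ?K) * ennreal (l powr (q - 3)) * (ennreal ((norm (f x))\<^sup>2) * indicator (?S l) x) \<partial>lborel)"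
        by (rule nn_integral_cmult[symmetric]) measurable
      also have "\<dots> = (\<integral>\<^sup>+ x. ennreal (q * ?K) * (ennreal ((norm (f x))\<^sup>2) * (ennreal (l powr (q - 3)) * indicator {0..} l * indicator (?S l) x)) \<partial>lborel)"
        using True by (intro nn_integral_cong) (simp add: mult_ac)
      finally show ?thesis .
    next
      case False
      then show ?thesis
        \<comment> \<open>For l < 0 the indicator makes the left side vanish; for l = 0 it vanishes
          because \<open>0 powr (q - 1) = 0\<close>.\<close>
        by (cases "l = 0") auto
    qed
  qed
  also have "\<dots> = (\<integral>\<^sup>+ x. \<integral>\<^sup>+ l. ennreal (q * ?K) * (ennreal ((norm (f x))\<^sup>2) * (ennreal (l powr (q - 3)) * indicator {0..} l * indicator (?S l) x)) \<partial>lborel \<partial>lborel)"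
    by (rule lborel_pair.Fubini') (simp add: indicator_def split_beta')
  also have "\<dots> \<le> (\<integral>\<^sup>+ x. ennreal (q * ?K) * (ennreal (2 powr (q - 2) / (q - 2)) * ennreal (norm (f x) powr p)) \<partial>lborel)"
  proof (rule nn_integral_mono)
    fix x
    show "(\<integral>\<^sup>+ l. ennreal (q * ?K) * (ennreal ((norm (f x))\<^sup>2) * (ennreal (l powr (q - 3)) * indicator {0..} l * indicator (?S l) x)) \<partial>lborel) \<le>
      ennreal (q * ?K) * (ennreal (2 powr (q - 2) / (q - 2)) * ennreal (norm (f x) powr p))"
    proof (cases "f x = 0")
      case False
      let ?a = "norm (f x)"
      let ?L = "2 * ?a powr (1 - p)"
      have a: "?a > 0"
        using False by simp
      have "l * ?a powr (p - 1) \<le> 2 \<longleftrightarrow> l \<le> ?L" for l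
        using a by (simp add: powr_diff field_simps)
      then have "(\<integral>\<^sup>+ l. ennreal (q * ?K) * (ennreal ((norm (f x))\<^sup>2) * (ennreal (l powr (q - 3)) * indicator {0..} l * indicator (?S l) x)) \<partial>lborel) =
        (\<integral>\<^sup>+ l. ennreal (q * ?K) * (ennreal (?a\<^sup>2) * (ennreal (l powr (q - 3)) * indicator {0..?L} l)) \<partial>lborel)"
        by (intro nn_integral_cong) (simp add: indicator_def)
      also have "\<dots> = ennreal (q * ?K) * (ennreal (?a\<^sup>2) * ennreal (?L powr (q - 3 + 1) / (q - 3 + 1)))"
        using q2 by (subst nn_integral_powr_Icc[symmetric]) (auto simp: nn_integral_cmult)
      also have "ennreal (?a\<^sup>2) * ennreal (?L powr (q - 3 + 1) / (q - 3 + 1)) = ennreal (2 powr (q - 2) / (q - 2)) * ennreal (?a powr p)"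
      proof -
        have "?L powr (q - 2) = 2 powr (q - 2) * ?a powr ((1 - p) * (q - 2))"
          by (simp add: powr_mult powr_powr)
        \<comment> \<open>Duality enters here: (1 - p) q = - p, which makes the total exponent of |f
          x| equal to 2 + (p - 2) = p.\<close>
        also have "(1 - p) * (q - 2) = p - 2"
          using p by (simp add: q field_simps)
        finally have "?a\<^sup>2 * ?L powr (q - 2) = 2 powr (q - 2) * (?a\<^sup>2 * ?a powr (p - 2))"
          by simp
        also have "?a\<^sup>2 * ?a powr (p - 2) = ?a powr p"
          using a by (simp add: powr_diff powr_numeral)
        finally show ?thesis
          using q2 by (simp add: ennreal_mult[symmetric])
      qed
      finally show ?thesis by simp
    qed simp
  qed
  also have "\<dots> = ennreal (q * ?K) * (ennreal (2 powr (q - 2) / (q - 2)) * (\<integral>\<^sup>+ x. ennreal (norm (f x) powr p) \<partial>lborel))"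
    by (simp add: nn_integral_cmult)
  also have "\<dots> \<le> ennreal (q * ?K) * (ennreal (2 powr (q - 2) / (q - 2)) * 1)"
    using fp by (intro mult_left_mono) auto
  also have "\<dots> = ennreal (q * ?K * (2 powr (q - 2) / (q - 2)))"
    using q2 by (simp add: ennreal_mult[symmetric])
  finally show ?thesis .
qed

lemma fourier_cong_AE:
  fixes f g :: "'a::euclidean_space \<Rightarrow> complex"
  assumes [measurable]: "f \<in> borel_measurable lebesgue" "g \<in> borel_measurable lebesgue"
    and "AE x in lborel. f x = g x"
  shows "fourier f \<xi> = fourier g \<xi>"
proof -
  have [measurable]: "(\<lambda>x::'a. x) \<in> measurable lebesgue borel"
    by (simp add: measurable_completion)
  show ?thesis
    unfolding fourier_def using assms(3)
    by (intro integral_cong_AE) (auto simp: AE_completion_iff, measurable)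
qed

text \<open>Homogeneity removes the normalization for p < 2. A function of norm 0 cannot be
  normalized, but it vanishes almost everywhere and so its transform is identically 0.\<close>

lemma hausdorff_young_borel:
  assumes p: "1 < p" "p \<le> 2"
  shows "\<exists>C>0. \<forall>f :: 'a::euclidean_space \<Rightarrow> complex. integrable lborel f \<longrightarrow> Lp_norm p f < \<infinity> \<longrightarrow>
    Lp_norm (p / (p - 1)) (fourier f) \<le> ennreal C * Lp_norm p f"
proof (cases "p = 2")
  case True
  show ?thesis
  proof (intro exI conjI allI impI)
    show "gauss_total TYPE('a) > 0"
      by (rule gauss_total_pos)
    fix f :: "'a \<Rightarrow> complex" assume f: "integrable lborel f" "Lp_norm p f < \<infinity>"
    then have [measurable]: "f \<in> borel_measurable borel"
      by auto
    have pw: "norm z powr 2 = (norm z)\<^sup>2" for z :: complex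
      by (cases "z = 0") (auto simp: powr_numeral)
    have "integrable lborel (\<lambda>x. (norm (f x))\<^sup>2)"
      using f(2) by (simp add: integrable_iff_bounded Lp_norm_lborel enn_powr_less_top_iff True pw)
    then have "enn_powr (\<integral>\<^sup>+ \<xi>. ennreal ((norm (fourier f \<xi>))\<^sup>2) \<partial>lborel) (1 / 2) \<le>
      enn_powr (ennreal ((gauss_total TYPE('a))\<^sup>2) * (\<integral>\<^sup>+ x. ennreal ((norm (f x))\<^sup>2) \<partial>lborel)) (1 / 2)"
      by (intro enn_powr_mono plancherel_le f) auto
    also have "\<dots> = ennreal (((gauss_total TYPE('a))\<^sup>2) powr (1 / 2)) * enn_powr (\<integral>\<^sup>+ x. ennreal ((norm (f x))\<^sup>2) \<partial>lborel) (1 / 2)"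
      by (intro enn_powr_cmult) auto
    also have "((gauss_total TYPE('a))\<^sup>2) powr (1 / 2) = gauss_total TYPE('a)"
      using gauss_total_pos[of "TYPE('a)"] by (simp add: powr_half_sqrt)
    finally show "Lp_norm (p / (p - 1)) (fourier f) \<le> ennreal (gauss_total TYPE('a)) * Lp_norm p f"
      by (simp add: True Lp_norm_lborel pw)
  qed
next
  case False
  define q where "q = p / (p - 1)"
  define C where "C = q * (4 * (gauss_total TYPE('a))\<^sup>2) * (2 powr (q - 2) / (q - 2))"
  have q2: "q > 2"
    using p False by (auto simp: q_def field_simps)
  have C: "C > 0"
    unfolding C_def using q2 gauss_total_pos[of "TYPE('a)"] by simp
  show ?thesis
  proof (intro exI conjI allI impI)
    show "C powr (1 / q) > 0"
      using C by simp
    fix f :: "'a \<Rightarrow> complex" assume f: "integrable lborel f" and fin: "Lp_norm p f < \<infinity>"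
    then have fm [measurable]: "f \<in> borel_measurable borel"
      by auto
    obtain A where A: "Lp_norm p f = ennreal A" "A \<ge> 0"
      using fin by (cases "Lp_norm p f") auto
    have fl: "f \<in> borel_measurable lebesgue"
      by (simp add: measurable_completion)
    have "Lp_norm q (fourier f) \<le> ennreal (C powr (1 / q)) * Lp_norm p f"
    proof (cases "A = 0")
      case True
      have "(\<integral>\<^sup>+ x. ennreal (norm (f x) powr p) \<partial>lborel) = 0"
        using Lp_norm_eq_powr[of p f] p A True by (simp add: enn_powr_ennreal[of 0, simplified])
      then have "AE x in lborel. f x = 0"
        by (simp add: nn_integral_0_iff_AE)
      then have "fourier f \<xi> = fourier (\<lambda>_. 0) \<xi>" for \<xi>
        using fl by (intro fourier_cong_AE) auto
      then have "fourier f \<xi> = 0" for \<xi>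
        by (simp add: fourier_def)
      then show ?thesis
        using q2 by (simp add: Lp_norm_def enn_powr_ennreal[of 0, simplified])
    next
      case False
      define g where "g x = complex_of_real (1 / A) * f x" for x
      have gi: "integrable lborel g"
        using f by (simp add: g_def[abs_def])
      have g: "Lp_norm p g = 1"
        unfolding g_def[abs_def] using p A False fl
        by (subst Lp_norm_cmult) (auto simp: ennreal_mult[symmetric] norm_divide)
      have "(\<integral>\<^sup>+ x. ennreal (norm (g x) powr p) \<partial>lborel) \<le> 1"
        using Lp_norm_eq_powr[of p g] p g by (simp add: enn_powr_ennreal[of 1, simplified])
      then have "(\<integral>\<^sup>+ \<xi>. ennreal (norm (fourier g \<xi>) powr q) \<partial>lborel) \<le> ennreal C"
        unfolding C_def using p \<open>p \<noteq> 2\<close> gi by (intro hausdorff_young_normalized[of p]) (auto simp: q_def)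
      then have "Lp_norm q (fourier g) \<le> enn_powr (ennreal C) (1 / q)"
        unfolding Lp_norm_lborel using q2 by (intro enn_powr_mono) auto
      then have 1: "Lp_norm q (fourier g) \<le> ennreal (C powr (1 / q))"
        using C by (simp add: enn_powr_ennreal)
      have "fourier f = (\<lambda>\<xi>. complex_of_real A * fourier g \<xi>)"
        using A False by (auto simp: fourier_def g_def mult.assoc)
      moreover have "fourier g \<in> borel_measurable lebesgue"
        using gi by (intro measurable_completion) auto
      ultimately have "Lp_norm q (fourier f) = ennreal A * Lp_norm q (fourier g)"
        using A q2 by (simp add: Lp_norm_cmult)
      also have "\<dots> \<le> ennreal A * ennreal (C powr (1 / q))"
        using 1 by (intro mult_left_mono) auto
      finally show ?thesis
        using A by (simp add: mult.commute)
    qed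
    then show "Lp_norm (p / (p - 1)) (fourier f) \<le> ennreal (C powr (1 / q)) * Lp_norm p f"
      by (simp add: q_def)
  qed
qed

subsection \<open>The spherical mean on Lebesgue spaces\<close>

lemma (in complete_measure) measurable_cong_AE':
  assumes g: "g \<in> measurable M N" and ae: "AE x in M. f x = g x" and f: "f \<in> space M \<rightarrow> space N"
  shows "f \<in> measurable M N"
proof (rule measurableI)
  show "f x \<in> space N" if "x \<in> space M" for x
    using that f by auto
  fix A assume A: "A \<in> sets N"
  show "f -` A \<inter> space M \<in> sets M"
  proof (rule in_sets_AE)
    show "AE x in M. x \<in> g -` A \<inter> space M \<longleftrightarrow> x \<in> f -` A \<inter> space M"
      using ae by eventually_elim auto
    show "g -` A \<inter> space M \<in> sets M"
      using g A by (rule measurable_sets)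
  qed auto
qed

lemma borel_measurable_lebesgue_cong_AE:
  fixes f g :: "'a::euclidean_space \<Rightarrow> complex"
  assumes "g \<in> borel_measurable lebesgue" "AE x in lborel. f x = g x"
  shows "f \<in> borel_measurable lebesgue"
  using assms by (intro complete_measure.measurable_cong_AE'[OF completion.complete_measure_axioms assms(1)])
    (auto simp: AE_completion_iff)

interpretation lborel_sphere: pair_sigma_finite lborel "sphere_prob :: 'a::euclidean_space measure"
  by (intro pair_sigma_finite.intro sigma_finite_lborel sphere_prob.sigma_finite_measure_axioms)

interpretation sphere_lborel: pair_sigma_finite "sphere_prob :: 'a::euclidean_space measure" lborel
  by (intro pair_sigma_finite.intro sigma_finite_lborel sphere_prob.sigma_finite_measure_axioms)

text \<open>Averaging over spheres preserves the integral, by Tonelli and translation invariance.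
  This one identity gives the transfer of null sets, the L^p bound for the mean and integrability on
  almost every sphere.\<close>

lemma nn_integral_sphere_translates:
  fixes g :: "'a::euclidean_space \<Rightarrow> ennreal"
  assumes [measurable]: "g \<in> borel_measurable borel"
  shows "(\<integral>\<^sup>+ x. \<integral>\<^sup>+ w. g (x + t *\<^sub>R w) \<partial>sphere_prob \<partial>lborel) = (\<integral>\<^sup>+ x. g x \<partial>lborel)"
proof -
  have "(\<integral>\<^sup>+ x. \<integral>\<^sup>+ w. g (x + t *\<^sub>R w) \<partial>sphere_prob \<partial>lborel) = (\<integral>\<^sup>+ w. \<integral>\<^sup>+ x. g (x + t *\<^sub>R w) \<partial>lborel \<partial>sphere_prob)"
    by (rule sphere_lborel.Fubini') simp
  also have "\<dots> = (\<integral>\<^sup>+ w. (\<integral>\<^sup>+ x. g x \<partial>lborel) \<partial>(sphere_prob :: 'a measure))"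
    by (simp add: nn_integral_lborel_translate)
  finally show ?thesis
    by (simp add: sphere_prob.emeasure_space_1[simplified])
qed

lemma spherical_mean_borel:
  fixes f :: "'a::euclidean_space \<Rightarrow> complex"
  assumes [measurable]: "f \<in> borel_measurable borel"
  shows "spherical_mean t f x = (LINT w|sphere_prob. f (x + t *\<^sub>R w))"
  unfolding spherical_mean_def
  using integral_surface_measure(1)[of "\<lambda>w. f (x + t *\<^sub>R w)"] integral_surface_measure(2)[where 'a='a, of "\<lambda>_. 0::real"]
  by simp

lemma borel_measurable_spherical_mean [measurable]:
  fixes f :: "'a::euclidean_space \<Rightarrow> complex"
  assumes [measurable]: "f \<in> borel_measurable borel"
  shows "spherical_mean t f \<in> borel_measurable borel"
  unfolding spherical_mean_borel[OF assms, abs_def] by measurable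

lemma AE_spherical_mean_cong:
  fixes f g :: "'a::euclidean_space \<Rightarrow> complex"
  assumes [measurable]: "g \<in> borel_measurable borel" and fg: "AE x in lborel. f x = g x"
  shows "AE x in lborel. spherical_mean t f x = spherical_mean t g x"
proof -
  from fg obtain N where N: "{x. f x \<noteq> g x} \<subseteq> N" "N \<in> sets borel" "emeasure lborel N = 0"
    by (auto elim!: AE_E)
  note [measurable] = N(2)
  \<comment> \<open>The sphere measures of the exceptional set integrate to its volume 0, so almost
    all of them are 0.\<close>
  have "(\<integral>\<^sup>+ x. \<integral>\<^sup>+ w. indicator N (x + t *\<^sub>R w) \<partial>sphere_prob \<partial>lborel) = 0"
    using N by (subst nn_integral_sphere_translates) auto
  then have "AE x in lborel. (\<integral>\<^sup>+ w. indicator N (x + t *\<^sub>R w) \<partial>sphere_prob) = 0"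
    by (subst (asm) nn_integral_0_iff_AE) auto
  then show ?thesis
  proof eventually_elim
    case (elim x)
    then have "AE w in sphere_prob. indicator N (x + t *\<^sub>R w) = (0 :: ennreal)"
      by (subst (asm) nn_integral_0_iff_AE) auto
    then have "AE w in sphere_prob. f (x + t *\<^sub>R w) = g (x + t *\<^sub>R w)"
      by eventually_elim (use N(1) in \<open>auto simp: indicator_def split: if_splits\<close>)
    then have ae: "AE w in surface_measure. f (x + t *\<^sub>R w) = g (x + t *\<^sub>R w)"
      by (rule AE_surface_measure)
    have gm: "(\<lambda>w. g (x + t *\<^sub>R w)) \<in> borel_measurable surface_measure"
    proof -
      have "(\<lambda>w. g (x + t *\<^sub>R w)) \<in> borel_measurable (restrict_space borel (sphere 0 1))"
        by (rule measurable_restrict_space1) measurable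
      then show ?thesis
        unfolding surface_measure_def by (intro measurable_completion) simp
    qed
    \<comment> \<open>On such a sphere \<open>f\<close> agrees with a Borel function off a null set;
      completeness is what makes it measurable there.\<close>
    have "complete_measure (surface_measure :: 'a measure)"
      unfolding surface_measure_def by (rule completion.complete_measure_axioms)
    then have "(\<lambda>w. f (x + t *\<^sub>R w)) \<in> borel_measurable surface_measure"
      by (rule complete_measure.measurable_cong_AE'[OF _ gm ae]) auto
    then show ?case
      unfolding spherical_mean_def using gm ae by (intro arg_cong2[where f=scaleR] integral_cong_AE refl)
  qed
qed

text \<open>A form of Jensen's inequality with a lossy constant, from \<open>a \<le> \<lambda> + \<lambda>\<^bsup>1-p\<^esup> a\<^bsup>p\<^esup>\<close>.\<close>

lemma (in prob_space) norm_integral_powr_le: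
  fixes f :: "'a \<Rightarrow> complex"
  assumes [measurable]: "f \<in> borel_measurable M" and p: "1 \<le> p"
  shows "ennreal (norm (integral\<^sup>L M f) powr p) \<le> ennreal (2 powr p) * (\<integral>\<^sup>+ x. ennreal (norm (f x) powr p) \<partial>M)"
proof (cases "integrable M f")
  case True
  let ?Y = "\<integral>\<^sup>+ x. ennreal (norm (f x) powr p) \<partial>M"
  show ?thesis
  proof (cases ?Y)
    case (real y)
    show ?thesis
    proof (cases "y = 0")
      case True
      then have "AE x in M. f x = 0"
        using real by (simp add: nn_integral_0_iff_AE)
      then have "integral\<^sup>L M f = integral\<^sup>L M (\<lambda>_. 0)"
        by (intro integral_cong_AE) auto
      then show ?thesis by simp
    next
      case False
      then have y: "y > 0"
        using real by simp
      \<comment> \<open>This threshold balances the two terms: both \<open>L\<close> and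
        \<open>L powr (1 - p) * y\<close> equal the p-th root of \<open>y\<close>, which leads to
        the factor 2.\<close>
      define L where "L = y powr (1 / p)"
      have L: "L > 0"
        using y by (simp add: L_def)
      have le: "a \<le> L + L powr (1 - p) * a powr p" if "a \<ge> 0" for a
      proof (cases "a \<le> L")
        case False
        then have "a = a powr (1 - p) * a powr p"
          using L by (simp add: powr_add[symmetric])
        also have "\<dots> \<le> L powr (1 - p) * a powr p"
          using False L p by (intro mult_right_mono powr_mono2') auto
        finally show ?thesis
          using L by linarith
      qed (use that in \<open>auto intro: add_increasing2\<close>)
      have "ennreal (norm (integral\<^sup>L M f)) \<le> (\<integral>\<^sup>+ x. ennreal (norm (f x)) \<partial>M)"
        using \<open>integrable M f\<close> by (rule integral_norm_bound_ennreal)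
      also have "\<dots> \<le> (\<integral>\<^sup>+ x. ennreal L + ennreal (L powr (1 - p)) * ennreal (norm (f x) powr p) \<partial>M)"
        using le L by (intro nn_integral_mono) (simp add: ennreal_mult[symmetric] ennreal_plus[symmetric] ennreal_leI del: ennreal_plus)
      also have "\<dots> = ennreal L + ennreal (L powr (1 - p)) * ?Y"
        by (simp add: nn_integral_add nn_integral_cmult emeasure_space_1)
      also have "\<dots> = ennreal (L + L powr (1 - p) * y)"
        using real L by (simp add: ennreal_mult[symmetric] ennreal_plus[symmetric] del: ennreal_plus)
      also have "L powr (1 - p) * y = L"
      proof -
        have "y = L powr p"
          using y p by (simp add: L_def powr_powr)
        then show ?thesis
          using L by (simp add: powr_add[symmetric])
      qed
      finally have "norm (integral\<^sup>L M f) \<le> 2 * L"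
        using L by simp
      then have "norm (integral\<^sup>L M f) powr p \<le> (2 * L) powr p"
        using p by (intro powr_mono2) auto
      also have "\<dots> = 2 powr p * y"
        using p y by (simp add: L_def powr_mult powr_powr)
      finally show ?thesis
        using real by (simp add: ennreal_mult[symmetric] ennreal_leI)
    qed
  qed (simp add: ennreal_mult_top)
\<comment> \<open>Without integrability the integral on the left is 0 by convention.\<close>
qed (simp add: not_integrable_integral_eq)

lemma Lp_norm_spherical_mean_borel:
  fixes f :: "'a::euclidean_space \<Rightarrow> complex"
  assumes [measurable]: "f \<in> borel_measurable borel" and p: "1 \<le> p"
  shows "Lp_norm p (spherical_mean t f) \<le> 2 * Lp_norm p f"
proof -
  have "(\<integral>\<^sup>+ x. ennreal (norm (spherical_mean t f x) powr p) \<partial>lborel) \<le>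
    (\<integral>\<^sup>+ x. ennreal (2 powr p) * (\<integral>\<^sup>+ w. ennreal (norm (f (x + t *\<^sub>R w)) powr p) \<partial>sphere_prob) \<partial>lborel)"
    unfolding spherical_mean_borel[OF assms(1)]
    using p by (intro nn_integral_mono sphere_prob.norm_integral_powr_le) auto
  also have "\<dots> = ennreal (2 powr p) * (\<integral>\<^sup>+ x. \<integral>\<^sup>+ w. ennreal (norm (f (x + t *\<^sub>R w)) powr p) \<partial>sphere_prob \<partial>lborel)"
    by (rule nn_integral_cmult) measurable
  also have "(\<integral>\<^sup>+ x. \<integral>\<^sup>+ w. ennreal (norm (f (x + t *\<^sub>R w)) powr p) \<partial>sphere_prob \<partial>lborel) = (\<integral>\<^sup>+ x. ennreal (norm (f x) powr p) \<partial>lborel)"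
    by (rule nn_integral_sphere_translates[where g="\<lambda>x. ennreal (norm (f x) powr p)"]) measurable
  finally have "Lp_norm p (spherical_mean t f) \<le> enn_powr (ennreal (2 powr p) * (\<integral>\<^sup>+ x. ennreal (norm (f x) powr p) \<partial>lborel)) (1 / p)"
    unfolding Lp_norm_lborel using p by (intro enn_powr_mono) auto
  also have "\<dots> = 2 * Lp_norm p f"
    unfolding Lp_norm_lborel using p by (subst enn_powr_cmult) (auto simp: powr_powr)
  finally show ?thesis .
qed

text \<open>On a probability space a <= 1 + a^p turns p-integrability into integrability. Without it
  the spherical mean could not be shown additive, because a non-integrable restriction is given the
  integral 0.\<close>

lemma AE_integrable_sphere:
  fixes f :: "'a::euclidean_space \<Rightarrow> complex"
  assumes [measurable]: "f \<in> borel_measurable borel" and p: "1 \<le> p" and fin: "Lp_norm p f < \<infinity>"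
  shows "AE x in lborel. integrable sphere_prob (\<lambda>w. f (x + t *\<^sub>R w))"
proof -
  have "(\<integral>\<^sup>+ x. \<integral>\<^sup>+ w. ennreal (norm (f (x + t *\<^sub>R w)) powr p) \<partial>sphere_prob \<partial>lborel) = (\<integral>\<^sup>+ x. ennreal (norm (f x) powr p) \<partial>lborel)"
    by (rule nn_integral_sphere_translates[where g="\<lambda>x. ennreal (norm (f x) powr p)"]) measurable
  also have "\<dots> < \<infinity>"
    using fin by (simp add: Lp_norm_lborel enn_powr_less_top_iff)
  finally have "AE x in lborel. (\<integral>\<^sup>+ w. ennreal (norm (f (x + t *\<^sub>R w)) powr p) \<partial>sphere_prob) \<noteq> \<infinity>"
    by (intro nn_integral_PInf_AE) auto
  then show ?thesis
  proof eventually_elim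
    case (elim x)
    have "(\<integral>\<^sup>+ w. ennreal (norm (f (x + t *\<^sub>R w))) \<partial>sphere_prob) \<le>
        (\<integral>\<^sup>+ w. ennreal 1 + ennreal (norm (f (x + t *\<^sub>R w)) powr p) \<partial>sphere_prob)"
    proof (rule nn_integral_mono)
      fix w
      have le: "a \<le> 1 + a powr p" if "a \<ge> 0" for a :: real
        using that p powr_mono[of 1 p a] by (cases "a \<le> 1") (auto intro: add_increasing2)
      then show "ennreal (norm (f (x + t *\<^sub>R w))) \<le> ennreal 1 + ennreal (norm (f (x + t *\<^sub>R w)) powr p)"
        by (subst ennreal_plus[symmetric]) (auto simp del: ennreal_plus intro!: ennreal_leI le)
    qed
    also have "\<dots> = 1 + (\<integral>\<^sup>+ w. ennreal (norm (f (x + t *\<^sub>R w)) powr p) \<partial>sphere_prob)"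
      by (subst nn_integral_add) (auto simp: sphere_prob.emeasure_space_1[simplified])
    also have "\<dots> < \<infinity>"
      using elim by (simp add: ennreal_add_less_top less_top)
    finally show ?case
      by (simp add: integrable_iff_bounded)
  qed
qed

text \<open>Translating \<open>f\<close> by t w multiplies its transform by exp (i t w . xi).
  Averaging over w produces \<open>sphere_cf\<close> at - t xi, and radial symmetry removes the
  sign.\<close>

lemma fourier_spherical_mean_borel:
  fixes f :: "real ^ 'n \<Rightarrow> complex"
  assumes f: "integrable lborel f"
  shows "fourier (spherical_mean t f) \<xi> = sphere_cf (t *\<^sub>R \<xi>) * fourier f \<xi>"
proof -
  have fm [measurable]: "f \<in> borel_measurable borel"
    using f by auto
  have "integrable (sphere_prob \<Otimes>\<^sub>M lborel) (\<lambda>(w, x). f (x + t *\<^sub>R w) * chi x \<xi>)"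
  proof (rule sphere_lborel.Fubini_integrable)
    have "(LINT x|lborel. norm (f (x + t *\<^sub>R w))) = (LINT x|lborel. norm (f x))" for w
      by (rule integral_lborel_translate) simp
    then show "integrable sphere_prob (\<lambda>w. LINT x|lborel. norm (case (w, x) of (w, x) \<Rightarrow> f (x + t *\<^sub>R w) * chi x \<xi>))"
      by (simp add: norm_mult)
    have "integrable lborel (\<lambda>x. f (x + t *\<^sub>R w) * chi x \<xi>)" for w
      by (intro integrable_mult_chi integrable_lborel_translate f)
    then show "AE w in sphere_prob. integrable lborel (\<lambda>x. case (w, x) of (w, x) \<Rightarrow> f (x + t *\<^sub>R w) * chi x \<xi>)"
      by simp
  qed measurable
  note pair = this
  have "fourier (spherical_mean t f) \<xi> = (LINT x|lborel. (LINT w|sphere_prob. f (x + t *\<^sub>R w) * chi x \<xi>))"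
    by (subst fourier_lborel) (simp_all add: spherical_mean_borel)
  also have "\<dots> = (LINT w|sphere_prob. (LINT x|lborel. f (x + t *\<^sub>R w) * chi x \<xi>))"
    using pair by (rule sphere_lborel.Fubini_integral)
  also have "\<dots> = (LINT w|sphere_prob. chi w (- (t *\<^sub>R \<xi>)) * fourier f \<xi>)"
  proof (intro Bochner_Integration.integral_cong refl)
    fix w
    have "chi w (- (t *\<^sub>R \<xi>)) * chi (x + t *\<^sub>R w) \<xi> = chi x \<xi>" for x
      by (simp add: exp_add[symmetric] inner_add_left algebra_simps)
    then have "(LINT x|lborel. f (x + t *\<^sub>R w) * chi x \<xi>) =
       (LINT x|lborel. chi w (- (t *\<^sub>R \<xi>)) * (f (x + t *\<^sub>R w) * chi (x + t *\<^sub>R w) \<xi>))"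
      by (intro Bochner_Integration.integral_cong refl) (metis mult.left_commute)
    also have "\<dots> = chi w (- (t *\<^sub>R \<xi>)) * (LINT x|lborel. f (x + t *\<^sub>R w) * chi (x + t *\<^sub>R w) \<xi>)"
      by (rule integral_mult_right_zero)
    also have "(LINT x|lborel. f (x + t *\<^sub>R w) * chi (x + t *\<^sub>R w) \<xi>) = fourier f \<xi>"
      unfolding fourier_lborel[OF fm] by (rule integral_lborel_translate[where f="\<lambda>x. f x * chi x \<xi>"]) measurable
    finally show "(LINT x|lborel. f (x + t *\<^sub>R w) * chi x \<xi>) = chi w (- (t *\<^sub>R \<xi>)) * fourier f \<xi>" .
  qed
  also have "\<dots> = sphere_cf (- (t *\<^sub>R \<xi>)) * fourier f \<xi>"
    unfolding sphere_cf_def by (rule integral_mult_left_zero)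
  finally show ?thesis
    using sphere_defect_radial(1)[of "- (t *\<^sub>R \<xi>)" "t *\<^sub>R \<xi>"] by simp
qed

section \<open>The operator that subtracts a function from its spherical mean\<close>

definition mean_diff :: "real \<Rightarrow> ('a::euclidean_space \<Rightarrow> complex) \<Rightarrow> 'a \<Rightarrow> complex" where
  "mean_diff t f x = spherical_mean t f x - f x"

lemma AE_mean_diff_cong:
  fixes f g :: "'a::euclidean_space \<Rightarrow> complex"
  assumes "g \<in> borel_measurable borel" "AE x in lborel. f x = g x"
  shows "AE x in lborel. mean_diff t f x = mean_diff t g x"
  using AE_spherical_mean_cong[OF assms, of t] assms(2)
  by eventually_elim (simp add: mean_diff_def)

lemma mean_diff_Lp:
  fixes f :: "'a::euclidean_space \<Rightarrow> complex"
  assumes f: "f \<in> Lp p" and p: "1 \<le> p"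
  shows "mean_diff t f \<in> Lp p" "Lp_norm p (mean_diff t f) \<le> 12 * Lp_norm p f"
proof -
  obtain g where g: "g \<in> borel_measurable borel" "AE x in lborel. f x = g x"
    using lebesgue_borel_representative[OF LpD(1)[OF f]] by blast
  note [measurable] = g(1)
  have gl: "g \<in> borel_measurable lebesgue" "spherical_mean t g \<in> borel_measurable lebesgue"
    by (auto intro!: measurable_completion)
  note fg = AE_mean_diff_cong[OF g, of t]
  have m: "mean_diff t f \<in> borel_measurable lebesgue"
    by (rule borel_measurable_lebesgue_cong_AE[OF _ fg]) (use gl in \<open>simp add: mean_diff_def[abs_def]\<close>)
  have "Lp_norm p (mean_diff t f) = Lp_norm p (mean_diff t g)"
    by (rule Lp_norm_cong_AE[OF fg])
  also have "\<dots> \<le> 4 * (Lp_norm p (spherical_mean t g) + Lp_norm p g)"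
    unfolding mean_diff_def[abs_def] by (rule Lp_norm_diff[OF gl(2,1) p])
  also have "\<dots> \<le> 4 * (2 * Lp_norm p g + Lp_norm p g)"
    by (intro mult_left_mono add_right_mono Lp_norm_spherical_mean_borel p) auto
  \<comment> \<open>The 12 is 4 (2 + 1): the loss in the triangle inequality, times the norm bound 2
    of the mean plus 1 for the function itself.\<close>
  also have "\<dots> = 12 * Lp_norm p g"
    by (simp add: distrib_left mult.assoc[symmetric] distrib_right[symmetric])
  also have "Lp_norm p g = Lp_norm p f"
    using g(2) by (intro Lp_norm_cong_AE) auto
  finally show le: "Lp_norm p (mean_diff t f) \<le> 12 * Lp_norm p f" .
  show "mean_diff t f \<in> Lp p"
    using m le_less_trans[OF le] LpD(2)[OF f] by (auto intro!: LpI simp: ennreal_mult_less_top)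
qed

lemma AE_mean_diff_diff:
  fixes f g :: "'a::euclidean_space \<Rightarrow> complex"
  assumes f: "f \<in> Lp p" and g: "g \<in> Lp p" and p: "1 \<le> p"
  shows "AE x in lborel. mean_diff t (\<lambda>x. f x - g x) x = mean_diff t f x - mean_diff t g x"
proof -
  obtain f' where f': "f' \<in> borel_measurable borel" "AE x in lborel. f x = f' x"
    using lebesgue_borel_representative[OF LpD(1)[OF f]] by blast
  obtain g' where g': "g' \<in> borel_measurable borel" "AE x in lborel. g x = g' x"
    using lebesgue_borel_representative[OF LpD(1)[OF g]] by blast
  note [measurable] = f'(1) g'(1)
  have fin: "Lp_norm p f' < \<infinity>" "Lp_norm p g' < \<infinity>"
    using LpD(2)[OF f] LpD(2)[OF g] Lp_norm_cong_AE[OF f'(2)] Lp_norm_cong_AE[OF g'(2)] by simp_all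
  have "AE x in lborel. f x - g x = f' x - g' x"
    using f'(2) g'(2) by eventually_elim simp
  from AE_mean_diff_cong[OF _ this, of t]
  have "AE x in lborel. mean_diff t (\<lambda>x. f x - g x) x = mean_diff t (\<lambda>x. f' x - g' x) x"
    by simp
  then show ?thesis
    using AE_mean_diff_cong[OF f', of t] AE_mean_diff_cong[OF g', of t]
      AE_integrable_sphere[OF f'(1) p fin(1), of t] AE_integrable_sphere[OF g'(1) p fin(2), of t]
    by eventually_elim (simp add: mean_diff_def spherical_mean_borel)
qed

lemma fourier_mean_diff:
  fixes f :: "real ^ 'n \<Rightarrow> complex"
  assumes f: "f \<in> Lp 1"
  shows "fourier (mean_diff t f) \<xi> = - complex_of_real (sphere_defect (t *\<^sub>R \<xi>)) * fourier f \<xi>"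
proof -
  obtain g where g: "g \<in> borel_measurable borel" "AE x in lborel. f x = g x"
    using lebesgue_borel_representative[OF LpD(1)[OF f]] by blast
  note [measurable] = g(1)
  have gl: "g \<in> borel_measurable lebesgue"
    by (auto intro!: measurable_completion)
  have "Lp_norm 1 g < \<infinity>"
    using LpD(2)[OF f] Lp_norm_cong_AE[OF g(2), of 1] by simp
  then have gi: "integrable lborel g"
    by (simp add: integrable_iff_bounded Lp_norm_lborel enn_powr_less_top_iff)
  have "g \<in> Lp 1"
    using gi gl by (simp add: Lp1_iff_integrable integrable_completion)
  then have "mean_diff t g \<in> Lp 1"
    by (rule mean_diff_Lp) simp
  \<comment> \<open>Integrability of the spherical mean itself is recovered by adding
    \<open>g\<close> back to the difference, which is already known to be in L^1.\<close>
  have "integrable lborel (\<lambda>x. mean_diff t g x + g x)"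
  proof (rule Bochner_Integration.integrable_add[OF _ gi])
    show "integrable lborel (mean_diff t g)"
      using \<open>mean_diff t g \<in> Lp 1\<close>
      by (subst (asm) Lp1_iff_integrable, subst (asm) integrable_completion) (auto simp: mean_diff_def[abs_def])
  qed
  then have mi: "integrable lborel (spherical_mean t g)"
    by (simp add: mean_diff_def)
  have "fourier (mean_diff t f) \<xi> = fourier (mean_diff t g) \<xi>"
    using LpD(1)[OF mean_diff_Lp(1)[OF f]] LpD(1)[OF \<open>mean_diff t g \<in> Lp 1\<close>] AE_mean_diff_cong[OF g]
    by (intro fourier_cong_AE) auto
  also have "\<dots> = fourier (spherical_mean t g) \<xi> - fourier g \<xi>"
    unfolding mean_diff_def[abs_def]
    by (subst (1 2 3) fourier_lborel) (auto simp: left_diff_distrib integrable_mult_chi[OF mi, simplified] integrable_mult_chi[OF gi, simplified])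
  also have "\<dots> = - (1 - sphere_cf (t *\<^sub>R \<xi>)) * fourier g \<xi>"
    by (simp add: fourier_spherical_mean_borel[OF gi] algebra_simps)
  also have "fourier g \<xi> = fourier f \<xi>"
    using g gl LpD(1)[OF f] by (intro fourier_cong_AE) auto
  finally show ?thesis
    by (simp only: one_minus_sphere_cf)
qed

subsection \<open>Extension of the Fourier transform\<close>

lemma borel_measurable_fourier_lebesgue:
  fixes f :: "'a::euclidean_space \<Rightarrow> complex"
  assumes f: "f \<in> borel_measurable lebesgue"
  shows "fourier f \<in> borel_measurable borel"
proof -
  obtain g where g: "g \<in> borel_measurable borel" "AE x in lborel. f x = g x"
    using lebesgue_borel_representative[OF f] by blast
  have "fourier f = fourier g"
    using f g by (intro ext fourier_cong_AE) (auto intro!: measurable_completion)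
  then show ?thesis
    using g(1) by simp
qed

lemma lebesgue_measurable_fourier:
  fixes f :: "'a::euclidean_space \<Rightarrow> complex"
  assumes "f \<in> borel_measurable lebesgue"
  shows "fourier f \<in> borel_measurable lebesgue"
  using borel_measurable_fourier_lebesgue[OF assms] by (intro measurable_completion) simp

lemma fourier_diff:
  fixes f g :: "'a::euclidean_space \<Rightarrow> complex"
  assumes "f \<in> Lp 1" "g \<in> Lp 1"
  shows "fourier (\<lambda>x. f x - g x) \<xi> = fourier f \<xi> - fourier g \<xi>"
proof -
  have int: "integrable lebesgue (\<lambda>x. f x * chi x \<xi>)" if "f \<in> Lp 1" for f :: "'a \<Rightarrow> complex"
  proof (rule Bochner_Integration.integrable_bound)
    show "integrable lebesgue f"
      using that by (simp add: Lp1_iff_integrable)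
    have "(\<lambda>x. chi x \<xi>) \<in> borel_measurable lebesgue"
      by (rule measurable_completion) measurable
    then show "(\<lambda>x. f x * chi x \<xi>) \<in> borel_measurable lebesgue"
      using LpD(1)[OF that] by (rule borel_measurable_times[rotated])
  qed (simp add: norm_mult)
  show ?thesis
    unfolding fourier_def using int[OF assms(1)] int[OF assms(2)]
    by (simp add: left_diff_distrib)
qed

lemma hausdorff_young:
  assumes p: "1 < p" "p \<le> 2"
  shows "\<exists>C>0. \<forall>f :: 'a::euclidean_space \<Rightarrow> complex. f \<in> Lp 1 \<longrightarrow> f \<in> Lp p \<longrightarrow>
    Lp_norm (p / (p - 1)) (fourier f) \<le> ennreal C * Lp_norm p f"
proof -
  obtain C where C: "C > 0" "\<And>f :: 'a \<Rightarrow> complex. integrable lborel f \<Longrightarrow> Lp_norm p f < \<infinity> \<Longrightarrow>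
    Lp_norm (p / (p - 1)) (fourier f) \<le> ennreal C * Lp_norm p f"
    using hausdorff_young_borel[OF p, where 'a='a] by blast
  have "Lp_norm (p / (p - 1)) (fourier f) \<le> ennreal C * Lp_norm p f" if f: "f \<in> Lp 1" "f \<in> Lp p" for f :: "'a \<Rightarrow> complex"
  proof -
    obtain g where g: "g \<in> borel_measurable borel" "AE x in lborel. f x = g x"
      using lebesgue_borel_representative[OF LpD(1)[OF f(1)]] by blast
    have eq: "Lp_norm r f = Lp_norm r g" for r
      using g(2) by (rule Lp_norm_cong_AE)
    have "fourier f = fourier g"
      using f g by (intro ext fourier_cong_AE) (auto intro!: measurable_completion simp: LpD)
    moreover have "Lp_norm 1 g < \<infinity>" "Lp_norm p g < \<infinity>"
      using LpD(2)[OF f(1)] LpD(2)[OF f(2)] by (simp_all add: eq)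
    moreover from this(1) have "integrable lborel g"
      using g(1) by (simp add: integrable_iff_bounded Lp_norm_lborel enn_powr_less_top_iff)
    ultimately show ?thesis
      using C(2)[of g] by (simp add: eq)
  qed
  then show ?thesis
    using C(1) by blast
qed

text \<open>The bound on |x| puts the truncation in L^1. The bound on |f x| makes it a function to
  which the lower Plancherel inequality for bounded functions applies.\<close>

definition cutoff :: "nat \<Rightarrow> ('a::euclidean_space \<Rightarrow> complex) \<Rightarrow> 'a \<Rightarrow> complex" where
  "cutoff k f x = (if norm x \<le> real k \<and> norm (f x) \<le> real k then f x else 0)"

lemma norm_cutoff_le: "norm (cutoff k f x) \<le> norm (f x)" "norm (cutoff k f x) \<le> real k"
  by (auto simp: cutoff_def)

lemma borel_measurable_cutoff:
  assumes [measurable]: "f \<in> borel_measurable lebesgue"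
  shows "cutoff k f \<in> borel_measurable lebesgue"
proof -
  have [measurable]: "(norm :: 'a \<Rightarrow> real) \<in> borel_measurable lebesgue"
    by (rule measurable_completion) measurable
  show ?thesis
    unfolding cutoff_def[abs_def] by measurable
qed

lemma cutoff_Lp:
  fixes f :: "'a::euclidean_space \<Rightarrow> complex"
  assumes f: "f \<in> Lp p" and p: "0 < p"
  shows "cutoff k f \<in> Lp 1" "cutoff k f \<in> Lp p"
proof -
  have m: "cutoff k f \<in> borel_measurable lebesgue"
    using LpD(1)[OF f] by (rule borel_measurable_cutoff)
  have "Lp_norm p (cutoff k f) \<le> Lp_norm p f"
    using p by (intro Lp_norm_mono) (auto intro: norm_cutoff_le)
  then show "cutoff k f \<in> Lp p"
    using m LpD(2)[OF f] by (auto intro!: LpI)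
  have "integrable lebesgue (\<lambda>x. indicator (cball 0 (real k) :: 'a set) x *\<^sub>R real k)"
    using lmeasurable_cball[of "0::'a" "real k"] by (simp add: lmeasurable_iff_integrable)
  then have "integrable lebesgue (cutoff k f)"
    using m by (rule Bochner_Integration.integrable_bound) (auto simp: cutoff_def indicator_def)
  then show "cutoff k f \<in> Lp 1"
    by (simp add: Lp1_iff_integrable)
qed

lemma tendsto_Lp_norm_0:
  assumes "(\<lambda>k. \<integral>\<^sup>+ x. ennreal (norm (f k x) powr p) \<partial>lebesgue) \<longlonglongrightarrow> 0" and p: "0 < p"
  shows "(\<lambda>k. Lp_norm p (f k)) \<longlonglongrightarrow> 0"
proof (rule order_tendstoI)
  fix a :: ennreal assume "0 < a"
  then obtain b where "0 < b" "b < a"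
    using dense by blast
  then obtain d where d: "0 < d" "ennreal d < a"
    by (cases b) auto
  have "\<forall>\<^sub>F k in sequentially. (\<integral>\<^sup>+ x. ennreal (norm (f k x) powr p) \<partial>lebesgue) < ennreal (d powr p)"
    using d by (intro order_tendstoD(2)[OF assms(1)]) simp
  then show "\<forall>\<^sub>F k in sequentially. Lp_norm p (f k) < a"
  proof eventually_elim
    case (elim k)
    then have "Lp_norm p (f k) \<le> enn_powr (ennreal (d powr p)) (1 / p)"
      unfolding Lp_norm_def using p by (intro enn_powr_mono) auto
    also have "\<dots> = ennreal d"
      using p d by (simp add: enn_powr_ennreal powr_powr)
    finally show ?case
      using d by simp
  qed
qed simp

lemma cutoff_tendsto:
  fixes f :: "'a::euclidean_space \<Rightarrow> complex"
  assumes f: "f \<in> Lp p" and p: "0 < p"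
  shows "(\<lambda>k. Lp_norm p (\<lambda>x. cutoff k f x - f x)) \<longlonglongrightarrow> 0"
proof (rule tendsto_Lp_norm_0[OF _ p])
  have [measurable]: "f \<in> borel_measurable lebesgue" "\<And>k. cutoff k f \<in> borel_measurable lebesgue"
    using LpD(1)[OF f] borel_measurable_cutoff by auto
  have "(\<lambda>k. \<integral>\<^sup>+ x. ennreal (norm (cutoff k f x - f x) powr p) \<partial>lebesgue) \<longlonglongrightarrow> (\<integral>\<^sup>+ (x::'a). 0 \<partial>lebesgue)"
  proof (rule nn_integral_dominated_convergence[where w="\<lambda>x. ennreal (norm (f x) powr p)"])
    show "(\<integral>\<^sup>+ x. ennreal (norm (f x) powr p) \<partial>lebesgue) < \<infinity>"
      using LpD(2)[OF f] by (simp add: Lp_norm_def enn_powr_less_top_iff)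
    show "AE x in lebesgue. ennreal (norm (cutoff k f x - f x) powr p) \<le> ennreal (norm (f x) powr p)" for k
      by (auto simp: cutoff_def)
    show "AE x in lebesgue. (\<lambda>k. ennreal (norm (cutoff k f x - f x) powr p)) \<longlonglongrightarrow> 0"
    proof (rule AE_I2)
      fix x
      obtain N :: nat where N: "max (norm x) (norm (f x)) \<le> real N"
        using real_arch_simple by blast
      have "\<forall>\<^sub>F k in sequentially. ennreal (norm (cutoff k f x - f x) powr p) = 0"
        using eventually_ge_at_top[of N]
      proof eventually_elim
        case (elim k)
        then have "real N \<le> real k"
          by simp
        then show ?case
          using N by (auto simp: cutoff_def)
      qed
      then show "(\<lambda>k. ennreal (norm (cutoff k f x - f x) powr p)) \<longlonglongrightarrow> 0"
        by (rule tendsto_eventually)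
    qed
  qed auto
  then show "(\<lambda>k. \<integral>\<^sup>+ x. ennreal (norm (cutoff k f x - f x) powr p) \<partial>lebesgue) \<longlonglongrightarrow> 0"
    by simp
qed

text \<open>A rapidly Cauchy sequence in \<open>L\<^sup>q\<close> converges almost everywhere; weighting the differences
  by \<open>2\<^sup>k\<close> before summing their \<open>q\<close>-th powers avoids Minkowski's inequality.\<close>

lemma rapidly_Cauchy_AE_convergent:
  fixes h :: "nat \<Rightarrow> 'a::euclidean_space \<Rightarrow> complex"
  assumes [measurable]: "\<And>k. h k \<in> borel_measurable borel" and q: "1 \<le> q" and B: "0 \<le> B"
    and le: "\<And>k. Lp_norm q (\<lambda>x. h (Suc k) x - h k x) \<le> ennreal (B * (1 / 4) ^ k)"
  shows "AE x in lborel. convergent (\<lambda>k. h k x)"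
proof -
  define d where "d k x = (2 ^ k * norm (h (Suc k) x - h k x)) powr q" for k x
  have [measurable]: "d k \<in> borel_measurable borel" for k
    unfolding d_def[abs_def] by measurable
  have d: "(\<integral>\<^sup>+ x. ennreal (d k x) \<partial>lborel) \<le> ennreal (B powr q * (1 / 2) ^ k)" for k
  proof -
    have "(\<integral>\<^sup>+ x. ennreal (d k x) \<partial>lborel) = (\<integral>\<^sup>+ x. ennreal ((2 ^ k) powr q) * ennreal (norm (h (Suc k) x - h k x) powr q) \<partial>lborel)"
      by (simp add: d_def powr_mult ennreal_mult)
    also have "\<dots> = ennreal ((2 ^ k) powr q) * (\<integral>\<^sup>+ x. ennreal (norm (h (Suc k) x - h k x) powr q) \<partial>lborel)"
      by (rule nn_integral_cmult) measurable
    also have "\<dots> = ennreal ((2 ^ k) powr q) * enn_powr (Lp_norm q (\<lambda>x. h (Suc k) x - h k x)) q"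
      using q by (simp add: Lp_norm_eq_powr)
    also have "\<dots> \<le> ennreal ((2 ^ k) powr q) * enn_powr (ennreal (B * (1 / 4) ^ k)) q"
      using q by (intro mult_left_mono enn_powr_mono le) auto
    also have "\<dots> = ennreal ((2 ^ k * (B * (1 / 4) ^ k)) powr q)"
      using B by (simp add: enn_powr_ennreal ennreal_mult[symmetric] powr_mult)
    also have "2 ^ k * (B * (1 / 4) ^ k) = B * (1 / 2) ^ k"
    proof -
      have "(2::real) ^ k * (1 / 4) ^ k = (1 / 2) ^ k"
        by (simp add: power_mult_distrib[symmetric])
      then show ?thesis
        by (metis mult.left_commute)
    qed
    also have "ennreal ((B * (1 / 2) ^ k) powr q) = ennreal (B powr q * ((1 / 2) ^ k) powr q)"
      using B by (simp add: powr_mult)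
    also have "\<dots> \<le> ennreal (B powr q * ((1 / 2) ^ k) powr 1)"
      using q by (intro ennreal_leI mult_left_mono powr_mono') (auto simp: power_le_one)
    finally show ?thesis by simp
  qed
  have "(\<integral>\<^sup>+ x. (\<Sum>k. ennreal (d k x)) \<partial>lborel) = (\<Sum>k. \<integral>\<^sup>+ x. ennreal (d k x) \<partial>lborel)"
    by (rule nn_integral_suminf) measurable
  also have "\<dots> \<le> (\<Sum>k. ennreal (B powr q * (1 / 2) ^ k))"
    using d by (intro suminf_le) auto
  also have "\<dots> = ennreal (\<Sum>k. B powr q * (1 / 2) ^ k)"
    by (intro suminf_ennreal2 summable_mult summable_geometric) auto
  also have "\<dots> < \<infinity>"
    by simp
  finally have "AE x in lborel. (\<Sum>k. ennreal (d k x)) \<noteq> \<infinity>"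
    by (intro nn_integral_PInf_AE) auto
  then show ?thesis
  proof eventually_elim
    case (elim x)
    have dnn: "d k x \<ge> 0" for k
      by (simp add: d_def)
    have "summable (\<lambda>k. d k x)"
      using elim summable_iff_suminf_neq_top[of "\<lambda>k. d k x"] dnn by auto
    \<comment> \<open>Summability is used only through boundedness of the terms: taking q-th roots
      leaves increments of size at most K^(1/q) 2^(-k), which are summable.\<close>
    then have "Bseq (\<lambda>k. d k x)"
      using convergent_imp_Bseq summable_LIMSEQ_zero convergentI by blast
    then obtain K where K: "K > 0" "\<And>k. norm (d k x) \<le> K"
      by (auto elim: BseqE)
    have bd: "norm (h (Suc k) x - h k x) \<le> K powr (1 / q) * (1 / 2) ^ k" for k
    proof -
      have "d k x powr (1 / q) \<le> K powr (1 / q)"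
        using K(2)[of k] q dnn by (intro powr_mono2) auto
      moreover have "d k x powr (1 / q) = 2 ^ k * norm (h (Suc k) x - h k x)"
        using q by (simp add: d_def powr_powr)
      ultimately show ?thesis
        by (simp add: field_simps)
    qed
    have "summable (\<lambda>k. h (Suc k) x - h k x)"
      by (rule summable_comparison_test'[OF summable_mult[OF summable_geometric], of "1 / 2" 0 _ "K powr (1 / q)"]) (use bd in auto)
    then have "convergent (\<lambda>n. \<Sum>k<n. h (Suc k) x - h k x)"
      by (simp add: summable_iff_convergent)
    then have "convergent (\<lambda>n. h n x - h 0 x)"
      unfolding sum_lessThan_telescope[of "\<lambda>k. h k x"] .
    then show ?case
      using convergent_add_const_right_iff[of "\<lambda>n. h n x" "- h 0 x"] by simp
  qed
qed

text \<open>Completeness of L^q carried out for one sequence: truncations with errors at most 4^(-k)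
  have, by Hausdorff-Young, rapidly Cauchy transforms. These converge almost everywhere, and Fatou's
  lemma upgrades this to convergence in norm.\<close>

lemma is_fourier_Lp_exists:
  fixes f :: "'a::euclidean_space \<Rightarrow> complex"
  assumes f: "f \<in> Lp p" and p: "1 < p" "p \<le> 2"
  shows "\<exists>F. is_fourier_Lp p f F"
proof -
  define q where "q = p / (p - 1)"
  have q: "q \<ge> 1"
    using p by (simp add: q_def field_simps)
  obtain C where C: "C > 0" "\<And>f :: 'a \<Rightarrow> complex. f \<in> Lp 1 \<Longrightarrow> f \<in> Lp p \<Longrightarrow>
    Lp_norm q (fourier f) \<le> ennreal C * Lp_norm p f"
    using hausdorff_young[OF p, where 'a='a] unfolding q_def by blast
  have "\<exists>n. Lp_norm p (\<lambda>x. cutoff n f x - f x) \<le> ennreal ((1 / 4) ^ k)" for k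
  proof -
    have "\<forall>\<^sub>F n in sequentially. Lp_norm p (\<lambda>x. cutoff n f x - f x) < ennreal ((1 / 4) ^ k)"
      using p by (intro order_tendstoD(2)[OF cutoff_tendsto] f) (auto simp del: power_divide)
    then show ?thesis
      by (auto dest!: eventually_happens intro: less_imp_le)
  qed
  then obtain n where n: "\<And>k. Lp_norm p (\<lambda>x. cutoff (n k) f x - f x) \<le> ennreal ((1 / 4) ^ k)"
    by metis
  define g where "g k = cutoff (n k) f" for k
  have g: "g k \<in> Lp 1" "g k \<in> Lp p" for k
    using cutoff_Lp[OF f] p by (auto simp: g_def)
  have gm [measurable]: "fourier (g k) \<in> borel_measurable borel" for k
    using LpD(1)[OF g(1)] by (rule borel_measurable_fourier_lebesgue)
  \<comment> \<open>The triangle inequality bounds the distance of the m-th and k-th truncations by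
    4 (4^(-k) + 4^(-k)), hence the 8.\<close>
  define B where "B = C * 8"
  have B: "B > 0"
    using C by (simp add: B_def)
  have Cauchy: "Lp_norm q (\<lambda>\<xi>. fourier (g m) \<xi> - fourier (g k) \<xi>) \<le> ennreal (B * (1 / 4) ^ k)" if "k \<le> m" for k m
  proof -
    have "Lp_norm p (\<lambda>x. g m x - g k x) = Lp_norm p (\<lambda>x. (g m x - f x) - (g k x - f x))"
      by simp
    also have "\<dots> \<le> 4 * (Lp_norm p (\<lambda>x. g m x - f x) + Lp_norm p (\<lambda>x. g k x - f x))"
      using p by (intro Lp_norm_diff LpD(1)[OF Lp_diff[OF g(2) f]]) auto
    also have "\<dots> \<le> 4 * (ennreal ((1 / 4) ^ k) + ennreal ((1 / 4) ^ k))"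
    proof (intro mult_left_mono add_mono)
      have "Lp_norm p (\<lambda>x. g m x - f x) \<le> ennreal ((1 / 4) ^ m)"
        using n by (simp add: g_def)
      also have "\<dots> \<le> ennreal ((1 / 4) ^ k)"
        using that by (intro ennreal_leI power_decreasing) auto
      finally show "Lp_norm p (\<lambda>x. g m x - f x) \<le> ennreal ((1 / 4) ^ k)" .
    qed (use n in \<open>auto simp: g_def\<close>)
    also have "\<dots> = ennreal (8 * (1 / 4) ^ k)"
      by (simp add: ennreal_plus[symmetric] ennreal_mult[symmetric] ennreal_numeral[symmetric] del: ennreal_plus ennreal_numeral power_divide)
    finally have le: "Lp_norm p (\<lambda>x. g m x - g k x) \<le> ennreal (8 * (1 / 4) ^ k)" .
    have "Lp_norm q (\<lambda>\<xi>. fourier (g m) \<xi> - fourier (g k) \<xi>) = Lp_norm q (fourier (\<lambda>x. g m x - g k x))"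
      by (simp only: fourier_diff[OF g(1) g(1), abs_def])
    also have "\<dots> \<le> ennreal C * Lp_norm p (\<lambda>x. g m x - g k x)"
      using p by (intro C(2) Lp_diff g) auto
    also have "\<dots> \<le> ennreal C * ennreal (8 * (1 / 4) ^ k)"
      using le by (rule mult_left_mono) simp
    also have "\<dots> = ennreal (B * (1 / 4) ^ k)"
      using C(1) by (simp add: ennreal_mult[symmetric] B_def mult.assoc del: power_divide)
    finally show ?thesis .
  qed
  \<comment> \<open>Where the transforms diverge, \<open>lim\<close> takes a fixed default value;
    this keeps \<open>F\<close> Borel measurable and concerns only a null set.\<close>
  define F where "F \<xi> = lim (\<lambda>k. fourier (g k) \<xi>)" for \<xi>
  have [measurable]: "F \<in> borel_measurable borel"
    unfolding F_def[abs_def] by measurable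
  have "AE \<xi> in lborel. convergent (\<lambda>k. fourier (g k) \<xi>)"
    using q B Cauchy by (intro rapidly_Cauchy_AE_convergent[of _ q B]) auto
  then have F: "AE \<xi> in lborel. (\<lambda>k. fourier (g k) \<xi>) \<longlonglongrightarrow> F \<xi>"
    by eventually_elim (simp add: F_def convergent_LIMSEQ_iff)
  have Fk: "Lp_norm q (\<lambda>\<xi>. fourier (g k) \<xi> - F \<xi>) \<le> ennreal (B * (1 / 4) ^ k)" for k
  proof -
    let ?b = "enn_powr (ennreal (B * (1 / 4) ^ k)) q"
    have "(\<integral>\<^sup>+ \<xi>. ennreal (norm (fourier (g k) \<xi> - F \<xi>) powr q) \<partial>lborel) =
      (\<integral>\<^sup>+ \<xi>. liminf (\<lambda>m. ennreal (norm (fourier (g m) \<xi> - fourier (g k) \<xi>) powr q)) \<partial>lborel)"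
    proof (rule nn_integral_cong_AE)
      show "AE \<xi> in lborel. ennreal (norm (fourier (g k) \<xi> - F \<xi>) powr q) =
        liminf (\<lambda>m. ennreal (norm (fourier (g m) \<xi> - fourier (g k) \<xi>) powr q))"
        using F
      proof eventually_elim
        case (elim \<xi>)
        have "(\<lambda>m. ennreal (norm (fourier (g m) \<xi> - fourier (g k) \<xi>) powr q)) \<longlonglongrightarrow> ennreal (norm (F \<xi> - fourier (g k) \<xi>) powr q)"
          using q by (intro tendsto_ennrealI tendsto_powr' tendsto_intros elim) auto
        then show ?case
          using lim_imp_Liminf[OF sequentially_bot] by (metis norm_minus_commute)
      qed
    qed
    also have "\<dots> \<le> liminf (\<lambda>m. \<integral>\<^sup>+ \<xi>. ennreal (norm (fourier (g m) \<xi> - fourier (g k) \<xi>) powr q) \<partial>lborel)"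
      by (rule nn_integral_liminf) measurable
    also have "\<dots> \<le> liminf (\<lambda>m::nat. ?b)"
    proof (rule Liminf_mono)
      show "\<forall>\<^sub>F m in sequentially. (\<integral>\<^sup>+ \<xi>. ennreal (norm (fourier (g m) \<xi> - fourier (g k) \<xi>) powr q) \<partial>lborel) \<le> ?b"
        using eventually_ge_at_top[of k]
      proof eventually_elim
        case (elim m)
        show ?case
          using q Cauchy[OF elim] by (subst Lp_norm_eq_powr) (auto intro!: enn_powr_mono)
      qed
    qed
    also have "\<dots> = ?b"
      by (simp add: Liminf_const)
    finally have "Lp_norm q (\<lambda>\<xi>. fourier (g k) \<xi> - F \<xi>) \<le> enn_powr ?b (1 / q)"
      unfolding Lp_norm_lborel using q by (intro enn_powr_mono) auto
    also have "\<dots> = ennreal (B * (1 / 4) ^ k)"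
      using q B by (simp add: enn_powr_ennreal powr_powr)
    finally show ?thesis .
  qed
  have lim: "(\<lambda>k. Lp_norm q (\<lambda>\<xi>. fourier (g k) \<xi> - F \<xi>)) \<longlonglongrightarrow> 0"
  proof (rule tendsto_sandwich[OF _ _ tendsto_const])
    show "\<forall>\<^sub>F k in sequentially. Lp_norm q (\<lambda>\<xi>. fourier (g k) \<xi> - F \<xi>) \<le> ennreal (B * (1 / 4) ^ k)"
      using Fk by simp
    have "(\<lambda>k. ennreal (B * (1 / 4) ^ k)) \<longlonglongrightarrow> ennreal (B * 0)"
      by (intro tendsto_ennrealI tendsto_intros LIMSEQ_power_zero) auto
    then show "(\<lambda>k. ennreal (B * (1 / 4) ^ k)) \<longlonglongrightarrow> 0"
      by simp
  qed simp
  have gl: "fourier (g k) \<in> borel_measurable lebesgue" and Fl: "F \<in> borel_measurable lebesgue" for k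
    by (auto intro!: measurable_completion)
  have "fourier (g 0) \<in> Lp q"
  proof (rule LpI[OF gl])
    have "Lp_norm q (fourier (g 0)) \<le> ennreal C * Lp_norm p (g 0)"
      by (intro C(2) g)
    also have "\<dots> < \<infinity>"
      using LpD(2)[OF g(2), of 0] by (simp add: ennreal_mult_less_top)
    finally show "Lp_norm q (fourier (g 0)) < \<infinity>" .
  qed
  moreover have "(\<lambda>\<xi>. fourier (g 0) \<xi> - F \<xi>) \<in> Lp q"
    using gl Fl le_less_trans[OF Fk[of 0]] by (intro LpI) auto
  \<comment> \<open>\<open>F\<close> is in L^q as the difference of the first transform and its
    error, both of which have finite norm.\<close>
  ultimately have "(\<lambda>\<xi>. fourier (g 0) \<xi> - (fourier (g 0) \<xi> - F \<xi>)) \<in> Lp q"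
    using q by (rule Lp_diff)
  then have "F \<in> Lp q"
    by simp
  moreover have "(\<lambda>k. Lp_norm p (\<lambda>x. g k x - f x)) \<longlonglongrightarrow> 0"
  proof (rule tendsto_sandwich[OF _ _ tendsto_const])
    show "\<forall>\<^sub>F k in sequentially. Lp_norm p (\<lambda>x. g k x - f x) \<le> ennreal ((1 / 4) ^ k)"
      using n by (simp add: g_def)
    have "(\<lambda>k. ennreal ((1 / 4) ^ k)) \<longlonglongrightarrow> ennreal 0"
      by (intro tendsto_ennrealI LIMSEQ_power_zero) auto
    then show "(\<lambda>k. ennreal ((1 / 4) ^ k)) \<longlonglongrightarrow> 0"
      by simp
  qed simp
  ultimately show ?thesis
    using g lim unfolding is_fourier_Lp_def q_def by blast
qed

lemma is_fourier_Lp_fourier_Lp: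
  fixes f :: "'a::euclidean_space \<Rightarrow> complex"
  assumes "f \<in> Lp p" "1 < p" "p \<le> 2"
  shows "is_fourier_Lp p f (fourier_Lp p f)"
  unfolding fourier_Lp_def using is_fourier_Lp_exists[OF assms] by (rule someI_ex)

text \<open>Truncation extends the bound from bounded functions. The transform of the truncation
  error is controlled by the upper inequality and disappears in the limit; the 16 is the product of
  the two triangle losses.\<close>

lemma plancherel_ge:
  "\<exists>C>0. \<forall>f :: 'a::euclidean_space \<Rightarrow> complex. f \<in> Lp 1 \<longrightarrow> f \<in> Lp 2 \<longrightarrow>
    Lp_norm 2 f \<le> ennreal C * Lp_norm 2 (fourier f)"
proof -
  let ?K = "gauss_total TYPE('a)"
  have K: "?K > 0"
    by (rule gauss_total_pos)
  have pw: "norm z powr 2 = (norm z)\<^sup>2" for z :: complex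
    by (cases "z = 0") (auto simp: powr_numeral)
  obtain A where A: "A > 0" "\<And>f :: 'a \<Rightarrow> complex. f \<in> Lp 1 \<Longrightarrow> f \<in> Lp 2 \<Longrightarrow> Lp_norm 2 (fourier f) \<le> ennreal A * Lp_norm 2 f"
    using hausdorff_young[of 2, where 'a='a] by auto
  have bounded: "Lp_norm 2 f \<le> ennreal (1 / ?K) * Lp_norm 2 (fourier f)"
    if f: "f \<in> Lp 1" and b: "\<And>x. norm (f x) \<le> b" for f :: "'a \<Rightarrow> complex" and b
  proof -
    obtain g0 where g0: "g0 \<in> borel_measurable borel" "AE x in lborel. f x = g0 x"
      using lebesgue_borel_representative[OF LpD(1)[OF f]] by blast
    note [measurable] = g0(1)
    \<comment> \<open>A Borel representative respects the bound \<open>b\<close> only almost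
      everywhere; setting it to 0 elsewhere makes the bound hold at every point.\<close>
    define g where "g x = (if norm (g0 x) \<le> b then g0 x else 0)" for x
    have [measurable]: "g \<in> borel_measurable borel"
      unfolding g_def[abs_def] by measurable
    have fg: "AE x in lborel. f x = g x"
      using g0(2) by eventually_elim (metis b g_def)
    have "b \<ge> 0"
      using order_trans[OF norm_ge_zero b] .
    then have gb: "norm (g x) \<le> b" for x
      by (simp add: g_def)
    have "Lp_norm 1 g < \<infinity>"
      using LpD(2)[OF f] Lp_norm_cong_AE[OF fg, of 1] by simp
    then have gi: "integrable lborel g"
      by (simp add: integrable_iff_bounded Lp_norm_lborel enn_powr_less_top_iff)
    have "fourier f = fourier g"
      using LpD(1)[OF f] fg by (intro ext fourier_cong_AE) (auto intro!: measurable_completion)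
    moreover have "Lp_norm 2 f = Lp_norm 2 g"
      using fg by (rule Lp_norm_cong_AE)
    moreover have "Lp_norm 2 g \<le> ennreal (1 / ?K) * Lp_norm 2 (fourier g)"
    proof -
      have "ennreal (?K\<^sup>2 powr (1 / 2)) * Lp_norm 2 g = enn_powr (ennreal (?K\<^sup>2) * (\<integral>\<^sup>+ x. ennreal ((norm (g x))\<^sup>2) \<partial>lborel)) (1 / 2)"
        unfolding Lp_norm_lborel pw by (rule enn_powr_cmult[symmetric]) auto
      also have "\<dots> \<le> Lp_norm 2 (fourier g)"
        unfolding Lp_norm_lborel pw by (intro enn_powr_mono plancherel_ge_bounded[OF gi gb]) auto
      finally have "ennreal ?K * Lp_norm 2 g \<le> Lp_norm 2 (fourier g)"
        using K by (simp add: powr_half_sqrt)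
      then have "ennreal (1 / ?K) * (ennreal ?K * Lp_norm 2 g) \<le> ennreal (1 / ?K) * Lp_norm 2 (fourier g)"
        by (rule mult_left_mono) simp
      moreover have "ennreal (1 / ?K) * (ennreal ?K * Lp_norm 2 g) = Lp_norm 2 g"
        using K by (simp add: mult.assoc[symmetric] ennreal_mult[symmetric])
      ultimately show ?thesis by simp
    qed
    ultimately show ?thesis by simp
  qed
  have "Lp_norm 2 f \<le> ennreal (16 / ?K) * Lp_norm 2 (fourier f)" if f: "f \<in> Lp 1" "f \<in> Lp 2" for f :: "'a \<Rightarrow> complex"
  proof -
    let ?e = "\<lambda>k. Lp_norm 2 (\<lambda>x. cutoff k f x - f x)"
    have c: "cutoff k f \<in> Lp 1" "cutoff k f \<in> Lp 2" for k
      using cutoff_Lp[OF f(2)] by auto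
    have "Lp_norm 2 f \<le> 4 * (ennreal (1 / ?K) * (4 * (Lp_norm 2 (fourier f) + ennreal A * ?e k)) + ?e k)" for k
    proof -
      have "Lp_norm 2 f = Lp_norm 2 (\<lambda>x. cutoff k f x - (cutoff k f x - f x))"
        by simp
      also have "\<dots> \<le> 4 * (Lp_norm 2 (cutoff k f) + ?e k)"
        by (intro Lp_norm_diff LpD(1)[OF c(2)] LpD(1)[OF Lp_diff[OF c(2) f(2)]]) auto
      also have "\<dots> \<le> 4 * (ennreal (1 / ?K) * (4 * (Lp_norm 2 (fourier f) + ennreal A * ?e k)) + ?e k)"
      proof (intro mult_left_mono add_right_mono)
        have "Lp_norm 2 (cutoff k f) \<le> ennreal (1 / ?K) * Lp_norm 2 (fourier (cutoff k f))"
          by (rule bounded[OF c(1) norm_cutoff_le(2)])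
        also have "Lp_norm 2 (fourier (cutoff k f)) = Lp_norm 2 (\<lambda>\<xi>. fourier f \<xi> + fourier (\<lambda>x. cutoff k f x - f x) \<xi>)"
          by (simp add: fourier_diff c f)
        also have "\<dots> \<le> 4 * (Lp_norm 2 (fourier f) + Lp_norm 2 (fourier (\<lambda>x. cutoff k f x - f x)))"
          by (intro Lp_norm_add lebesgue_measurable_fourier LpD(1)[OF f(2)] LpD(1)[OF Lp_diff[OF c(2) f(2)]]) auto
        also have "\<dots> \<le> 4 * (Lp_norm 2 (fourier f) + ennreal A * ?e k)"
          by (intro mult_left_mono add_left_mono A(2) Lp_diff c f) auto
        finally show "Lp_norm 2 (cutoff k f) \<le> ennreal (1 / ?K) * (4 * (Lp_norm 2 (fourier f) + ennreal A * ?e k))"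
          by (simp add: mult_left_mono)
      qed auto
      finally show ?thesis .
    qed
    moreover have "(\<lambda>k. 4 * (ennreal (1 / ?K) * (4 * (Lp_norm 2 (fourier f) + ennreal A * ?e k)) + ?e k)) \<longlonglongrightarrow>
      4 * (ennreal (1 / ?K) * (4 * (Lp_norm 2 (fourier f) + ennreal A * 0)) + 0)"
      using cutoff_tendsto[OF f(2)] by (intro ennreal_tendsto_cmult tendsto_add tendsto_const) auto
    ultimately have "Lp_norm 2 f \<le> 4 * (ennreal (1 / ?K) * (4 * (Lp_norm 2 (fourier f) + ennreal A * 0)) + 0)"
      by (intro LIMSEQ_le_const) auto
    also have "\<dots> = ennreal (16 / ?K) * Lp_norm 2 (fourier f)"
    proof -
      have "ennreal (16 / ?K) = 4 * (ennreal (1 / ?K) * 4)"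
        using K by (simp add: ennreal_mult[symmetric] ennreal_numeral[symmetric] del: ennreal_numeral)
      then show ?thesis
        by (simp add: mult.assoc)
    qed
    finally show ?thesis .
  qed
  then show ?thesis
    using K by (intro exI[of _ "16 / ?K"]) auto
qed

subsection \<open>The multiplier estimates\<close>

lemma Lp_norm_multiplier_le:
  fixes F :: "'a::euclidean_space \<Rightarrow> complex"
  assumes F: "F \<in> borel_measurable lebesgue" and q: "0 < q" and c: "0 \<le> c"
    and le: "\<And>\<xi>. norm (u \<xi>) \<le> c * norm (v \<xi>)" and v: "v \<in> borel_measurable lebesgue"
  shows "Lp_norm q (\<lambda>\<xi>. u \<xi> * F \<xi>) \<le> ennreal c * Lp_norm q (\<lambda>\<xi>. v \<xi> * F \<xi>)"
proof -
  have "Lp_norm q (\<lambda>\<xi>. u \<xi> * F \<xi>) \<le> Lp_norm q (\<lambda>\<xi>. complex_of_real c * (v \<xi> * F \<xi>))"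
  proof (intro Lp_norm_mono AE_I2 q)
    fix \<xi>
    show "norm (u \<xi> * F \<xi>) \<le> norm (complex_of_real c * (v \<xi> * F \<xi>))"
      using mult_right_mono[OF le norm_ge_zero, of \<xi> "F \<xi>"] c by (simp add: norm_mult mult.assoc)
  qed
  also have "\<dots> = ennreal (norm (complex_of_real c)) * Lp_norm q (\<lambda>\<xi>. v \<xi> * F \<xi>)"
    using F v q by (intro Lp_norm_cmult borel_measurable_times) auto
  finally show ?thesis
    using c by simp
qed

text \<open>The symbol m(t xi) - 1 of the operator \<open>mean_diff t\<close>.\<close>

definition multiplier :: "real \<Rightarrow> 'a::euclidean_space \<Rightarrow> complex" where
  "multiplier t \<xi> = - complex_of_real (sphere_defect (t *\<^sub>R \<xi>))"

lemma borel_measurable_sphere_defect [measurable]: "sphere_defect \<in> borel_measurable borel"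
  unfolding sphere_defect_def[abs_def] by measurable

lemma borel_measurable_multiplier: "multiplier t \<in> borel_measurable lebesgue"
  unfolding multiplier_def[abs_def] by (rule measurable_completion) measurable

lemma sphere_defect_nonneg: "0 \<le> sphere_defect \<xi>"
  unfolding sphere_defect_def by (rule integral_nonneg_AE) simp

lemma norm_multiplier: "norm (multiplier t \<xi>) = sphere_defect (t *\<^sub>R \<xi>)"
  by (simp add: multiplier_def abs_of_nonneg[OF sphere_defect_nonneg])

lemma norm_multiplier_le: "norm (multiplier t \<xi>) \<le> 2"
  using sphere_defect_le[of "t *\<^sub>R \<xi>"] min.cobounded1[of 1 "(norm (t *\<^sub>R \<xi>))\<^sup>2"] unfolding norm_multiplier by linarith

lemma Lp_norm_multiplier_bounded:
  fixes F :: "'a::euclidean_space \<Rightarrow> complex"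
  assumes "F \<in> borel_measurable lebesgue" "0 < q"
  shows "Lp_norm q (\<lambda>\<xi>. multiplier t \<xi> * F \<xi>) \<le> 2 * Lp_norm q F"
proof -
  have "Lp_norm q (\<lambda>\<xi>. multiplier t \<xi> * F \<xi>) \<le> ennreal 2 * Lp_norm q (\<lambda>\<xi>. 1 * F \<xi>)"
    using assms norm_multiplier_le by (intro Lp_norm_multiplier_le) auto
  then show ?thesis by simp
qed

text \<open>Both estimates pass from the approximating sequence to its limit, because the multiplier is
  bounded and the mean difference is a bounded operator.\<close>

lemma multiplier_fourier_Lp_le:
  fixes f :: "real ^ 'n \<Rightarrow> complex"
  assumes f: "f \<in> Lp p" and p: "1 < p" and F: "is_fourier_Lp p f F" and C: "0 < C"
    and HY: "\<And>g :: real ^ 'n \<Rightarrow> complex. g \<in> Lp 1 \<Longrightarrow> g \<in> Lp p \<Longrightarrow> Lp_norm (p / (p - 1)) (fourier g) \<le> ennreal C * Lp_norm p g"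
  shows "Lp_norm (p / (p - 1)) (\<lambda>\<xi>. multiplier t \<xi> * F \<xi>) \<le> ennreal (16 * C) * Lp_norm p (mean_diff t f)"
proof -
  define q where "q = p / (p - 1)"
  have p1: "1 \<le> p"
    using p by simp
  have q: "q \<ge> 1"
    using p by (simp add: q_def field_simps)
  obtain g where g: "\<And>k. g k \<in> Lp 1" "\<And>k. g k \<in> Lp p"
    and gf: "(\<lambda>k. Lp_norm p (\<lambda>x. g k x - f x)) \<longlonglongrightarrow> 0"
    and gF: "(\<lambda>k. Lp_norm q (\<lambda>\<xi>. fourier (g k) \<xi> - F \<xi>)) \<longlonglongrightarrow> 0"
    using F unfolding is_fourier_Lp_def q_def by blast
  have FL: "F \<in> Lp q"
    using F unfolding is_fourier_Lp_def q_def by blast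
  note [measurable] = LpD(1)[OF FL] borel_measurable_multiplier[of t]
  have gm [measurable]: "fourier (g k) \<in> borel_measurable lebesgue" for k
    by (rule lebesgue_measurable_fourier[OF LpD(1)[OF g(1)]])
  let ?e = "\<lambda>k. Lp_norm p (\<lambda>x. g k x - f x)" and ?d = "\<lambda>k. Lp_norm q (\<lambda>\<xi>. fourier (g k) \<xi> - F \<xi>)"
  let ?D = "Lp_norm p (mean_diff t f)"
  \<comment> \<open>The 12 and the 2 are the operator bounds of \<open>mean_diff t\<close> and of
    the multiplier. Their terms tend to 0 with k, so that 4 * C * 4 survives as the
    constant.\<close>
  have "Lp_norm q (\<lambda>\<xi>. multiplier t \<xi> * F \<xi>) \<le> 4 * (ennreal C * (4 * (?D + 12 * ?e k)) + 2 * ?d k)" for k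
  proof -
    have "Lp_norm q (\<lambda>\<xi>. multiplier t \<xi> * F \<xi>) =
      Lp_norm q (\<lambda>\<xi>. multiplier t \<xi> * fourier (g k) \<xi> - multiplier t \<xi> * (fourier (g k) \<xi> - F \<xi>))"
      by (simp add: algebra_simps)
    also have "\<dots> \<le> 4 * (Lp_norm q (\<lambda>\<xi>. multiplier t \<xi> * fourier (g k) \<xi>) + Lp_norm q (\<lambda>\<xi>. multiplier t \<xi> * (fourier (g k) \<xi> - F \<xi>)))"
      using q by (intro Lp_norm_diff) measurable
    also have "\<dots> \<le> 4 * (ennreal C * (4 * (?D + 12 * ?e k)) + 2 * ?d k)"
    proof (intro mult_left_mono add_mono)
      have "Lp_norm q (\<lambda>\<xi>. multiplier t \<xi> * fourier (g k) \<xi>) = Lp_norm q (fourier (mean_diff t (g k)))"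
        by (simp only: fourier_mean_diff[OF g(1), abs_def] multiplier_def)
      also have "\<dots> \<le> ennreal C * Lp_norm p (mean_diff t (g k))"
        unfolding q_def using p by (intro HY mean_diff_Lp g) auto
      also have "\<dots> \<le> ennreal C * (4 * (?D + 12 * ?e k))"
      proof (rule mult_left_mono)
        have "AE x in lborel. mean_diff t (g k) x = mean_diff t f x + mean_diff t (\<lambda>x. g k x - f x) x"
          using AE_mean_diff_diff[OF g(2)[of k] f p1, where t=t] by eventually_elim simp
        then have "Lp_norm p (mean_diff t (g k)) = Lp_norm p (\<lambda>x. mean_diff t f x + mean_diff t (\<lambda>x. g k x - f x) x)"
          by (rule Lp_norm_cong_AE)
        also have "\<dots> \<le> 4 * (?D + Lp_norm p (mean_diff t (\<lambda>x. g k x - f x)))"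
          using p by (intro Lp_norm_add LpD(1)[OF mean_diff_Lp(1)[where p=p]] Lp_diff g f) auto
        also have "\<dots> \<le> 4 * (?D + 12 * ?e k)"
          using p by (intro mult_left_mono add_left_mono mean_diff_Lp(2) Lp_diff g f) auto
        finally show "Lp_norm p (mean_diff t (g k)) \<le> 4 * (?D + 12 * ?e k)" .
      qed simp
      finally show "Lp_norm q (\<lambda>\<xi>. multiplier t \<xi> * fourier (g k) \<xi>) \<le> ennreal C * (4 * (?D + 12 * ?e k))" .
      show "Lp_norm q (\<lambda>\<xi>. multiplier t \<xi> * (fourier (g k) \<xi> - F \<xi>)) \<le> 2 * ?d k"
        using q by (intro Lp_norm_multiplier_bounded) auto
    qed auto
    finally show ?thesis .
  qed
  moreover have "(\<lambda>k. 4 * (ennreal C * (4 * (?D + 12 * ?e k)) + 2 * ?d k)) \<longlonglongrightarrow> 4 * (ennreal C * (4 * (?D + 12 * 0)) + 2 * 0)"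
    using gf gF by (intro ennreal_tendsto_cmult tendsto_add tendsto_const) auto
  ultimately have "Lp_norm q (\<lambda>\<xi>. multiplier t \<xi> * F \<xi>) \<le> 4 * (ennreal C * (4 * (?D + 12 * 0)) + 2 * 0)"
    by (intro LIMSEQ_le_const) auto
  also have "\<dots> = ennreal (16 * C) * ?D"
    using C by (simp add: ennreal_mult mult_ac)
  finally show ?thesis
    by (simp add: q_def)
qed

lemma mean_diff_le_multiplier_fourier_L2:
  fixes f :: "real ^ 'n \<Rightarrow> complex"
  assumes f: "f \<in> Lp 2" and F: "is_fourier_Lp 2 f F" and C: "0 < C"
    and Plancherel: "\<And>g :: real ^ 'n \<Rightarrow> complex. g \<in> Lp 1 \<Longrightarrow> g \<in> Lp 2 \<Longrightarrow> Lp_norm 2 g \<le> ennreal C * Lp_norm 2 (fourier g)"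
  shows "Lp_norm 2 (mean_diff t f) \<le> ennreal (16 * C) * Lp_norm 2 (\<lambda>\<xi>. multiplier t \<xi> * F \<xi>)"
proof -
  obtain g where g: "\<And>k. g k \<in> Lp 1" "\<And>k. g k \<in> Lp 2"
    and gf: "(\<lambda>k. Lp_norm 2 (\<lambda>x. g k x - f x)) \<longlonglongrightarrow> 0"
    and gF: "(\<lambda>k. Lp_norm 2 (\<lambda>\<xi>. fourier (g k) \<xi> - F \<xi>)) \<longlonglongrightarrow> 0"
    using F unfolding is_fourier_Lp_def by auto
  have FL: "F \<in> Lp 2"
    using F unfolding is_fourier_Lp_def by simp
  note [measurable] = LpD(1)[OF FL] borel_measurable_multiplier[of t]
  have gm [measurable]: "fourier (g k) \<in> borel_measurable lebesgue" for k
    by (rule lebesgue_measurable_fourier[OF LpD(1)[OF g(1)]])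
  let ?e = "\<lambda>k. Lp_norm 2 (\<lambda>x. g k x - f x)" and ?d = "\<lambda>k. Lp_norm 2 (\<lambda>\<xi>. fourier (g k) \<xi> - F \<xi>)"
  let ?G = "Lp_norm 2 (\<lambda>\<xi>. multiplier t \<xi> * F \<xi>)"
  have "Lp_norm 2 (mean_diff t f) \<le> 4 * (ennreal C * (4 * (?G + 2 * ?d k)) + 12 * ?e k)" for k
  proof -
    have "AE x in lborel. mean_diff t f x = mean_diff t (g k) x - mean_diff t (\<lambda>x. g k x - f x) x"
      using AE_mean_diff_diff[OF g(2)[of k] f one_le_numeral, where t=t] by eventually_elim simp
    then have "Lp_norm 2 (mean_diff t f) = Lp_norm 2 (\<lambda>x. mean_diff t (g k) x - mean_diff t (\<lambda>x. g k x - f x) x)"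
      by (rule Lp_norm_cong_AE)
    also have "\<dots> \<le> 4 * (Lp_norm 2 (mean_diff t (g k)) + Lp_norm 2 (mean_diff t (\<lambda>x. g k x - f x)))"
      by (intro Lp_norm_diff LpD(1)[OF mean_diff_Lp(1)[where p=2]] Lp_diff g f) auto
    also have "\<dots> \<le> 4 * (ennreal C * (4 * (?G + 2 * ?d k)) + 12 * ?e k)"
    proof (intro mult_left_mono add_mono mean_diff_Lp(2) Lp_diff g f)
      have "Lp_norm 2 (mean_diff t (g k)) \<le> ennreal C * Lp_norm 2 (fourier (mean_diff t (g k)))"
        by (intro Plancherel mean_diff_Lp g) auto
      also have "Lp_norm 2 (fourier (mean_diff t (g k))) =
        Lp_norm 2 (\<lambda>\<xi>. multiplier t \<xi> * F \<xi> + multiplier t \<xi> * (fourier (g k) \<xi> - F \<xi>))"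
      proof -
        have "fourier (mean_diff t (g k)) = (\<lambda>\<xi>. multiplier t \<xi> * F \<xi> + multiplier t \<xi> * (fourier (g k) \<xi> - F \<xi>))"
          by (rule ext) (simp add: fourier_mean_diff[OF g(1)] multiplier_def algebra_simps)
        then show ?thesis by simp
      qed
      also have "ennreal C * \<dots> \<le> ennreal C * (4 * (?G + 2 * ?d k))"
      proof (rule mult_left_mono)
        have "Lp_norm 2 (\<lambda>\<xi>. multiplier t \<xi> * F \<xi> + multiplier t \<xi> * (fourier (g k) \<xi> - F \<xi>)) \<le>
          4 * (?G + Lp_norm 2 (\<lambda>\<xi>. multiplier t \<xi> * (fourier (g k) \<xi> - F \<xi>)))"
          by (intro Lp_norm_add) measurable
        also have "\<dots> \<le> 4 * (?G + 2 * ?d k)"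
          by (intro mult_left_mono add_left_mono Lp_norm_multiplier_bounded) auto
        finally show "Lp_norm 2 (\<lambda>\<xi>. multiplier t \<xi> * F \<xi> + multiplier t \<xi> * (fourier (g k) \<xi> - F \<xi>)) \<le> 4 * (?G + 2 * ?d k)" .
      qed simp
      finally show "Lp_norm 2 (mean_diff t (g k)) \<le> ennreal C * (4 * (?G + 2 * ?d k))" .
    qed auto
    finally show ?thesis .
  qed
  moreover have "(\<lambda>k. 4 * (ennreal C * (4 * (?G + 2 * ?d k)) + 12 * ?e k)) \<longlonglongrightarrow> 4 * (ennreal C * (4 * (?G + 2 * 0)) + 12 * 0)"
    using gf gF by (intro ennreal_tendsto_cmult tendsto_add tendsto_const) auto
  ultimately have "Lp_norm 2 (mean_diff t f) \<le> 4 * (ennreal C * (4 * (?G + 2 * 0)) + 12 * 0)"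
    by (intro LIMSEQ_le_const) auto
  also have "\<dots> = ennreal (16 * C) * ?G"
    using C by (simp add: ennreal_mult mult_ac)
  finally show ?thesis .
qed

section \<open>Comparison of the multiplier with the weight, and conclusion\<close>

definition weight :: "real \<Rightarrow> 'a::euclidean_space \<Rightarrow> complex" where
  "weight t \<xi> = complex_of_real (min 1 ((t * norm \<xi>)\<^sup>2))"

lemma norm_weight: "norm (weight t \<xi>) = min 1 ((t * norm \<xi>)\<^sup>2)"
  by (simp add: weight_def)

lemma borel_measurable_weight: "weight t \<in> borel_measurable lebesgue"
  unfolding weight_def[abs_def] by (rule measurable_completion) measurable

lemma weight_le_multiplier:
  fixes \<xi> :: "real ^ 'n"
  assumes "CARD('n) \<ge> 2"
  shows "norm (weight t \<xi>) \<le> 16 * real CARD('n) * norm (multiplier t \<xi>)"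
  using sphere_defect_ge[OF assms, of "t *\<^sub>R \<xi>"] by (simp add: norm_weight norm_multiplier field_simps power_mult_distrib)

lemma multiplier_le_weight: "norm (multiplier t \<xi>) \<le> 2 * norm (weight t \<xi>)"
  using sphere_defect_le[of "t *\<^sub>R \<xi>"] by (simp add: norm_weight norm_multiplier power_mult_distrib)

text \<open>The q-th power is increasing and fixes 1, so it commutes with \<open>min 1\<close>. Thus
  the weighted integral is an ordinary norm of a product.\<close>

lemma Lp_norm_weight:
  assumes t: "0 < t" and q: "0 < q"
  shows "enn_powr (\<integral>\<^sup>+ \<xi>. ennreal (min 1 ((t * norm \<xi>) powr (2 * q)) * norm (F \<xi>) powr q) \<partial>lebesgue) (1 / q) =
    Lp_norm q (\<lambda>\<xi>. weight t \<xi> * F \<xi>)"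
proof -
  have "min 1 ((t * norm \<xi>) powr (2 * q)) * norm (F \<xi>) powr q = norm (weight t \<xi> * F \<xi>) powr q" for \<xi>
  proof -
    let ?a = "(t * norm \<xi>)\<^sup>2"
    have "(t * norm \<xi>) powr (2 * q) = ?a powr q"
      using t by (cases "\<xi> = 0") (auto simp: powr_powr[symmetric] powr_numeral)
    moreover have "min 1 (?a powr q) = (min 1 ?a) powr q"
      using q powr_mono2[of q 1 ?a] powr_mono2[of q ?a 1] by (auto simp: min_def)
    ultimately show ?thesis
      by (simp add: norm_mult norm_weight powr_mult)
  qed
  then show ?thesis
    by (simp add: Lp_norm_def)
qed

lemma Lp_norm_weight_le:
  fixes f :: "real ^ 'n \<Rightarrow> complex"
  assumes n: "CARD('n) \<ge> 2" and p: "1 < p" "p \<le> 2"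
  shows "\<exists>C>0. \<forall>t. \<forall>f :: real ^ 'n \<Rightarrow> complex. f \<in> Lp p \<longrightarrow>
    Lp_norm (p / (p - 1)) (\<lambda>\<xi>. weight t \<xi> * fourier_Lp p f \<xi>) \<le> ennreal C * Lp_norm p (mean_diff t f)"
proof -
  obtain C where C: "C > 0" and HY: "\<And>g :: real ^ 'n \<Rightarrow> complex. g \<in> Lp 1 \<Longrightarrow> g \<in> Lp p \<Longrightarrow>
    Lp_norm (p / (p - 1)) (fourier g) \<le> ennreal C * Lp_norm p g"
    using hausdorff_young[OF p, where 'a="real ^ 'n"] by blast
  let ?c = "16 * real CARD('n)"
  have "Lp_norm (p / (p - 1)) (\<lambda>\<xi>. weight t \<xi> * fourier_Lp p f \<xi>) \<le> ennreal (?c * (16 * C)) * Lp_norm p (mean_diff t f)"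
    if f: "f \<in> Lp p" for t and f :: "real ^ 'n \<Rightarrow> complex"
  proof -
    note F = is_fourier_Lp_fourier_Lp[OF f p]
    have "fourier_Lp p f \<in> borel_measurable lebesgue"
      using F by (auto simp: is_fourier_Lp_def LpD)
    then have "Lp_norm (p / (p - 1)) (\<lambda>\<xi>. weight t \<xi> * fourier_Lp p f \<xi>) \<le> ennreal ?c * Lp_norm (p / (p - 1)) (\<lambda>\<xi>. multiplier t \<xi> * fourier_Lp p f \<xi>)"
      using p weight_le_multiplier[OF n] by (intro Lp_norm_multiplier_le borel_measurable_multiplier) auto
    also have "\<dots> \<le> ennreal ?c * (ennreal (16 * C) * Lp_norm p (mean_diff t f))"
      by (intro mult_left_mono multiplier_fourier_Lp_le[OF f p(1) F C] HY) auto
    also have "\<dots> = ennreal (?c * (16 * C)) * Lp_norm p (mean_diff t f)"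
      using C by (subst ennreal_mult) (auto simp: mult.assoc)
    finally show ?thesis .
  qed
  then show ?thesis
    using C by (intro exI[of _ "?c * (16 * C)"]) auto
qed

lemma mean_diff_L2_le:
  "\<exists>C>0. \<forall>t. \<forall>f :: real ^ 'n \<Rightarrow> complex. f \<in> Lp 2 \<longrightarrow>
    Lp_norm 2 (mean_diff t f) \<le> ennreal C * Lp_norm 2 (\<lambda>\<xi>. weight t \<xi> * fourier_Lp 2 f \<xi>)"
proof -
  obtain C where C: "C > 0" and P: "\<And>g :: real ^ 'n \<Rightarrow> complex. g \<in> Lp 1 \<Longrightarrow> g \<in> Lp 2 \<Longrightarrow>
    Lp_norm 2 g \<le> ennreal C * Lp_norm 2 (fourier g)"
    using plancherel_ge[where 'a="real ^ 'n"] by blast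
  have "Lp_norm 2 (mean_diff t f) \<le> ennreal (16 * C * 2) * Lp_norm 2 (\<lambda>\<xi>. weight t \<xi> * fourier_Lp 2 f \<xi>)"
    if f: "f \<in> Lp 2" for t and f :: "real ^ 'n \<Rightarrow> complex"
  proof -
    have F: "is_fourier_Lp 2 f (fourier_Lp 2 f)"
      using f by (intro is_fourier_Lp_fourier_Lp) auto
    then have "fourier_Lp 2 f \<in> borel_measurable lebesgue"
      by (auto simp: is_fourier_Lp_def LpD)
    then have "Lp_norm 2 (\<lambda>\<xi>. multiplier t \<xi> * fourier_Lp 2 f \<xi>) \<le> ennreal 2 * Lp_norm 2 (\<lambda>\<xi>. weight t \<xi> * fourier_Lp 2 f \<xi>)"
      using multiplier_le_weight by (intro Lp_norm_multiplier_le borel_measurable_weight) auto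
    then have "ennreal (16 * C) * Lp_norm 2 (\<lambda>\<xi>. multiplier t \<xi> * fourier_Lp 2 f \<xi>) \<le>
      ennreal (16 * C) * (ennreal 2 * Lp_norm 2 (\<lambda>\<xi>. weight t \<xi> * fourier_Lp 2 f \<xi>))"
      by (rule mult_left_mono) simp
    also have "\<dots> = ennreal (16 * C * 2) * Lp_norm 2 (\<lambda>\<xi>. weight t \<xi> * fourier_Lp 2 f \<xi>)"
      using C by (subst ennreal_mult[of "16 * C" 2]) (auto simp: mult.assoc)
    finally show ?thesis
      using mean_diff_le_multiplier_fourier_L2[OF f F C P, of t] by (rule order_trans[rotated])
  qed
  then show ?thesis
    using C by (intro exI[of _ "16 * C * 2"]) auto
qed

text \<open>The trivial bound for the transform, applied to the mean difference at one frequency; 16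
  n is the reciprocal of the constant in \<open>sphere_defect_ge\<close>.\<close>

lemma weight_fourier_L1_le:
  fixes f :: "real ^ 'n \<Rightarrow> complex"
  assumes n: "CARD('n) \<ge> 2" and f: "f \<in> Lp 1"
  shows "ennreal (min 1 ((t * norm \<xi>)\<^sup>2) * norm (fourier f \<xi>)) \<le> ennreal (16 * real CARD('n)) * Lp_norm 1 (mean_diff t f)"
proof -
  let ?c = "16 * real CARD('n)"
  have int: "integrable lebesgue (mean_diff t f)"
    using mean_diff_Lp(1)[OF f] by (simp add: Lp1_iff_integrable)
  have "(\<lambda>x. chi x \<xi>) \<in> borel_measurable lebesgue"
    by (rule measurable_completion) measurable
  then have int': "integrable lebesgue (\<lambda>x. mean_diff t f x * chi x \<xi>)"
    using int borel_measurable_integrable[OF int] by (intro Bochner_Integration.integrable_bound[OF int] borel_measurable_times) (auto simp: norm_mult)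
  have "min 1 ((t * norm \<xi>)\<^sup>2) * norm (fourier f \<xi>) \<le> ?c * norm (multiplier t \<xi>) * norm (fourier f \<xi>)"
    using weight_le_multiplier[OF n, of t \<xi>] by (intro mult_right_mono) (auto simp: norm_weight)
  also have "\<dots> = ?c * norm (fourier (mean_diff t f) \<xi>)"
    by (simp add: fourier_mean_diff[OF f] multiplier_def norm_mult)
  finally have "ennreal (min 1 ((t * norm \<xi>)\<^sup>2) * norm (fourier f \<xi>)) \<le> ennreal ?c * ennreal (norm (fourier (mean_diff t f) \<xi>))"
    by (subst ennreal_mult[symmetric]) (auto intro: ennreal_leI)
  also have "\<dots> \<le> ennreal ?c * (\<integral>\<^sup>+ x. ennreal (norm (mean_diff t f x * chi x \<xi>)) \<partial>lebesgue)"
    unfolding fourier_def by (intro mult_left_mono integral_norm_bound_ennreal int') simp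
  also have "(\<integral>\<^sup>+ x. ennreal (norm (mean_diff t f x * chi x \<xi>)) \<partial>lebesgue) = Lp_norm 1 (mean_diff t f)"
  proof -
    have "enn_powr x 1 = x" for x
      by (cases x) (auto simp: enn_powr_ennreal)
    then show ?thesis
      by (simp add: Lp_norm_def norm_mult)
  qed
  finally show ?thesis .
qed

theorem theorem2:
  fixes p :: real
  assumes "1 \<le> p" and "p \<le> 2" and "CARD('n::finite) \<ge> 2"
  shows "\<exists>C>0. \<exists>c>0. \<forall>t>0.
    (1 < p \<and> p < 2 \<longrightarrow>
      (\<forall>q::real. 1 / p + 1 / q = 1 \<longrightarrow> (\<forall>f :: real ^ 'n \<Rightarrow> complex. f \<in> Lp p \<longrightarrow>
        enn_powr (\<integral>\<^sup>+ \<xi>. ennreal (min 1 ((t * norm \<xi>) powr (2 * q)) *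
            norm (fourier_Lp p f \<xi>) powr q) \<partial>lebesgue) (1 / q)
          \<le> ennreal C * Lp_norm p (\<lambda>x. spherical_mean t f x - f x)))) \<and>
    (p = 1 \<longrightarrow>
      (\<forall>f :: real ^ 'n \<Rightarrow> complex. f \<in> Lp 1 \<longrightarrow>
        (SUP \<xi>. ennreal (min 1 ((t * norm \<xi>)\<^sup>2) * norm (fourier f \<xi>)))
          \<le> ennreal C * Lp_norm 1 (\<lambda>x. spherical_mean t f x - f x))) \<and>
    (p = 2 \<longrightarrow>
      (\<forall>f :: real ^ 'n \<Rightarrow> complex. f \<in> Lp 2 \<longrightarrow>
        ennreal c * Lp_norm 2 (\<lambda>x. spherical_mean t f x - f x)
          \<le> enn_powr (\<integral>\<^sup>+ \<xi>. ennreal (min 1 ((t * norm \<xi>) ^ 4) *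
              (norm (fourier_Lp 2 f \<xi>))\<^sup>2) \<partial>lebesgue) (1 / 2) \<and>
        enn_powr (\<integral>\<^sup>+ \<xi>. ennreal (min 1 ((t * norm \<xi>) ^ 4) *
              (norm (fourier_Lp 2 f \<xi>))\<^sup>2) \<partial>lebesgue) (1 / 2)
          \<le> ennreal C * Lp_norm 2 (\<lambda>x. spherical_mean t f x - f x)))"
proof -
  note n = assms(3)
  have D: "(\<lambda>x. spherical_mean t f x - f x) = mean_diff t f" for t and f :: "real ^ 'n \<Rightarrow> complex"
    by (simp add: mean_diff_def fun_eq_iff)
  consider "p = 1" | "1 < p" by (use assms(1) in linarith)
  then show ?thesis
  proof cases
    case 1
    \<comment> \<open>\<open>c\<close> is constrained only by the clause for p = 2, so any positive
      number is a witness for it here.\<close>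
    then show ?thesis
      unfolding D using n
      by (intro exI[of _ "16 * real CARD('n)"] conjI exI[of _ "1::real"]) (auto intro!: SUP_least weight_fourier_L1_le)
  next
    case 2
    obtain C where C: "C > 0" "\<And>t (f :: real ^ 'n \<Rightarrow> complex). f \<in> Lp p \<Longrightarrow>
      Lp_norm (p / (p - 1)) (\<lambda>\<xi>. weight t \<xi> * fourier_Lp p f \<xi>) \<le> ennreal C * Lp_norm p (mean_diff t f)"
      using Lp_norm_weight_le[OF n 2 assms(2)] by blast
    obtain B where B: "B > 0" "\<And>t (f :: real ^ 'n \<Rightarrow> complex). f \<in> Lp 2 \<Longrightarrow>
      Lp_norm 2 (mean_diff t f) \<le> ennreal B * Lp_norm 2 (\<lambda>\<xi>. weight t \<xi> * fourier_Lp 2 f \<xi>)"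
      using mean_diff_L2_le by blast
    \<comment> \<open>The upper bound for the mean difference, divided by its constant, is the lower
      half of the equivalence; this gives the witness 1 / B for \<open>c\<close>.\<close>
    have B': "ennreal (1 / B) * Lp_norm 2 (mean_diff t f) \<le> Lp_norm 2 (\<lambda>\<xi>. weight t \<xi> * fourier_Lp 2 f \<xi>)"
      if "f \<in> Lp 2" for t and f :: "real ^ 'n \<Rightarrow> complex"
    proof -
      have "ennreal (1 / B) * Lp_norm 2 (mean_diff t f) \<le> ennreal (1 / B) * (ennreal B * Lp_norm 2 (\<lambda>\<xi>. weight t \<xi> * fourier_Lp 2 f \<xi>))"
        using B(2)[OF that] by (rule mult_left_mono) simp
      also have "\<dots> = Lp_norm 2 (\<lambda>\<xi>. weight t \<xi> * fourier_Lp 2 f \<xi>)"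
        using B(1) by (simp add: mult.assoc[symmetric] ennreal_mult[symmetric])
      finally show ?thesis .
    qed
    have W2: "enn_powr (\<integral>\<^sup>+ \<xi>. ennreal (min 1 ((t * norm \<xi>) ^ 4) * (norm (F \<xi>))\<^sup>2) \<partial>lebesgue) (1 / 2) =
      Lp_norm 2 (\<lambda>\<xi>. weight t \<xi> * F \<xi>)" if t: "0 < t" for t and F :: "real ^ 'n \<Rightarrow> complex"
    proof -
      have "(t * norm \<xi>) powr (2 * 2) = (t * norm \<xi>) ^ 4" "norm (F \<xi>) powr 2 = (norm (F \<xi>))\<^sup>2" for \<xi>
        using t by (cases "\<xi> = 0"; cases "F \<xi> = 0"; simp add: powr_numeral)+
      then show ?thesis
        using Lp_norm_weight[OF t, of 2 F] by simp
    qed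
    have Wq: "enn_powr (\<integral>\<^sup>+ \<xi>. ennreal (min 1 ((t * norm \<xi>) powr (2 * q)) * norm (fourier_Lp p f \<xi>) powr q) \<partial>lebesgue) (1 / q)
      \<le> ennreal C * Lp_norm p (mean_diff t f)"
      if t: "0 < t" and q: "1 / p + 1 / q = 1" and f: "f \<in> Lp p" for t q and f :: "real ^ 'n \<Rightarrow> complex"
    proof -
      \<comment> \<open>With q = 0 the convention 1 / 0 = 0 would turn the relation into p =
        1.\<close>
      have "q \<noteq> 0"
        using q 2 by auto
      then have "q = p / (p - 1)"
        using q 2 by (simp add: field_simps)
      moreover from this have "0 < q"
        using 2 by simp
      ultimately show ?thesis
        using C(2)[OF f, of t] Lp_norm_weight[OF t, of q "fourier_Lp p f"] by simp
    qed
    show ?thesis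
      unfolding D
    proof (rule exI[of _ C], rule conjI[OF C(1)], rule exI[of _ "1 / B"], intro conjI allI impI)
      show "1 / B > 0"
        using B(1) by simp
    next
      fix t q :: real and f :: "real ^ 'n \<Rightarrow> complex"
      assume "0 < t" "1 / p + 1 / q = 1" "f \<in> Lp p"
      then show "enn_powr (\<integral>\<^sup>+ \<xi>. ennreal (min 1 ((t * norm \<xi>) powr (2 * q)) * norm (fourier_Lp p f \<xi>) powr q) \<partial>lebesgue) (1 / q)
        \<le> ennreal C * Lp_norm p (mean_diff t f)"
        by (rule Wq)
    next
      fix t :: real and f :: "real ^ 'n \<Rightarrow> complex"
      assume "0 < t" "p = 2" "f \<in> Lp 2"
      then show "ennreal (1 / B) * Lp_norm 2 (mean_diff t f) \<le>
        enn_powr (\<integral>\<^sup>+ \<xi>. ennreal (min 1 ((t * norm \<xi>) ^ 4) * (norm (fourier_Lp 2 f \<xi>))\<^sup>2) \<partial>lebesgue) (1 / 2)"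
        by (simp only: W2 B')
    next
      fix t :: real and f :: "real ^ 'n \<Rightarrow> complex"
      assume "0 < t" "p = 2" "f \<in> Lp 2"
      then show "enn_powr (\<integral>\<^sup>+ \<xi>. ennreal (min 1 ((t * norm \<xi>) ^ 4) * (norm (fourier_Lp 2 f \<xi>))\<^sup>2) \<partial>lebesgue) (1 / 2)
        \<le> ennreal C * Lp_norm 2 (mean_diff t f)"
        using C(2)[of f t] by (simp add: W2)
    qed (use 2 in auto)
  qed
qed

end
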